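(* Let $A\in\mathbb{R}^{n\times n}$, $B\in\mathbb{R}^{n\times m}$ with $(A,B)$ controllable. Let $G_0\in\mathbb{R}^{n\times n}$, $Y_0\in\mathbb{R}^{m\times n}$ satisfy $$AG_0+BY_0=G_0A+A,\qquad G_0B=\mathbf{0},$$ with $G_0-I_n$ invertible and such that $I_n+\mu' G_0$ is anti-Hurwitz for every $\mu'\in[-1,1/n]$. Put $K_0=Y_0(G_0-I_n)^{-1}$, $A_0=A+BK_0$, where $A_0$ is nilpotent. Fix $\mu\in[-1,1/n]$, put $G_{\mathbf d}=I_n+\mu G_0$, $\mathbf{d}(s)=e^{sG_{\mathbf d}}$, and let $\rho>0$, $X\in\mathbb{R}^{n\times n}$, $Y\in\mathbb{R}^{m\times n}$ satisfy $$XA_0^\top+A_0X+Y^\top B^\top+BY+\rho\,(XG_{\mathbf d}^\top+G_{\mathbf d}X)=\mathbf{0},\qquad XG_{\mathbf d}^\top+G_{\mathbf d}X\succ0,\qquad X\succ0.$$ Let $K=YX^{-1}$, $P=X^{-1}$, $\|x\|=\sqrt{x^\top Px}$, and let $\|\cdot\|_{\mathbf d}$ be the canonical homogeneous norm induced by $\|\cdot\|$. Put $$\overline{\eta}=\tfrac12\lambda_{\max}\big(P^{1/2}G_{\mathbf d}P^{-1/2}+P^{-1/2}G_{\mathbf d}^\top P^{1/2}\big),\qquad \underline{\eta}=\tfrac12\lambda_{\min}\big(P^{1/2}G_{\mathbf d}P^{-1/2}+P^{-1/2}G_{\mathbf d}^\top P^{1/2}\big).$$ For a quantizer $\mathfrak{q}:\mathbb{R}^n\to\mathcal{Q}$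 consider the closed-loop system $$\dot x=Ax+Bu(\mathfrak{q}(x)),\qquad u(z)=K_0z+\|z\|_{\mathbf d}^{1+\mu}K\,\mathbf{d}(-\ln\|z\|_{\mathbf d})\,z, \tag{S}$$ with solutions understood in the sense of Filippov. Then there exists $\epsilon_0>0$ such that for every $\epsilon\in(0,\epsilon_0)$ and every quantizer $\mathfrak{q}$ on $\mathbb{R}^n$ satisfying $$\|\mathfrak{q}(x)-x\|_{\mathbf d}\le\epsilon\|x\|_{\mathbf d}\qquad\forall x\in\mathbb{R}^n,$$ the following hold. (1) If $K_0=\mathbf{0}$, then the system (S) is globally uniformly finite-time stable when $\mu<0$, and globally uniformly nearly fixed-time stable when $\mu>0$. (2) If $K_0\ne\mathbf{0}$ and, additionally, for some $\kappa\in\mathbb{R}_+$, $$\|\mathfrak{q}(x)-x\|\le\kappa\|x\|\qquad\forall x\in\mathbb{R}^n,$$ then the system (S) is locally uniformly finite-time stable when $\mu<\min\{\underline{\eta}-1,0\}$, and globally uniformly practically fixed-time stable when $\mu>\max\{\overline{\eta}-1,0\}$.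
   Context: Notation: $\mathbb{R}_+=[0,\infty)$; $M\succ0$ means $M$ is symmetric positive definite; $\lambda_{\min},\lambda_{\max}$ are the extreme eigenvalues of a symmetric matrix; a matrix is anti-Hurwitz if all its eigenvalues have positive real part; $\mathcal{K}$ is the set of continuous strictly increasing functions $\alpha:\mathbb{R}_+\to\mathbb{R}_+$ with $\alpha(0)=0$. Quantizer on $\mathbb{R}^n$: given an index set $\Xi\subseteq\mathbb{N}$, non-empty pairwise disjoint sets $\mathcal{D}_i\subseteq\mathbb{R}^n$ ($i\in\Xi$) with $\bigcup_{i\in\Xi}\mathcal{D}_i=\mathbb{R}^n$, and points $q_i\in\mathcal{D}_i$, with $\mathcal{Q}=\{q_i\}_{i\in\Xi}$, the quantizer is the map $\mathfrak{q}:\mathbb{R}^n\to\mathcal{Q}$ with $\mathfrak{q}(x)=q_i$ for all $x\in\mathcal{D}_i$. Canonical homogeneous norm: for a linear dilation $\mathbf{d}(s)=e^{sG_{\mathbf d}}$ with $P\succ0$ and $PG_{\mathbf d}+G_{\mathbf d}^\top P\succ0$, and $\|x\|=\sqrt{x^\top Px}$, set $\|\mathbf{0}\|_{\mathbf d}=0$ and, for $x\neq\mathbf{0}$, $\|x\|_{\mathbf d}=e^{s}$ where $s\in\mathbb{R}$ is the unique number with $\|\mathbf{d}(-s)x\|=1$. The nonlinear term of $u(z)$ is taken to be $\mathbf{0}$ at $z=\mathbf{0}$. Stability notions (for all solutions $x(t)$, $t\ge0$, with $x(0)=x_0$). The system is globally uniformly - Lyapunov stable if there is $\alpha\in\mathcal{K}$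 with $\|x(t)\|\le\alpha(\|x_0\|)$ for all $x_0\in\mathbb{R}^n$, $t\ge0$; - finite-time stable if it is globally uniformly Lyapunov stable and there is a locally bounded $T:\mathbb{R}^n\to\mathbb{R}_+$ with $\|x(t)\|=0$ for all $t\ge T(x_0)$, $x_0\in\mathbb{R}^n$; - nearly fixed-time stable if it is globally uniformly Lyapunov stable and for every $r>0$ there is $T_r>0$ with $\|x(t)\|<r$ for all $t\ge T_r$, independently of $x_0\in\mathbb{R}^n$; - practically Lyapunov stable if there are $r\in\mathbb{R}_+$, $\chi\in\mathcal{K}$ with $\|x(t)\|\le r+\chi(\|x_0\|)$ for all $t\ge0$, $x_0\in\mathbb{R}^n$; - practically fixed-time stable if it is globally uniformly practically Lyapunov stable (with some $r$) and there is $\tilde T>0$ with $\|x(t)\|\le r$ for all $t\ge\tilde T$ and all $x_0\in\mathbb{R}^n$. Locally uniformly finite-time stable: the Lyapunov and finite-time conditions above hold for all $x_0$ in some neighbourhood of the origin. *)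

theory Defs
  imports "HOL-Analysis.Analysis"
begin

section \<open>Matrices\<close>

text \<open>On \<^typ>\<open>real^'n^'n\<close> the type-class operations \<open>*\<close>, \<open>1\<close> and \<open>^\<close> act
  entrywise, so powers and the exponential are built from \<open>**\<close> and \<^term>\<open>mat 1\<close>.\<close>

primrec matpow :: "'a::semiring_1^'n^'n \<Rightarrow> nat \<Rightarrow> 'a^'n^'n" where
  "matpow M 0 = mat 1"
| "matpow M (Suc k) = M ** matpow M k"

definition mexp :: "real^'n^'n \<Rightarrow> real^'n^'n" where
  "mexp M = (\<Sum>k. matpow M k /\<^sub>R fact k)"

definition nilpotent_mat :: "real^'n^'n \<Rightarrow> bool" where
  "nilpotent_mat M \<longleftrightarrow> (\<exists>k. matpow M k = 0)"

definition eigenvalues :: "'a::field^'n^'n \<Rightarrow> 'a set" where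
  "eigenvalues M = {l. \<exists>v. v \<noteq> 0 \<and> M *v v = l *s v}"

definition lambda_max :: "real^'n^'n \<Rightarrow> real" where
  "lambda_max M = Max (eigenvalues M)"

definition lambda_min :: "real^'n^'n \<Rightarrow> real" where
  "lambda_min M = Min (eigenvalues M)"

definition anti_Hurwitz :: "real^'n^'n \<Rightarrow> bool" where
  "anti_Hurwitz M \<longleftrightarrow> (\<forall>l \<in> eigenvalues (map_matrix complex_of_real M). Re l > 0)"

definition posdef :: "real^'n^'n \<Rightarrow> bool" where
  "posdef M \<longleftrightarrow> transpose M = M \<and> (\<forall>x. x \<noteq> 0 \<longrightarrow> x \<bullet> (M *v x) > 0)"

definition msqrt :: "real^'n^'n \<Rightarrow> real^'n^'n" where
  "msqrt M = (THE S. posdef S \<and> S ** S = M)"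

text \<open>Controllability of \<open>x' = A x + B u\<close>: every state can be steered to every other state
  in finite time. Inputs are integrable and trajectories solve the integral equation.\<close>

definition controllable :: "real^'n^'n \<Rightarrow> real^'m^'n \<Rightarrow> bool" where
  "controllable A B \<longleftrightarrow>
     (\<forall>x0 x1. \<exists>T>0. \<exists>(u :: real \<Rightarrow> real^'m) x.
        u absolutely_integrable_on {0..T} \<and> continuous_on {0..T} x \<and> x T = x1 \<and>
        (\<forall>t\<in>{0..T}. ((\<lambda>s. A *v x s + B *v u s) has_integral (x t - x0)) {0..t}))"

section \<open>Weighted norm, dilation and canonical homogeneous norm\<close>

definition wnorm :: "real^'n^'n \<Rightarrow> real^'n \<Rightarrow> real" where
  "wnorm P x = sqrt (x \<bullet> (P *v x))"

definition dilation :: "real^'n^'n \<Rightarrow> real \<Rightarrow> real^'n^'n" where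
  "dilation G s = mexp (s *\<^sub>R G)"

definition hnorm :: "real^'n^'n \<Rightarrow> real^'n^'n \<Rightarrow> real^'n \<Rightarrow> real" where
  "hnorm P G x = (if x = 0 then 0 else exp (THE s. wnorm P (dilation G (- s) *v x) = 1))"

section \<open>Quantizer and feedback\<close>

definition quantizer :: "(real^'n \<Rightarrow> real^'n) \<Rightarrow> bool" where
  "quantizer q \<longleftrightarrow>
     (\<exists>(I :: nat set) D c.
        (\<forall>i\<in>I. D i \<noteq> {}) \<and> disjoint_family_on D I \<and> (\<Union>i\<in>I. D i) = UNIV \<and>
        (\<forall>i\<in>I. c i \<in> D i \<and> (\<forall>x\<in>D i. q x = c i)))"

definition feedback ::
  "real^'n^'m \<Rightarrow> real^'n^'m \<Rightarrow> real^'n^'n \<Rightarrow> real^'n^'n \<Rightarrow> real \<Rightarrow> real^'n \<Rightarrow> real^'m" where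
  "feedback K0 K P G \<mu> z = K0 *v z +
     (if z = 0 then 0
      else hnorm P G z powr (1 + \<mu>) *\<^sub>R (K *v (dilation G (- ln (hnorm P G z)) *v z)))"

section \<open>Filippov solutions\<close>

text \<open>The members of \<open>\<D>\<close> are finitely many non-overlapping compact intervals \<open>[Inf k, Sup k]\<close>.\<close>

definition abs_cont_on :: "real set \<Rightarrow> (real \<Rightarrow> 'a::real_normed_vector) \<Rightarrow> bool" where
  "abs_cont_on S x \<longleftrightarrow>
     (\<forall>e>0. \<exists>d>0. \<forall>\<D>. \<D> division_of \<Union>\<D> \<and> \<Union>\<D> \<subseteq> S \<and> (\<Sum>k\<in>\<D>. Sup k - Inf k) < d \<longrightarrow>
        (\<Sum>k\<in>\<D>. norm (x (Sup k) - x (Inf k))) < e)"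

definition filippov_map :: "('a::euclidean_space \<Rightarrow> 'a) \<Rightarrow> 'a \<Rightarrow> 'a set" where
  "filippov_map f x =
     (\<Inter>\<delta>\<in>{0<..}. \<Inter>N\<in>{N. negligible N}. closure (convex hull (f ` (ball x \<delta> - N))))"

text \<open>Filippov solutions of \<open>x' = f x\<close> on \<open>[0, \<tau>)\<close>, where \<open>\<tau> = \<infinity>\<close> is allowed.\<close>

definition filippov_solution ::
  "('a::euclidean_space \<Rightarrow> 'a) \<Rightarrow> ereal \<Rightarrow> (real \<Rightarrow> 'a) \<Rightarrow> bool" where
  "filippov_solution f \<tau> x \<longleftrightarrow> 0 < \<tau> \<and>
     (\<forall>b\<ge>0. ereal b < \<tau> \<longrightarrow> abs_cont_on {0..b} x) \<and>
     (AE t in lebesgue. 0 < t \<and> ereal t < \<tau> \<longrightarrow>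
        (\<exists>v\<in>filippov_map f (x t). (x has_vector_derivative v) (at t)))"

section \<open>Stability\<close>

text \<open>In the following, \<open>nrm\<close> is the norm on the state space. All estimates are required along
  every solution on its whole interval of existence \<open>[0, \<tau>)\<close>. Solutions are not assumed to be
  global in time, so that the properties cannot hold merely because solutions escape
  in finite time. The set \<open>U\<close> contains the initial states under consideration.\<close>

definition classK :: "(real \<Rightarrow> real) set" where
  "classK = {\<alpha>. continuous_on {0..} \<alpha> \<and> strict_mono_on {0..} \<alpha> \<and> \<alpha> 0 = 0}"

definition Lyapunov_stable_on ::
  "('a::euclidean_space \<Rightarrow> real) \<Rightarrow> ('a \<Rightarrow> 'a) \<Rightarrow> 'a set \<Rightarrow> bool" where
  "Lyapunov_stable_on nrm f U \<longleftrightarrow>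
     (\<exists>\<alpha>\<in>classK. \<forall>x0\<in>U. \<forall>\<tau> x. filippov_solution f \<tau> x \<and> x 0 = x0 \<longrightarrow>
        (\<forall>t\<ge>0. ereal t < \<tau> \<longrightarrow> nrm (x t) \<le> \<alpha> (nrm x0)))"

definition finite_time_stable_on ::
  "('a::euclidean_space \<Rightarrow> real) \<Rightarrow> ('a \<Rightarrow> 'a) \<Rightarrow> 'a set \<Rightarrow> bool" where
  "finite_time_stable_on nrm f U \<longleftrightarrow> Lyapunov_stable_on nrm f U \<and>
     (\<exists>T :: 'a \<Rightarrow> real. (\<forall>x. T x \<ge> 0) \<and> (\<forall>x. \<exists>\<delta>>0. bounded (T ` ball x \<delta>)) \<and>
        (\<forall>x0\<in>U. \<forall>\<tau> x. filippov_solution f \<tau> x \<and> x 0 = x0 \<longrightarrow>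
           (\<forall>t\<ge>T x0. ereal t < \<tau> \<longrightarrow> nrm (x t) = 0)))"

definition globally_finite_time_stable ::
  "('a::euclidean_space \<Rightarrow> real) \<Rightarrow> ('a \<Rightarrow> 'a) \<Rightarrow> bool" where
  "globally_finite_time_stable nrm f \<longleftrightarrow> finite_time_stable_on nrm f UNIV"

definition locally_finite_time_stable ::
  "('a::euclidean_space \<Rightarrow> real) \<Rightarrow> ('a \<Rightarrow> 'a) \<Rightarrow> bool" where
  "locally_finite_time_stable nrm f \<longleftrightarrow>
     (\<exists>U. open U \<and> 0 \<in> U \<and> finite_time_stable_on nrm f U)"

definition nearly_fixed_time_stable ::
  "('a::euclidean_space \<Rightarrow> real) \<Rightarrow> ('a \<Rightarrow> 'a) \<Rightarrow> bool" where
  "nearly_fixed_time_stable nrm f \<longleftrightarrow> Lyapunov_stable_on nrm f UNIV \<and>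
     (\<forall>r>0. \<exists>Tr>0. \<forall>\<tau> x. filippov_solution f \<tau> x \<longrightarrow>
        (\<forall>t\<ge>Tr. ereal t < \<tau> \<longrightarrow> nrm (x t) < r))"

definition practically_Lyapunov_stable_with ::
  "real \<Rightarrow> ('a::euclidean_space \<Rightarrow> real) \<Rightarrow> ('a \<Rightarrow> 'a) \<Rightarrow> bool" where
  "practically_Lyapunov_stable_with r nrm f \<longleftrightarrow>
     (\<exists>\<beta>\<in>classK. \<forall>x0 \<tau> x. filippov_solution f \<tau> x \<and> x 0 = x0 \<longrightarrow>
        (\<forall>t\<ge>0. ereal t < \<tau> \<longrightarrow> nrm (x t) \<le> r + \<beta> (nrm x0)))"

definition practically_fixed_time_stable ::
  "('a::euclidean_space \<Rightarrow> real) \<Rightarrow> ('a \<Rightarrow> 'a) \<Rightarrow> bool" where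
  "practically_fixed_time_stable nrm f \<longleftrightarrow>
     (\<exists>r\<ge>0. practically_Lyapunov_stable_with r nrm f \<and>
        (\<exists>T>0. \<forall>\<tau> x. filippov_solution f \<tau> x \<longrightarrow>
           (\<forall>t\<ge>T. ereal t < \<tau> \<longrightarrow> nrm (x t) \<le> r)))"

end

theory Submission
  imports Defs
begin

text \<open>Let \<open>V\<close> be the canonical homogeneous norm and \<open>y = d(- ln V(x)) x\<close> the projection of \<open>x\<close> to the
  unit sphere. The closed loop with exact measurements is homogeneous of degree \<open>\<mu>\<close>, and the linear matrix
  equation says precisely that \<open>V' = - \<rho> V\<^sup>1\<^sup>+\<^sup>\<mu>\<close> along it. After rescaling by \<open>d(- ln V(x))\<close> the quantized
  state lies uniformly close to \<open>y\<close>, so continuity of the feedback near the unit sphere costs at most a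
  fixed fraction of this decay. The only other perturbation, \<open>B K0 (q(x) - x)\<close>, is of size \<open>\<kappa>\<close> times the
  weighted norm of \<open>x\<close>, hence at most \<open>V\<close> to the power \<open>\<eta>min\<close> for small and \<open>\<eta>max\<close> for large \<open>x\<close>; it is
  negligible against \<open>V\<^sup>1\<^sup>+\<^sup>\<mu>\<close> near the origin or near infinity under the respective conditions on \<open>\<mu>\<close>.

  \<open>V\<close> is never differentiated: \<open>V(x(t)) \<le> e\<^sup>s\<close> means that \<open>d(- s) x(t)\<close> lies in the unit ball, and
  applying the smooth map \<open>d\<close> to an absolutely continuous solution gives a one-sided difference
  quotient bound, which is all the comparison argument needs.\<close>

section \<open>Matrix exponential and dilations\<close>

text \<open>The quantizer is an arbitrary map, so the field may jump anywhere, and a Filippov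
  velocity at \<open>x\<close> is a limit of convex combinations of field values at nearby points.
  At each such point \<open>y\<close> the decay inequality involves its own functional
  \<open>grad y\<close>, but only a half-space cut out by one fixed functional survives convex hulls
  and closures. Replacing \<open>grad y\<close> by \<open>grad x0\<close> costs a small number times
  the size of the field, which is why local boundedness off the origin is carried along with the
  decay. Losses are absorbed because the formal identity V' = V (\<open>grad\<close> . x') /
  \<open>rate\<close> has a denominator of at least \<eta>min > 0: the exact rate \<rho> drops to
  \<rho> / 2 for the quantized field and to \<rho> / 4 along solutions. The threshold for \<epsilon>
  comes from compactness of a shell around the unit sphere, so it is the same for all quantizers and
  does not depend on \<kappa>, which only moves the level of \<open>V\<close> where the
  \<open>K0\<close> term becomes negligible.\<close>

lemma bounded_bilinear_matrix_mult:
  "bounded_bilinear ((**) :: real^'n^'m \<Rightarrow> real^'p^'n \<Rightarrow> real^'p^'m)"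
  unfolding bilinear_conv_bounded_bilinear[symmetric] bilinear_def
  by (auto intro!: linearI simp: matrix_add_ldistrib matrix_matrix_mult_def vec_eq_iff
      sum.distrib sum_distrib_left algebra_simps)

lemma bounded_bilinear_matrix_vector_mult:
  "bounded_bilinear ((*v) :: real^'n^'m \<Rightarrow> real^'n \<Rightarrow> real^'m)"
  unfolding bilinear_conv_bounded_bilinear[symmetric] bilinear_def
  by (auto intro!: linearI simp: algebra_simps scaleR_matrix_vector_assoc)

lemmas continuous_on_matrix_vector_mult [continuous_intros] =
  bounded_bilinear.continuous_on[OF bounded_bilinear_matrix_vector_mult]

lemma matpow_scaleR: "matpow (s *\<^sub>R M) k = s ^ k *\<^sub>R matpow M k" for M :: "real^'n^'n"
  by (induction k) (simp_all add: bounded_bilinear.scaleR_left[OF bounded_bilinear_matrix_mult]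
      bounded_bilinear.scaleR_right[OF bounded_bilinear_matrix_mult])

lemma matpow_commute: "M ** matpow M k = matpow M k ** M"
  by (induction k) (auto, metis matrix_mul_assoc)

text \<open>Geometric growth suffices to compare the exponential series with a scalar one. The
  prefactor is there because the identity matrix need not have norm 1 in this norm.\<close>

lemma norm_matpow_le:
  obtains C :: real where "C \<ge> 0" "\<And>k. norm (matpow (M :: real^'n^'n) k) \<le> norm (mat 1 :: real^'n^'n) * C ^ k"
proof -
  obtain K where K: "K > 0"
    "\<And>a b. norm ((a :: real^'n^'n) ** (b :: real^'n^'n)) \<le> norm a * norm b * K"
    using bounded_bilinear.pos_bounded[OF bounded_bilinear_matrix_mult] by blast
  have "norm (matpow M k) \<le> norm (mat 1 :: real^'n^'n) * (norm M * K) ^ k" for k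
  proof (induction k)
    case (Suc k)
    have "norm (matpow M (Suc k)) \<le> norm M * norm (matpow M k) * K"
      using K(2) by simp
    also have "\<dots> \<le> norm M * (norm (mat 1 :: real^'n^'n) * (norm M * K) ^ k) * K"
      using Suc K(1) by (intro mult_right_mono mult_left_mono) auto
    finally show ?case by (simp add: ac_simps)
  qed simp
  then show ?thesis using that[of "norm M * K"] K(1) by auto
qed

lemma summable_mexp: "summable (\<lambda>k. matpow M k /\<^sub>R fact k)" for M :: "real^'n^'n"
proof -
  obtain C where C: "C \<ge> 0" "\<And>k. norm (matpow M k) \<le> norm (mat 1 :: real^'n^'n) * C ^ k"
    using norm_matpow_le[of M] by blast
  show ?thesis
  proof (rule summable_comparison_test')
    show "summable (\<lambda>k. norm (mat 1 :: real^'n^'n) * (inverse (fact k) * C ^ k))"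
      by (intro summable_mult summable_exp)
    show "norm (matpow M k /\<^sub>R fact k) \<le> norm (mat 1 :: real^'n^'n) * (inverse (fact k) * C ^ k)" if "k \<ge> 0" for k
      using C(2)[of k] by (simp add: field_simps)
  qed
qed

text \<open>Each entry of \<open>dilation G s\<close> is a scalar power series in \<open>s\<close>,
  so the real theorem on termwise differentiation becomes applicable.\<close>

lemma mexp_component: "mexp M $ i $ j = (\<Sum>k. matpow M k $ i $ j / fact k)"
  and summable_mexp_component: "summable (\<lambda>k. matpow M k $ i $ j / fact k)" for M :: "real^'n^'n"
proof -
  have bl: "bounded_linear (\<lambda>m :: real^'n^'n. m $ i $ j)"
    by (intro bounded_linear_compose[OF bounded_linear_vec_nth bounded_linear_vec_nth])
  show "summable (\<lambda>k. matpow M k $ i $ j / fact k)"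
    using bounded_linear.summable[OF bl summable_mexp[of M]] by (simp add: field_simps)
  show "mexp M $ i $ j = (\<Sum>k. matpow M k $ i $ j / fact k)"
    using bounded_linear.suminf[OF bl summable_mexp[of M]] by (simp add: mexp_def field_simps)
qed


lemma dilation_0 [simp]: "dilation G 0 = mat 1"
proof -
  have "(\<lambda>k. matpow (0 :: real^'a^'a) k /\<^sub>R fact k) sums (\<Sum>k\<in>{0}. matpow (0 :: real^'a^'a) k /\<^sub>R fact k)"
  proof (rule sums_finite)
    show "matpow (0 :: real^'a^'a) k /\<^sub>R fact k = 0" if "k \<notin> {0}" for k
      using that by (cases k) (simp_all add: bounded_bilinear.zero_left[OF bounded_bilinear_matrix_mult])
  qed simp
  then show ?thesis
    by (simp add: dilation_def mexp_def sums_iff)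
qed

lemma dilation_has_vector_derivative:
  "(dilation G has_vector_derivative (G ** dilation G s)) (at s within S)"
proof -
  define c where "c i j k = matpow G k $ i $ j / fact k" for i j k
  have sm: "summable (\<lambda>k. c i j k * t ^ k)" for i j t
    using summable_mexp_component[of "t *\<^sub>R G" i j] by (simp add: c_def matpow_scaleR field_simps)
  have eq: "dilation G t $ i $ j = (\<Sum>k. c i j k * t ^ k)" for t i j
    by (simp add: dilation_def mexp_component c_def matpow_scaleR field_simps)
  \<comment> \<open>The factor \<open>Suc k\<close> produced by \<open>diffs\<close> cancels one
    factor of the factorial, and the extra power of \<open>G\<close> is peeled off on the
    left.\<close>
  have diffs: "diffs (c i j) k = (\<Sum>l\<in>UNIV. G $ i $ l * c l j k)" for i j k
    by (simp add: diffs_def c_def matrix_matrix_mult_def sum_divide_distrib sum_distrib_left field_simps del: of_nat_Suc)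
  have *: "((\<lambda>t. dilation G t $ i $ j) has_real_derivative ((G ** dilation G s) $ i $ j)) (at s)" for i j
  proof -
    have "((\<lambda>t. \<Sum>k. c i j k * t ^ k) has_real_derivative (\<Sum>k. diffs (c i j) k * s ^ k)) (at s)"
      by (rule termdiffs_strong_converges_everywhere) (rule sm)
    moreover have "(\<Sum>k. diffs (c i j) k * s ^ k) = (\<Sum>l\<in>UNIV. G $ i $ l * (\<Sum>k. c l j k * s ^ k))"
      by (simp add: diffs sum_distrib_right suminf_sum sm summable_mult mult.assoc suminf_mult)
    ultimately show ?thesis
      by (simp add: eq matrix_matrix_mult_def)
  qed
  have "(dilation G has_derivative (\<lambda>t. t *\<^sub>R (G ** dilation G s))) (at s)"
    unfolding has_derivative_componentwise_within[of "dilation G"] Basis_vec_def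
    using * by (auto simp: inner_axis has_field_derivative_def mult_commute_abs)
  then show ?thesis
    using has_derivative_at_withinI has_vector_derivative_def by blast
qed

lemma dilation_commute: "G ** dilation G s = dilation G s ** G"
proof -
  have sm: "summable (\<lambda>k. matpow (s *\<^sub>R G) k /\<^sub>R fact k)" by (rule summable_mexp)
  have "G ** dilation G s = (\<Sum>k. G ** (matpow (s *\<^sub>R G) k /\<^sub>R fact k))"
    unfolding dilation_def mexp_def
    by (rule bounded_linear.suminf[OF bounded_bilinear.bounded_linear_right[OF bounded_bilinear_matrix_mult] sm])
  also have "\<dots> = (\<Sum>k. (matpow (s *\<^sub>R G) k /\<^sub>R fact k) ** G)"
    by (simp add: matpow_scaleR matpow_commute bounded_bilinear.scaleR_left[OF bounded_bilinear_matrix_mult]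
      bounded_bilinear.scaleR_right[OF bounded_bilinear_matrix_mult])
  also have "\<dots> = dilation G s ** G"
    unfolding dilation_def mexp_def
    by (rule bounded_linear.suminf[OF bounded_bilinear.bounded_linear_left[OF bounded_bilinear_matrix_mult] sm, symmetric])
  finally show ?thesis .
qed

lemmas has_vector_derivative_matrix_mult =
  bounded_bilinear.has_vector_derivative[OF bounded_bilinear_matrix_mult]

lemma dilation_uminus_has_vector_derivative:
  "((\<lambda>s. dilation G (- s)) has_vector_derivative - (dilation G (- s) ** G)) (at s)"
  using vector_diff_chain_at[of uminus "-1" s "dilation G" "G ** dilation G (- s)"]
    dilation_has_vector_derivative[of G "- s" UNIV]
  by (auto intro!: derivative_eq_intros simp: o_def dilation_commute has_vector_derivative_minus)

lemma constant_if_vector_derivative_zero: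
  fixes f :: "real \<Rightarrow> 'a::real_normed_vector"
  assumes "\<And>s. (f has_vector_derivative 0) (at s)"
  shows "f s = f 0"
  using has_derivative_zero_constant[of UNIV f] assms
  by (force simp: has_vector_derivative_def)

lemma dilation_inverse: "dilation G (- s) ** dilation G s = mat 1"
proof -
  have "((\<lambda>s. dilation G (- s) ** dilation G s) has_vector_derivative 0) (at s)" for s
    using has_vector_derivative_matrix_mult[OF dilation_uminus_has_vector_derivative[of G s]
        dilation_has_vector_derivative[of G s UNIV]]
    by (simp add: matrix_mul_assoc bounded_bilinear.minus_left[OF bounded_bilinear_matrix_mult])
  from constant_if_vector_derivative_zero[OF this] show ?thesis by simp
qed

text \<open>The hypothesis is the infinitesimal form of homogeneity of degree \<mu>. Conjugating
  \<open>A\<close> by the dilation and weighting with \<open>exp (- \<mu> * s)\<close> gives a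
  function of \<open>s\<close> whose derivative contains exactly
  \<open>A ** G - G ** A - \<mu> *\<^sub>R A\<close>, hence a constant.\<close>

lemma dilation_intertwine:
  assumes "A ** G = G ** A + \<mu> *\<^sub>R A"
  shows "A ** dilation G s = exp (\<mu> * s) *\<^sub>R (dilation G s ** A)"
proof -
  define f where "f s = exp (- \<mu> * s) *\<^sub>R (dilation G (- s) ** (A ** dilation G s))" for s
  note bl = bounded_bilinear_matrix_mult
  have "(f has_vector_derivative 0) (at s)" for s
  proof -
    have eq: "D ** A ** G ** D' = D ** G ** A ** D' + \<mu> *\<^sub>R (D ** A ** D')" for D D'
      using arg_cong[OF assms, of "\<lambda>M. D ** M ** D'"]
      by (simp add: matrix_mul_assoc bounded_bilinear.add_left[OF bl] bounded_bilinear.scaleR_left[OF bl]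
          bounded_bilinear.add_right[OF bl] bounded_bilinear.scaleR_right[OF bl])
    have 1: "((\<lambda>s. A ** dilation G s) has_vector_derivative (A ** (G ** dilation G s))) (at s)"
      using has_vector_derivative_matrix_mult[OF has_vector_derivative_const[of A] dilation_has_vector_derivative[of G s UNIV]]
      by simp
    have 2: "((\<lambda>s. exp (- \<mu> * s)) has_vector_derivative (- \<mu> * exp (- \<mu> * s))) (at s)"
      by (auto intro!: derivative_eq_intros simp flip: has_real_derivative_iff_has_vector_derivative)
    show ?thesis
      unfolding f_def
      using bounded_bilinear.has_vector_derivative[OF bounded_bilinear_scaleR 2
            has_vector_derivative_matrix_mult[OF dilation_uminus_has_vector_derivative[of G s] 1]]
      by (simp add: eq bounded_bilinear.minus_left[OF bl] matrix_mul_assoc algebra_simps)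
  qed
  from constant_if_vector_derivative_zero[OF this] have "f s = A" by (simp add: f_def)
  then have "exp (\<mu> * s) *\<^sub>R (dilation G s ** A) = exp (\<mu> * s) *\<^sub>R (dilation G s ** f s)"
    by simp
  also have "\<dots> = (dilation G s ** dilation G (- s)) ** (A ** dilation G s)"
    by (simp add: f_def bounded_bilinear.scaleR_right[OF bl] matrix_mul_assoc flip: exp_add)
  finally show ?thesis
    using dilation_inverse[of G "- s"] by simp
qed

lemma dilation_add: "dilation G (s + t) = dilation G s ** dilation G t"
proof -
  define f where "f t = dilation G (- t) ** dilation G (s + t)" for t
  have "(f has_vector_derivative 0) (at t)" for t
  proof -
    have "((\<lambda>t. dilation G (s + t)) has_vector_derivative (G ** dilation G (s + t))) (at t)"
    proof -
      have "((+) s has_vector_derivative 1) (at t)"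
        by (auto intro!: derivative_eq_intros)
      from vector_diff_chain_at[OF this dilation_has_vector_derivative[of G "s + t" UNIV]]
      show ?thesis by (simp add: o_def)
    qed
    from has_vector_derivative_matrix_mult[OF dilation_uminus_has_vector_derivative[of G t] this]
    show ?thesis unfolding f_def
      by (simp add: matrix_mul_assoc bounded_bilinear.minus_left[OF bounded_bilinear_matrix_mult])
  qed
  from constant_if_vector_derivative_zero[OF this] have "f t = dilation G s" by (simp add: f_def)
  moreover have "dilation G t ** f t = dilation G (s + t)"
    using dilation_inverse[of G "- t"] by (simp add: f_def matrix_mul_assoc)
  \<comment> \<open>Degree 0 of the intertwining rule: whatever commutes with \<open>G\<close>
    commutes with its dilations.\<close>
  moreover have "dilation G t ** dilation G s = dilation G s ** dilation G t"
    using dilation_intertwine[of "dilation G s" G 0 t] by (simp add: dilation_commute)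
  ultimately show ?thesis by simp
qed

text \<open>The columns of \<open>B\<close> are fixed by \<open>G\<close>, so the flow of
  \<open>G\<close> stretches them by exactly \<open>exp s\<close>.\<close>

lemma dilation_mult_eq_exp:
  fixes B :: "real^'m^'n"
  assumes "G ** B = B"
  shows "dilation G s ** B = exp s *\<^sub>R B"
proof -
  define f where "f s = exp (- s) *\<^sub>R (dilation G s ** B)" for s
  have "(f has_vector_derivative 0) (at s)" for s
  proof -
    have 1: "((\<lambda>s. dilation G s ** B) has_vector_derivative (dilation G s ** B)) (at s)"
      using has_vector_derivative_matrix_mult[OF dilation_has_vector_derivative[of G s UNIV] has_vector_derivative_const[of B]] assms
      by (simp add: dilation_commute flip: matrix_mul_assoc)
    have 2: "((\<lambda>s. exp (- s)) has_vector_derivative (- exp (- s))) (at s)"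
      by (auto intro!: derivative_eq_intros simp flip: has_real_derivative_iff_has_vector_derivative)
    show ?thesis
      unfolding f_def
      using bounded_bilinear.has_vector_derivative[OF bounded_bilinear_scaleR 2 1]
      by simp
  qed
  from constant_if_vector_derivative_zero[OF this] have "f s = B" by (simp add: f_def)
  then have "exp s *\<^sub>R B = (exp s * exp (- s)) *\<^sub>R (dilation G s ** B)"
    by (metis f_def scaleR_scaleR)
  then show ?thesis by (simp flip: exp_add)
qed

section \<open>Rayleigh quotients and the square root\<close>

lemma symmetric_inner: "transpose M = M \<Longrightarrow> x \<bullet> (M *v y) = (M *v x) \<bullet> y" for M :: "real^'n^'n"
  by (metis dot_lmul_matrix transpose_matrix_vector)

lemma symmetricI:
  fixes M :: "real^'n^'n"
  assumes "\<And>x y. x \<bullet> (M *v y) = (M *v x) \<bullet> y"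
  shows "transpose M = M"
proof -
  have "(x v* M) \<bullet> y = (M *v x) \<bullet> y" for x y
    using assms by (simp add: dot_lmul_matrix)
  then have "x v* M = M *v x" for x by (metis vector_eq_rdot)
  then show ?thesis by (simp add: matrix_eq)
qed

lemma posdefD:
  assumes "posdef P"
  shows "transpose P = P" "x \<noteq> 0 \<Longrightarrow> x \<bullet> (P *v x) > 0" "x \<bullet> (P *v x) \<ge> 0"
proof -
  show "transpose P = P" "x \<noteq> 0 \<Longrightarrow> x \<bullet> (P *v x) > 0"
    using assms by (auto simp: posdef_def)
  then show "x \<bullet> (P *v x) \<ge> 0" by (cases "x = 0") auto
qed

text \<open>A maximiser \<open>v\<close> of the quadratic form on the unit sphere is an eigenvector:
  the residual \<open>w = M *v v - l *\<^sub>R v\<close> would otherwise be a direction in which the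
  form still increases.\<close>

lemma Rayleigh_maximum:
  fixes M :: "real^'n^'n"
  assumes "transpose M = M"
  obtains l where "l \<in> eigenvalues M" "\<And>x. x \<bullet> (M *v x) \<le> l * (x \<bullet> x)"
proof -
  have "continuous_on (sphere 0 1) (\<lambda>x. x \<bullet> (M *v x))"
    by (intro continuous_intros)
  moreover have "sphere (0::real^'n) 1 \<noteq> {}" by simp
  ultimately have "\<exists>v\<in>sphere 0 1. \<forall>y\<in>sphere 0 1. y \<bullet> (M *v y) \<le> v \<bullet> (M *v v)"
    by (intro continuous_attains_sup compact_sphere)
  then obtain v where v: "v \<in> sphere 0 1" and
    max: "\<And>y. y \<in> sphere 0 1 \<Longrightarrow> y \<bullet> (M *v y) \<le> v \<bullet> (M *v v)"
    by blast
  define l where "l = v \<bullet> (M *v v)"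
  have le: "x \<bullet> (M *v x) \<le> l * (x \<bullet> x)" for x
  proof (cases "x = 0")
    case False
    have "(x /\<^sub>R norm x) \<bullet> (M *v (x /\<^sub>R norm x)) \<le> l"
      unfolding l_def using False by (intro max) simp
    then have "x \<bullet> (M *v x) / (norm x)\<^sup>2 \<le> l"
      by (simp add: matrix_vector_mult_scaleR power2_eq_square divide_inverse_commute algebra_simps)
    then show ?thesis
      using False by (simp add: divide_le_eq dot_square_norm)
  qed simp
  define w where "w = M *v v - l *\<^sub>R v"
  have vv: "v \<bullet> v = 1" using v by (simp add: dot_square_norm)
  have wv: "w \<bullet> w = w \<bullet> (M *v v) - l * (w \<bullet> v)"
    by (simp add: w_def algebra_simps)
  \<comment> \<open>The bound \<open>le\<close> at \<open>v + t *\<^sub>R w\<close>: the terms of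
    order 0 cancel, and those of order 1 leave \<open>2 * t * (w \<bullet> w)\<close>.\<close>
  have quad: "2 * t * (w \<bullet> w) \<le> t\<^sup>2 * (l * (w \<bullet> w) - w \<bullet> (M *v w))" for t
  proof -
    have e1: "w \<bullet> (M *v v) = w \<bullet> w + l * (w \<bullet> v)" using wv by simp
    have e2: "v \<bullet> (M *v w) = w \<bullet> (M *v v)"
      using symmetric_inner[OF assms, of v w] by (simp add: inner_commute)
    have e3: "(v + t *\<^sub>R w) \<bullet> (M *v (v + t *\<^sub>R w))
        = v \<bullet> (M *v v) + t * (w \<bullet> (M *v v)) + t * (v \<bullet> (M *v w)) + t\<^sup>2 * (w \<bullet> (M *v w))"
      by (simp add: algebra_simps matrix_vector_mult_scaleR power2_eq_square)
    have e4: "(v + t *\<^sub>R w) \<bullet> (v + t *\<^sub>R w) = 1 + 2 * t * (w \<bullet> v) + t\<^sup>2 * (w \<bullet> w)"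
      by (simp add: distrib_left distrib_right inner_add_left inner_add_right inner_commute[of v w] vv power2_eq_square)
    have "l + t * (w \<bullet> w + l * (w \<bullet> v)) + t * (w \<bullet> w + l * (w \<bullet> v)) + t\<^sup>2 * (w \<bullet> (M *v w))
        \<le> l * (1 + 2 * t * (w \<bullet> v) + t\<^sup>2 * (w \<bullet> w))"
      using le[of "v + t *\<^sub>R w"] by (simp only: e3 e4 e2 e1 l_def[symmetric])
    then show ?thesis by (simp add: algebra_simps)
  qed
  have "w \<bullet> w = 0"
  proof (rule ccontr)
    assume "w \<bullet> w \<noteq> 0"
    then have pos: "w \<bullet> w > 0" by (metis inner_ge_zero less_eq_real_def)
    define C where "C = \<bar>l * (w \<bullet> w) - w \<bullet> (M *v w)\<bar> + 1"
    \<comment> \<open>This \<open>t\<close> makes the quadratic side at most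
      \<open>t * (w \<bullet> w)\<close>, half of the linear side.\<close>
    define t where "t = (w \<bullet> w) / C"
    have "C > 0" "t > 0" using pos by (auto simp: C_def t_def)
    have "2 * t * (w \<bullet> w) \<le> t\<^sup>2 * C"
      by (rule order_trans[OF quad mult_left_mono]) (auto simp: C_def)
    also have "t\<^sup>2 * C = t * (w \<bullet> w)"
      using \<open>C > 0\<close> by (simp add: t_def power2_eq_square)
    finally show False using pos \<open>t > 0\<close> by (auto simp: mult_less_0_iff)
  qed
  then have "M *v v = l *s v" by (simp add: w_def scalar_mult_eq_scaleR)
  moreover have "v \<noteq> 0" using vv by auto
  ultimately have "l \<in> eigenvalues M" by (auto simp: eigenvalues_def)
  with le that show ?thesis by blast
qed

text \<open>\<open>lambda_max\<close> and \<open>lambda_min\<close> are a \<open>Max\<close> and a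
  \<open>Min\<close>, which are informative only for finite sets. One eigenvector chosen per
  eigenvalue gives a pairwise orthogonal family, and such families are finite.\<close>

lemma finite_eigenvalues_symmetric:
  fixes M :: "real^'n^'n"
  assumes "transpose M = M"
  shows "finite (eigenvalues M)"
proof -
  define ev where "ev l = (SOME v. v \<noteq> 0 \<and> M *v v = l *\<^sub>R v)" for l
  have ev: "ev l \<noteq> 0" "M *v ev l = l *\<^sub>R ev l" if "l \<in> eigenvalues M" for l
    using someI_ex[of "\<lambda>v. v \<noteq> 0 \<and> M *v v = l *\<^sub>R v"] that
    by (auto simp: eigenvalues_def ev_def scalar_mult_eq_scaleR)
  have orth: "ev l \<bullet> ev l' = 0" if "l \<in> eigenvalues M" "l' \<in> eigenvalues M" "l \<noteq> l'" for l l'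
    using symmetric_inner[OF assms, of "ev l" "ev l'"] that by (simp add: ev)
  have inj: "inj_on ev (eigenvalues M)"
    by (rule inj_onI) (metis orth ev(1) inner_eq_zero_iff)
  have "pairwise orthogonal (ev ` eigenvalues M)"
    unfolding pairwise_def orthogonal_def by (metis imageE orth)
  then have "finite (ev ` eigenvalues M)"
    by (rule pairwise_orthogonal_imp_finite)
  then show ?thesis using inj finite_imageD by blast
qed

lemma Rayleigh_le_lambda_max:
  fixes M :: "real^'n^'n"
  assumes "transpose M = M"
  shows "x \<bullet> (M *v x) \<le> lambda_max M * (x \<bullet> x)"
proof -
  obtain l where l: "l \<in> eigenvalues M" "\<And>x. x \<bullet> (M *v x) \<le> l * (x \<bullet> x)"
    using Rayleigh_maximum[OF assms] by blast
  have "l \<le> lambda_max M"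
    unfolding lambda_max_def using finite_eigenvalues_symmetric[OF assms] l(1) by simp
  then show ?thesis using l(2)[of x] by (meson inner_ge_zero mult_right_mono order_trans)
qed

lemma uminus_matrix_vector_mult: "(- M) *v x = - (M *v x)" for M :: "real^'n^'m"
  by (rule bounded_bilinear.minus_left[OF bounded_bilinear_matrix_vector_mult])

lemma lambda_min_le_Rayleigh:
  fixes M :: "real^'n^'n"
  assumes "transpose M = M"
  shows "lambda_min M * (x \<bullet> x) \<le> x \<bullet> (M *v x)"
proof -
  have "transpose (- M) = - M" using assms by (simp add: transpose_def vec_eq_iff)
  then obtain l where l: "l \<in> eigenvalues (- M)" "\<And>x. x \<bullet> ((- M) *v x) \<le> l * (x \<bullet> x)"
    using Rayleigh_maximum by blast
  from l(1) have "- l \<in> eigenvalues M"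
    by (auto simp: eigenvalues_def uminus_matrix_vector_mult scalar_mult_eq_scaleR) (metis minus_minus)
  then have "lambda_min M \<le> - l"
    unfolding lambda_min_def using finite_eigenvalues_symmetric[OF assms] by simp
  then have "lambda_min M * (x \<bullet> x) \<le> - l * (x \<bullet> x)" by (rule mult_right_mono) simp
  with l(2)[of x] show ?thesis by (simp add: uminus_matrix_vector_mult)
qed

lemma posdef_lower_bound:
  fixes M :: "real^'n^'n"
  assumes "posdef M"
  obtains l where "l > 0" "\<And>x. l * (x \<bullet> x) \<le> x \<bullet> (M *v x)"
proof -
  have "transpose (- M) = - M" using posdefD(1)[OF assms] by (simp add: transpose_def vec_eq_iff)
  then obtain l where l: "l \<in> eigenvalues (- M)" "\<And>x. x \<bullet> ((- M) *v x) \<le> l * (x \<bullet> x)"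
    using Rayleigh_maximum by blast
  then obtain v where v: "v \<noteq> 0" "- (M *v v) = l *\<^sub>R v"
    by (auto simp: eigenvalues_def uminus_matrix_vector_mult scalar_mult_eq_scaleR)
  have "l * (v \<bullet> v) = - (v \<bullet> (M *v v))"
    using arg_cong[OF v(2), of "\<lambda>u. v \<bullet> u"] by simp
  then have "l * (v \<bullet> v) < 0" using posdefD(2)[OF assms v(1)] by simp
  then have "- l > 0" using inner_ge_zero[of v] by (metis mult_nonneg_nonneg neg_0_less_iff_less not_le)
  moreover have "- l * (x \<bullet> x) \<le> x \<bullet> (M *v x)" for x
    using l(2)[of x] by (simp add: uminus_matrix_vector_mult)
  ultimately show ?thesis using that by blast
qed

section \<open>Inverse and square root of a positive definite matrix\<close>

lemma posdef_invertible: "posdef P \<Longrightarrow> invertible P" for P :: "real^'n^'n"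
  by (metis invertible_left_inverse matrix_left_invertible_ker inner_zero_right posdefD(2) less_irrefl)

lemma matrix_inv_mult:
  assumes "invertible (P :: real^'n^'n)"
  shows "P ** matrix_inv P = mat 1" "matrix_inv P ** P = mat 1"
  using someI_ex[OF assms[unfolded invertible_def]] by (auto simp: matrix_inv_def)

lemma posdef_matrix_inv:
  fixes P :: "real^'n^'n"
  assumes "posdef P" shows "posdef (matrix_inv P)"
proof -
  note inv = matrix_inv_mult[OF posdef_invertible[OF assms]]
  have tr: "transpose (matrix_inv P) = matrix_inv P"
    by (metis inv matrix_mul_assoc matrix_mul_lid matrix_mul_rid matrix_transpose_mul posdefD(1)[OF assms] transpose_mat)
  have "x \<bullet> (matrix_inv P *v x) > 0" if "x \<noteq> 0" for x
  proof -
    define y where "y = matrix_inv P *v x"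
    have x: "x = P *v y" by (simp add: y_def matrix_vector_mul_assoc inv)
    then have "y \<noteq> 0" using that by auto
    then have "(P *v y) \<bullet> y > 0" using posdefD(2)[OF assms, of y] by (simp add: inner_commute)
    then show ?thesis using x y_def by metis
  qed
  with tr show ?thesis by (simp add: posdef_def)
qed

text \<open>The difference \<open>D\<close> of two roots satisfies
  \<open>S ** D + D ** S' = 0\<close>. Testing this on an eigenvector of \<open>D\<close> multiplies
  its eigenvalue by a positive number, so every eigenvalue of the symmetric matrix \<open>D\<close>
  is 0.\<close>

lemma posdef_sqrt_unique:
  fixes S S' :: "real^'n^'n"
  assumes "posdef S" "posdef S'" "S ** S = S' ** S'"
  shows "S = S'"
proof -
  define D where "D = S - S'"
  have trD: "transpose D = D"
    using posdefD(1)[OF assms(1)] posdefD(1)[OF assms(2)] by (simp add: D_def transpose_def vec_eq_iff)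
  have "S ** D + D ** S' = S ** S - S' ** S'"
    by (simp add: D_def bounded_bilinear.diff_left[OF bounded_bilinear_matrix_mult]
        bounded_bilinear.diff_right[OF bounded_bilinear_matrix_mult])
  then have eq: "S *v (D *v v) + D *v (S' *v v) = 0" for v
    using assms(3) by (metis cancel_comm_monoid_add_class.diff_cancel matrix_vector_mul_assoc
        matrix_vector_mult_0 matrix_vector_mult_add_rdistrib)
  have zero: "l = 0" if l: "l \<in> eigenvalues D" for l
  proof -
    obtain v where v: "v \<noteq> 0" "D *v v = l *\<^sub>R v"
      using l by (auto simp: eigenvalues_def scalar_mult_eq_scaleR)
    have "v \<bullet> (S *v (D *v v)) + v \<bullet> (D *v (S' *v v)) = 0"
      using arg_cong[OF eq[of v], of "\<lambda>u. v \<bullet> u"] by (simp add: inner_add_right)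
    then have "l * (v \<bullet> (S *v v) + v \<bullet> (S' *v v)) = 0"
      using symmetric_inner[OF trD, of v] by (simp add: v(2) matrix_vector_mult_scaleR distrib_left)
    moreover have "v \<bullet> (S *v v) + v \<bullet> (S' *v v) > 0"
      using posdefD(2)[OF assms(1) v(1)] posdefD(2)[OF assms(2) v(1)] by simp
    ultimately show "l = 0" by simp
  qed
  have q0: "x \<bullet> (D *v x) = 0" for x
  proof -
    have "eigenvalues D \<noteq> {}" using Rayleigh_maximum[OF trD] by blast
    then have "eigenvalues D = {0}" using zero by auto
    then show ?thesis
      using Rayleigh_le_lambda_max[OF trD, of x] lambda_min_le_Rayleigh[OF trD, of x]
      by (simp add: lambda_max_def lambda_min_def)
  qed
  \<comment> \<open>Polarisation: the form of \<open>D\<close> vanishes everywhere, and at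
    \<open>x + D *v x\<close> it equals twice the squared length of \<open>D *v x\<close>.\<close>
  have "D *v x = 0" for x
  proof -
    have "(x + D *v x) \<bullet> (D *v (x + D *v x)) = 2 * ((D *v x) \<bullet> (D *v x))"
      using symmetric_inner[OF trD, of x "D *v x"] q0[of x] q0[of "D *v x"]
      by (simp add: algebra_simps)
    then show ?thesis using q0 by simp
  qed
  then have "D = 0" by (metis matrix_eq matrix_vector_mult_0)
  then show ?thesis by (simp add: D_def)
qed

text \<open>The square root is \<open>sqrt c *\<^sub>R (I - Z)\<close> for the fixed point of
  \<open>Z \<mapsto> (M + Z\<^sup>2) / 2\<close>, where \<open>M = I - P / c\<close> is a contraction for large \<open>c\<close>.\<close>

lemma posdef_sqrt_exists:
  fixes P :: "real^'n^'n"
  assumes "posdef P"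
  obtains S where "posdef S" "S ** S = P"
proof -
  obtain l where l: "l > 0" "\<And>x. l * (x \<bullet> x) \<le> x \<bullet> (P *v x)"
    using posdef_lower_bound[OF assms] by blast
  define pl where "pl = Blinfun ((*v) P)"
  have pl: "blinfun_apply pl x = P *v x" for x
    unfolding pl_def by (subst bounded_linear_Blinfun_apply) (auto simp: linear_conv_bounded_linear[symmetric])
  \<comment> \<open>Adding \<open>l\<close> to the operator norm gives \<open>L > 0\<close> and
    \<open>l \<le> L\<close> at once.\<close>
  define L where "L = norm pl + l"
  have L: "L > 0" "L \<ge> l" "norm (P *v x) \<le> L * norm x" for x
  proof -
    show "L > 0" "L \<ge> l" using l(1) by (auto simp: L_def add_nonneg_pos)
    have "norm (P *v x) \<le> norm pl * norm x" using norm_blinfun[of pl x] by (simp add: pl)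
    also have "\<dots> \<le> L * norm x" using l(1) by (intro mult_right_mono) (auto simp: L_def)
    finally show "norm (P *v x) \<le> L * norm x" .
  qed
  \<comment> \<open>This \<open>c\<close> minimises
    \<open>1 - 2 * l / c + L\<^sup>2 / c\<^sup>2\<close>, the bound on the squared norm of
    \<open>I - P / c\<close>; the minimum is the square of \<open>m\<close> below.\<close>
  define c where "c = L\<^sup>2 / l"
  have c: "c > 0" using l(1) L(1) by (simp add: c_def)
  define M where "M = id_blinfun - pl /\<^sub>R c"
  define m where "m = sqrt (1 - l\<^sup>2 / L\<^sup>2)"
  have lL: "0 < l\<^sup>2 / L\<^sup>2" "l\<^sup>2 / L\<^sup>2 \<le> 1"
    using l(1) L(1,2) by (auto simp: divide_le_eq power_mono)
  then have m: "0 \<le> m" "m < 1" "m\<^sup>2 = 1 - l\<^sup>2 / L\<^sup>2"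
    by (auto simp: m_def real_sqrt_lt_1_iff)
  have M: "norm M \<le> m"
  proof (rule norm_blinfun_bound[OF m(1)])
    fix x
    have "(norm (M x))\<^sup>2 = x \<bullet> x - 2 * (x \<bullet> (P *v x)) / c + (norm (P *v x))\<^sup>2 / c\<^sup>2"
      unfolding power2_norm_eq_inner using c
      by (simp add: M_def pl blinfun.bilinear_simps inner_diff_left inner_diff_right inner_commute field_simps power2_eq_square)
    also have "\<dots> \<le> x \<bullet> x - 2 * (l * (x \<bullet> x)) / c + (L * norm x)\<^sup>2 / c\<^sup>2"
      using l(2)[of x] L(3)[of x] c by (intro add_mono diff_mono divide_right_mono power_mono) auto
    also have "\<dots> = (1 - l\<^sup>2 / L\<^sup>2) * (norm x)\<^sup>2"
      using l(1) L(1) by (simp add: c_def dot_square_norm field_simps power2_eq_square)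
    also have "\<dots> = (m * norm x)\<^sup>2"
      by (simp only: power_mult_distrib m(3))
    finally show "norm (M x) \<le> m * norm x"
      by (rule power2_le_imp_le) (simp add: m)
  qed
  \<comment> \<open>Symmetry is built into the space so that the root inherits it. The radius
    \<open>m < 1\<close> is preserved because (m + m * m) / 2 is at most \<open>m\<close>; it also
    gives the Lipschitz constant \<open>m\<close>, by Z Z - W W = Z (Z - W) + (Z - W) W, and makes I
    - Z positive definite.\<close>
  define \<S> where "\<S> = {Z :: (real^'n) \<Rightarrow>\<^sub>L (real^'n). norm Z \<le> m \<and> (\<forall>x y. x \<bullet> blinfun_apply Z y = blinfun_apply Z x \<bullet> y)}"
  define \<Phi> where "\<Phi> Z = (M + (Z o\<^sub>L Z)) /\<^sub>R 2" for Z
  have "\<exists>!Z\<in>\<S>. \<Phi> Z = Z"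
  proof (rule Banach_fix[where c = m])
    have "closed \<S>"
    proof -
      have "\<S> = cball 0 m \<inter> (\<Inter>x. \<Inter>y. {Z. x \<bullet> blinfun_apply Z y = blinfun_apply Z x \<bullet> y})"
        by (auto simp: \<S>_def)
      then show ?thesis
        by (auto intro!: closed_Int closed_INT closed_Collect_eq continuous_intros)
    qed
    then show "complete \<S>" by (simp add: complete_eq_closed)
    have "0 \<in> \<S>" using m by (simp add: \<S>_def)
    then show "\<S> \<noteq> {}" by blast
    show "0 \<le> m" "m < 1" by (fact m)+
    have Msym: "x \<bullet> M y = M x \<bullet> y" for x y
      using symmetric_inner[OF posdefD(1)[OF assms], of x y]
      by (simp add: M_def pl blinfun.bilinear_simps inner_diff_left inner_diff_right)
    show "\<Phi> ` \<S> \<subseteq> \<S>"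
    proof clarify
      fix Z assume Z: "Z \<in> \<S>"
      have "norm (M + (Z o\<^sub>L Z)) \<le> m + m * m"
      proof (rule norm_triangle_mono[OF M])
        show "norm (Z o\<^sub>L Z) \<le> m * m"
          using Z by (intro order_trans[OF norm_blinfun_compose] mult_mono) (auto simp: \<S>_def m(1))
      qed
      also have "\<dots> \<le> 2 * m" using m by (simp add: mult_left_le)
      finally have "norm (\<Phi> Z) \<le> m" by (simp add: \<Phi>_def)
      moreover have "x \<bullet> \<Phi> Z y = \<Phi> Z x \<bullet> y" for x y
        using Z Msym by (simp add: \<Phi>_def \<S>_def blinfun.bilinear_simps inner_add_left inner_add_right)
      ultimately show "\<Phi> Z \<in> \<S>" by (simp add: \<S>_def)
    qed
    fix Z W assume "Z \<in> \<S>" "W \<in> \<S>"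
    then have ZW: "norm Z \<le> m" "norm W \<le> m" by (auto simp: \<S>_def)
    have "\<Phi> Z - \<Phi> W = ((Z o\<^sub>L (Z - W)) + ((Z - W) o\<^sub>L W)) /\<^sub>R 2"
      by (rule blinfun_eqI) (simp add: \<Phi>_def blinfun.bilinear_simps algebra_simps)
    moreover have "norm ((Z o\<^sub>L (Z - W)) + ((Z - W) o\<^sub>L W)) \<le> m * norm (Z - W) + norm (Z - W) * m"
      using ZW by (intro norm_triangle_mono order_trans[OF norm_blinfun_compose] mult_mono) (auto simp: m)
    ultimately show "dist (\<Phi> Z) (\<Phi> W) \<le> m * dist Z W"
      by (simp add: dist_norm)
  qed
  then obtain Z where Z: "Z \<in> \<S>" "\<Phi> Z = Z" by blast
  define S where "S = matrix (\<lambda>x. sqrt c *\<^sub>R (x - Z x))"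
  have S: "S *v x = sqrt c *\<^sub>R (x - Z x)" for x
  proof -
    have "linear (\<lambda>x. sqrt c *\<^sub>R (x - Z x))"
      by (auto intro!: linearI simp: blinfun.bilinear_simps algebra_simps)
    then show ?thesis
      unfolding S_def by (simp add: linear_matrix_vector_mul_eq matrix_works)
  qed
  have Zsym: "x \<bullet> Z y = Z x \<bullet> y" for x y using Z(1) by (simp add: \<S>_def)
  have "transpose S = S"
    by (rule symmetricI) (simp add: S Zsym inner_diff_left inner_diff_right)
  moreover have "x \<bullet> (S *v x) > 0" if "x \<noteq> 0" for x
  proof -
    have "x \<bullet> Z x \<le> norm x * norm (Z x)" by (rule norm_cauchy_schwarz)
    also have "\<dots> \<le> norm x * (m * norm x)"
      using order_trans[OF norm_blinfun[of Z x] mult_right_mono[of "norm Z" m "norm x"]] Z(1)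
      by (intro mult_left_mono) (auto simp: \<S>_def)
    also have "\<dots> = m * (x \<bullet> x)" by (simp add: dot_square_norm power2_eq_square)
    also have "\<dots> < x \<bullet> x" using that m by simp
    finally show ?thesis using c by (simp add: S inner_diff_right)
  qed
  ultimately have "posdef S" by (simp add: posdef_def)
  moreover have "S ** S = P"
  proof -
    have "S *v (S *v x) = P *v x" for x
    proof -
      \<comment> \<open>The fixed point equation reads Z Z = 2 Z - M, hence (I - Z)(I - Z) = I - M =
        P / c.\<close>
      have "Z x = (M x + Z (Z x)) /\<^sub>R 2"
        using arg_cong[OF Z(2), of "\<lambda>f. f x"] by (simp add: \<Phi>_def blinfun.bilinear_simps)
      from arg_cong[OF this, of "\<lambda>u. 2 *\<^sub>R u"] have "2 *\<^sub>R Z x = M x + Z (Z x)" by simp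
      then have ZZ: "Z (Z x) = 2 *\<^sub>R Z x - M x" by (simp add: algebra_simps)
      have "S *v (S *v x) = c *\<^sub>R ((x - Z x) - (Z x - Z (Z x)))"
        using c by (simp add: S blinfun.bilinear_simps flip: scaleR_diff_right)
      also have "(x - Z x) - (Z x - Z (Z x)) = (P *v x) /\<^sub>R c"
        by (simp add: ZZ M_def pl blinfun.bilinear_simps scaleR_2)
      finally show ?thesis using c by simp
    qed
    then show ?thesis by (simp add: matrix_eq flip: matrix_vector_mul_assoc)
  qed
  ultimately show ?thesis using that by blast
qed

lemma msqrt:
  assumes "posdef P"
  shows "posdef (msqrt P)" "msqrt P ** msqrt P = P"
proof -
  have "\<exists>!S. posdef S \<and> S ** S = P"
    using posdef_sqrt_exists[OF assms] posdef_sqrt_unique by metis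
  from theI'[OF this] show "posdef (msqrt P)" "msqrt P ** msqrt P = P"
    by (auto simp: msqrt_def)
qed

section \<open>The symmetric part of the generator in the weighted inner product\<close>

lemma transpose_add: "transpose (A + B) = transpose A + transpose B" for A B :: "real^'n^'m"
  by (simp add: transpose_def vec_eq_iff)

text \<open>Twice the symmetric part of \<open>G\<close> with respect to the inner product weighted
  by \<open>P\<close>, expressed in the coordinates \<open>msqrt P *v y\<close>. Half its extreme
  eigenvalues are the numbers \<eta>min and \<eta>max of the theorem when \<open>G\<close> is
  \<open>Gd\<close>.\<close>

definition weighted_sym :: "real^'n^'n \<Rightarrow> real^'n^'n \<Rightarrow> real^'n^'n" where
  "weighted_sym P G = msqrt P ** G ** matrix_inv (msqrt P) + matrix_inv (msqrt P) ** transpose G ** msqrt P"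

context
  fixes P G :: "real^'n^'n"
  assumes P: "posdef P"
begin

lemmas msqrt_inverse = matrix_inv_mult[OF posdef_invertible[OF msqrt(1)[OF P]]]

lemma transpose_msqrt:
  "transpose (msqrt P) = msqrt P" "transpose (matrix_inv (msqrt P)) = matrix_inv (msqrt P)"
  using posdefD(1) msqrt(1)[OF P] posdef_matrix_inv by blast+

lemma transpose_weighted_sym: "transpose (weighted_sym P G) = weighted_sym P G"
  by (simp add: weighted_sym_def transpose_add matrix_transpose_mul transpose_msqrt matrix_mul_assoc add.commute)

lemma weighted_norm: "(msqrt P *v y) \<bullet> (msqrt P *v y) = y \<bullet> (P *v y)"
  by (metis msqrt(2)[OF P] matrix_vector_mul_assoc symmetric_inner[OF transpose_msqrt(1)])

lemma weighted_form:
  "(msqrt P *v y) \<bullet> (weighted_sym P G *v (msqrt P *v y)) = 2 * (y \<bullet> (P *v (G *v y)))"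
proof -
  define z where "z = msqrt P *v y"
  have y: "matrix_inv (msqrt P) *v z = y"
    by (simp add: z_def matrix_vector_mul_assoc msqrt_inverse)
  have "z \<bullet> (weighted_sym P G *v z) = z \<bullet> (msqrt P *v (G *v (matrix_inv (msqrt P) *v z)))
      + z \<bullet> (matrix_inv (msqrt P) *v (transpose G *v (msqrt P *v z)))"
    unfolding weighted_sym_def
    by (simp only: matrix_vector_mult_add_rdistrib inner_add_right matrix_vector_mul_assoc matrix_mul_assoc)
  also have "z \<bullet> (msqrt P *v (G *v (matrix_inv (msqrt P) *v z))) = (msqrt P *v z) \<bullet> (G *v y)"
    unfolding y by (rule symmetric_inner[OF transpose_msqrt(1)])
  also have "z \<bullet> (matrix_inv (msqrt P) *v (transpose G *v (msqrt P *v z))) = y \<bullet> (transpose G *v (msqrt P *v z))"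
    using symmetric_inner[OF transpose_msqrt(2)] y by metis
  also have "\<dots> = (msqrt P *v z) \<bullet> (G *v y)"
    by (metis dot_lmul_matrix inner_commute transpose_matrix_vector)
  also have "msqrt P *v z = P *v y"
    by (simp add: z_def msqrt(2)[OF P] matrix_vector_mul_assoc)
  finally show ?thesis
    using symmetric_inner[OF posdefD(1)[OF P], of y "G *v y"] by (simp add: z_def)
qed

lemma weighted_Rayleigh:
  shows "1/2 * lambda_min (weighted_sym P G) * (y \<bullet> (P *v y)) \<le> y \<bullet> (P *v (G *v y))"
    and "y \<bullet> (P *v (G *v y)) \<le> 1/2 * lambda_max (weighted_sym P G) * (y \<bullet> (P *v y))"
  using lambda_min_le_Rayleigh[OF transpose_weighted_sym, of "msqrt P *v y"]
    Rayleigh_le_lambda_max[OF transpose_weighted_sym, of "msqrt P *v y"]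
  by (simp_all add: weighted_norm weighted_form)

text \<open>The minimum is attained at an eigenvector; pulled back by the inverse root, its Rayleigh
  quotient becomes the assumed positive form.\<close>

lemma lambda_min_weighted_sym_pos:
  assumes "\<And>y. y \<noteq> 0 \<Longrightarrow> 0 < y \<bullet> (P *v (G *v y))"
  shows "0 < lambda_min (weighted_sym P G)"
proof -
  let ?M = "weighted_sym P G"
  have "eigenvalues ?M \<noteq> {}"
    using Rayleigh_maximum[OF transpose_weighted_sym] by blast
  then have "lambda_min ?M \<in> eigenvalues ?M"
    unfolding lambda_min_def by (intro Min_in finite_eigenvalues_symmetric transpose_weighted_sym)
  then obtain v where v: "v \<noteq> 0" "?M *v v = lambda_min ?M *\<^sub>R v"
    by (auto simp: eigenvalues_def scalar_mult_eq_scaleR)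
  define y where "y = matrix_inv (msqrt P) *v v"
  have vy: "v = msqrt P *v y" by (simp add: y_def matrix_vector_mul_assoc msqrt_inverse)
  then have "y \<noteq> 0" using v(1) by auto
  have "lambda_min ?M * (v \<bullet> v) = v \<bullet> (?M *v v)" by (simp add: v(2))
  also have "\<dots> = 2 * (y \<bullet> (P *v (G *v y)))" unfolding vy by (rule weighted_form)
  also have "\<dots> > 0" using assms[OF \<open>y \<noteq> 0\<close>] by simp
  finally show ?thesis using v(1) by (metis inner_gt_zero_iff zero_less_mult_pos2)
qed

end

section \<open>The canonical homogeneous norm\<close>

lemma matrix_vector_mult_minus_right: "M *v (- x) = - (M *v x)" for M :: "real^'n^'m"
  by (rule bounded_bilinear.minus_right[OF bounded_bilinear_matrix_vector_mult])

text \<open>The constants \<open>a\<close> and \<open>b\<close> bound the exponential growth rate of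
  the weighted norm along dilation orbits. They become \<eta>min and \<eta>max in the theorem, and
  they are the exponents in all comparisons between \<open>N\<close> and \<open>V\<close>.\<close>

locale homogeneous_norm =
  fixes P G :: "real^'n^'n" and a b :: real
  assumes posdef: "posdef P" and a_pos: "0 < a"
    and lower: "\<And>y. a * (y \<bullet> (P *v y)) \<le> y \<bullet> (P *v (G *v y))"
    and upper: "\<And>y. y \<bullet> (P *v (G *v y)) \<le> b * (y \<bullet> (P *v y))"
begin

abbreviation N :: "real^'n \<Rightarrow> real" where "N \<equiv> wnorm P"
abbreviation V :: "real^'n \<Rightarrow> real" where "V \<equiv> hnorm P G"
abbreviation d :: "real \<Rightarrow> real^'n^'n" where "d \<equiv> dilation G"

lemma a_le_b: "a \<le> b"
proof -
  obtain y :: "real^'n" where "y \<noteq> 0" using zero_neq_one by blast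
  then have "y \<bullet> (P *v y) > 0" by (rule posdefD(2)[OF posdef])
  with order_trans[OF lower[of y] upper[of y]] show ?thesis by simp
qed

lemma b_pos: "0 < b"
  using a_pos a_le_b by simp

lemma N_square: "(N x)\<^sup>2 = x \<bullet> (P *v x)"
  using posdefD(3)[OF posdef, of x] by (simp add: wnorm_def)

lemma N_nonneg: "0 \<le> N x"
  using posdefD(3)[OF posdef, of x] by (simp add: wnorm_def)

lemma N_eq_0_iff [simp]: "N x = 0 \<longleftrightarrow> x = 0"
  using posdefD(2)[OF posdef, of x] by (cases "x = 0") (auto simp: wnorm_def)

lemma N_pos: "x \<noteq> 0 \<Longrightarrow> 0 < N x"
  using N_nonneg[of x] N_eq_0_iff[of x] by linarith

lemma N_eq_norm: "N x = norm (msqrt P *v x)"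
  by (simp add: wnorm_def norm_eq_sqrt_inner weighted_norm[OF posdef])

lemma N_triangle: "N (x + y) \<le> N x + N y"
  by (simp add: N_eq_norm matrix_vector_right_distrib norm_triangle_ineq)

lemma N_minus [simp]: "N (- x) = N x"
  by (simp add: wnorm_def matrix_vector_mult_minus_right)

lemma continuous_on_N [continuous_intros]:
  "continuous_on S f \<Longrightarrow> continuous_on S (\<lambda>x. N (f x))"
  unfolding wnorm_def by (intro continuous_intros) auto

lemma continuous_on_dilation [continuous_intros]:
  "continuous_on S f \<Longrightarrow> continuous_on S (\<lambda>x. dilation H (f x))"
  by (rule continuous_on_compose2[of UNIV "dilation H"])
    (auto intro!: continuous_at_imp_continuous_on has_vector_derivative_continuous dilation_has_vector_derivative)

lemma norm_le_N: obtains C where "C > 0" "\<And>x. norm x \<le> C * N x"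
proof -
  obtain l where l: "l > 0" "\<And>x. l * (x \<bullet> x) \<le> x \<bullet> (P *v x)"
    using posdef_lower_bound[OF posdef] by blast
  have "norm x \<le> (1 / sqrt l) * N x" for x
  proof (rule power2_le_imp_le)
    show "(norm x)\<^sup>2 \<le> ((1 / sqrt l) * N x)\<^sup>2"
      using l(1) l(2)[of x] by (simp add: power_mult_distrib power_divide N_square power2_norm_eq_inner field_simps)
    show "0 \<le> (1 / sqrt l) * N x" using l(1) N_nonneg[of x] by simp
  qed
  then show ?thesis using that[of "1 / sqrt l"] l(1) by simp
qed

section \<open>Growth of the weighted norm along dilation orbits\<close>

lemma dilation_cancel [simp]: "d (- s) *v (d s *v x) = x" "d s *v (d (- s) *v x) = x"
  using dilation_inverse[of G s] dilation_inverse[of G "- s"] by (simp_all add: matrix_vector_mul_assoc)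

lemma dilation_eq_0_iff [simp]: "d s *v x = 0 \<longleftrightarrow> x = 0"
  by (metis dilation_cancel(1) matrix_vector_mult_0_right)

lemma N_square_dilation_has_derivative:
  "((\<lambda>s. (N (d s *v x))\<^sup>2) has_real_derivative 2 * ((d s *v x) \<bullet> (P *v (G *v (d s *v x))))) (at s)"
proof -
  have 1: "((\<lambda>s. d s *v x) has_vector_derivative (G *v (d s *v x))) (at s)"
    using bounded_bilinear.has_vector_derivative[OF bounded_bilinear_matrix_vector_mult
        dilation_has_vector_derivative[of G s UNIV] has_vector_derivative_const[of x]]
    by (simp add: matrix_vector_mul_assoc)
  have 2: "((\<lambda>s. P *v (d s *v x)) has_vector_derivative (P *v (G *v (d s *v x)))) (at s)"
    using bounded_bilinear.has_vector_derivative[OF bounded_bilinear_matrix_vector_mult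
        has_vector_derivative_const[of P] 1] by simp
  show ?thesis
    using bounded_bilinear.has_vector_derivative[OF bounded_bilinear_inner 1 2]
      symmetric_inner[OF posdefD(1)[OF posdef], of "d s *v x" "G *v (d s *v x)"]
    by (simp add: N_square has_real_derivative_iff_has_vector_derivative inner_commute)
qed

text \<open>The squared norm \<phi> along an orbit satisfies 2 a \<phi> \<le> \<phi>' \<le> 2 b
  \<phi>, so multiplying it by \<open>exp (- 2 * a * s)\<close> or \<open>exp (- 2 * b * s)\<close>
  gives a monotone function.\<close>

lemma N_dilation_bounds:
  assumes "0 \<le> s"
  shows "exp (a * s) * N x \<le> N (d s *v x)" "N (d s *v x) \<le> exp (b * s) * N x"
proof -
  define \<phi> where "\<phi> s = (N (d s *v x))\<^sup>2" for s
  define \<psi> where "\<psi> s = (d s *v x) \<bullet> (P *v (G *v (d s *v x)))" for s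
  have exp_sq: "(exp (c * s))\<^sup>2 = exp (c * (s * 2))" for c :: real
    by (simp add: power2_eq_square flip: exp_add)
  have D\<phi>: "(\<phi> has_real_derivative 2 * \<psi> s) (at s)" for s
    using N_square_dilation_has_derivative[of x s] by (simp add: \<phi>_def[abs_def] \<psi>_def)
  have D: "((\<lambda>s. exp (- 2 * c * s) * \<phi> s) has_real_derivative
      2 * exp (- 2 * c * s) * (\<psi> s - c * \<phi> s)) (at s)" for c s
    by (auto intro!: derivative_eq_intros D\<phi> simp: algebra_simps)
  have low: "0 \<le> 2 * exp (- 2 * a * s) * (\<psi> s - a * \<phi> s)" for s
    using lower by (simp add: \<phi>_def \<psi>_def N_square)
  have up: "2 * exp (- 2 * b * s) * (\<psi> s - b * \<phi> s) \<le> 0" for s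
    using upper by (simp add: \<phi>_def \<psi>_def N_square mult_le_0_iff)
  have "exp (- 2 * a * 0) * \<phi> 0 \<le> exp (- 2 * a * s) * \<phi> s"
    by (rule DERIV_nonneg_imp_nondecreasing[OF assms]) (use D low in blast)
  then have "(exp (a * s) * N x)\<^sup>2 \<le> (N (d s *v x))\<^sup>2"
    by (simp add: \<phi>_def power_mult_distrib exp_minus field_simps exp_sq)
  then show "exp (a * s) * N x \<le> N (d s *v x)"
    by (rule power2_le_imp_le) (rule N_nonneg)
  have "exp (- 2 * b * s) * \<phi> s \<le> exp (- 2 * b * 0) * \<phi> 0"
    by (rule DERIV_nonpos_imp_nonincreasing[OF assms]) (use D up in blast)
  then have "(N (d s *v x))\<^sup>2 \<le> (exp (b * s) * N x)\<^sup>2"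
    by (simp add: \<phi>_def power_mult_distrib exp_minus field_simps exp_sq)
  then show "N (d s *v x) \<le> exp (b * s) * N x"
    by (rule power2_le_imp_le) (simp add: N_nonneg)
qed

lemma N_dilation_strict_mono:
  assumes "x \<noteq> 0" "s < t"
  shows "N (d s *v x) < N (d t *v x)"
proof -
  have "N (d s *v x) < exp (a * (t - s)) * N (d s *v x)"
    using assms a_pos N_pos[of "d s *v x"] by simp
  also have "\<dots> \<le> N (d (t - s) *v (d s *v x))"
    using assms(2) by (intro N_dilation_bounds) simp
  also have "\<dots> = N (d t *v x)"
    by (simp add: matrix_vector_mul_assoc flip: dilation_add)
  finally show ?thesis .
qed

lemma N_dilation_less_iff: "x \<noteq> 0 \<Longrightarrow> N (d s *v x) < N (d t *v x) \<longleftrightarrow> s < t"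
  using N_dilation_strict_mono[of x s t] N_dilation_strict_mono[of x t s] by (cases s t rule: linorder_cases) auto

lemma ex_unit_dilation:
  assumes "x \<noteq> 0"
  shows "\<exists>!s. N (d (- s) *v x) = 1"
proof -
  \<comment> \<open>Dilating by \<open>L\<close> scales the norm by at least
    \<open>exp (a * L)\<close>, the larger of \<open>N x\<close> and its reciprocal. Hence the orbit
    crosses the unit sphere between \<open>- L\<close> and \<open>L\<close>.\<close>
  define L where "L = \<bar>ln (N x)\<bar> / a"
  have L: "L \<ge> 0" using a_pos by (simp add: L_def)
  have eL: "exp (- (a * L)) \<le> N x" "N x \<le> exp (a * L)"
  proof -
    have "a * L = \<bar>ln (N x)\<bar>" "N x = exp (ln (N x))"
      using N_pos[OF assms] a_pos by (auto simp: L_def)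
    then show "exp (- (a * L)) \<le> N x" "N x \<le> exp (a * L)"
      by (metis abs_ge_minus_self abs_ge_self exp_le_cancel_iff minus_le_iff)+
  qed
  have "N (d (- L) *v x) \<le> 1"
  proof -
    have "exp (a * L) * N (d (- L) *v x) \<le> N x"
      using N_dilation_bounds(1)[OF L, of "d (- L) *v x"] by simp
    also have "\<dots> \<le> exp (a * L)" by (rule eL)
    finally show ?thesis by simp
  qed
  moreover have "1 \<le> N (d L *v x)"
  proof -
    have "1 = exp (a * L) * exp (- (a * L))" by (simp flip: exp_add)
    also have "\<dots> \<le> exp (a * L) * N x" using eL by simp
    also have "\<dots> \<le> N (d L *v x)" by (rule N_dilation_bounds(1)[OF L])
    finally show ?thesis .
  qed
  moreover have "continuous_on {- L..L} (\<lambda>s. N (d s *v x))"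
    by (intro continuous_intros)
  ultimately obtain s where "N (d s *v x) = 1"
    using IVT'[of "\<lambda>s. N (d s *v x)" "- L" 1 L] L by auto
  then have "N (d (- (- s)) *v x) = 1" by simp
  moreover have "s = t" if "N (d (- s) *v x) = 1" "N (d (- t) *v x) = 1" for s t
    using that N_dilation_less_iff[OF assms, of "- s" "- t"] N_dilation_less_iff[OF assms, of "- t" "- s"]
    by simp
  ultimately show ?thesis by blast
qed

section \<open>Level sets, homogeneity and continuity of the canonical norm\<close>

lemma V_0 [simp]: "V 0 = 0"
  by (simp add: hnorm_def)

lemma V_pos_iff [simp]: "0 < V x \<longleftrightarrow> x \<noteq> 0"
  by (simp add: hnorm_def)

lemma V_nonneg: "0 \<le> V x"
  by (simp add: hnorm_def)

lemma V_eq_0_iff [simp]: "V x = 0 \<longleftrightarrow> x = 0"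
  by (simp add: hnorm_def)

lemma N_unit:
  assumes "x \<noteq> 0"
  shows "N (d (- ln (V x)) *v x) = 1"
  using theI'[OF ex_unit_dilation[OF assms]] assms by (simp add: hnorm_def)

text \<open>Sublevel sets of \<open>V\<close> are preimages of the unit ball under linear maps. This
  stands in for the implicit function theorem, both for continuity of \<open>V\<close> and for its
  decay.\<close>

lemma V_less_exp_iff: "V x < exp s \<longleftrightarrow> N (d (- s) *v x) < 1"
proof (cases "x = 0")
  case False
  have "N (d (- s) *v x) < N (d (- ln (V x)) *v x) \<longleftrightarrow> ln (V x) < s"
    using N_dilation_less_iff[OF False] by simp
  moreover have "ln (V x) < s \<longleftrightarrow> V x < exp s"
    using False by (metis V_pos_iff exp_gt_zero ln_exp ln_less_cancel_iff)
  ultimately show ?thesis by (simp add: N_unit[OF False])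
qed (simp add: wnorm_def)

lemma V_greater_exp_iff: "exp s < V x \<longleftrightarrow> 1 < N (d (- s) *v x)"
proof (cases "x = 0")
  case False
  have "N (d (- ln (V x)) *v x) < N (d (- s) *v x) \<longleftrightarrow> s < ln (V x)"
    using N_dilation_less_iff[OF False] by simp
  moreover have "s < ln (V x) \<longleftrightarrow> exp s < V x"
    using False by (metis V_pos_iff exp_gt_zero ln_exp ln_less_cancel_iff)
  ultimately show ?thesis by (simp add: N_unit[OF False])
qed (simp add: wnorm_def)

lemma V_le_exp_iff: "V x \<le> exp s \<longleftrightarrow> N (d (- s) *v x) \<le> 1"
  using V_greater_exp_iff[of s x] by linarith

lemma V_eqI: "N (d (- s) *v x) = 1 \<Longrightarrow> V x = exp s"
  using V_less_exp_iff[of x s] V_greater_exp_iff[of s x] by linarith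

lemma V_dilation: "V (d s *v x) = exp s * V x"
proof (cases "x = 0")
  case False
  have "N (d (- (s + ln (V x))) *v (d s *v x)) = 1"
    using N_unit[OF False] by (simp add: matrix_vector_mul_assoc flip: dilation_add)
  from V_eqI[OF this] show ?thesis using False by (simp add: exp_add)
qed simp

lemma continuous_on_V [continuous_intros]:
  assumes "continuous_on S f"
  shows "continuous_on S (\<lambda>x. V (f x))"
proof -
  have op: "open {x. V x < e}" "open {x. e < V x}" for e
  proof -
    show "open {x. V x < e}"
    proof (cases "e > 0")
      case True
      have "{x. V x < e} = {x. N (d (- ln e) *v x) < 1}"
        using V_less_exp_iff[of _ "ln e"] True by simp
      also have "open \<dots>" by (intro open_Collect_less continuous_intros)
      finally show ?thesis .
    next
      case False
      then have "{x. V x < e} = {}" using V_nonneg by (auto simp: not_less intro: order_trans)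
      then show ?thesis by simp
    qed
    show "open {x. e < V x}"
    proof (cases "e > 0")
      case True
      have "{x. e < V x} = {x. 1 < N (d (- ln e) *v x)}"
        using V_greater_exp_iff[of "ln e"] True by simp
      also have "open \<dots>" by (intro open_Collect_less continuous_intros)
      finally show ?thesis .
    next
      case False
      \<comment> \<open>Level 0 is not of the form \<open>exp s\<close>; there the superlevel set is
        the punctured space, and below it everything.\<close>
      then have "{x. e < V x} = (if e = 0 then - {0} else UNIV)"
        by (auto simp: not_less less_le_trans[OF _ V_nonneg])
      then show ?thesis by auto
    qed
  qed
  have "continuous_on UNIV V"
    unfolding continuous_on_def
  proof (intro ballI order_tendstoI)
    show "eventually (\<lambda>y. e < V y) (at x)" if "e < V x" for e x
      using op(2) that unfolding eventually_at_topological by blast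
    show "eventually (\<lambda>y. V y < e) (at x)" if "V x < e" for e x
      using op(1) that unfolding eventually_at_topological by blast
  qed
  then show ?thesis
    by (rule continuous_on_compose2[OF _ assms]) simp
qed

text \<open>Write \<open>x = d s *v y\<close> with \<open>y\<close> on the unit sphere and
  \<open>s = ln (V x)\<close>. For \<open>s \<ge> 0\<close> the orbit from \<open>y\<close> grows at
  rate at most \<open>b\<close>; for \<open>s \<le> 0\<close> it is followed from \<open>x\<close>
  up to \<open>y\<close>, where the lower rate \<open>a\<close> counts.\<close>

lemma N_le_V:
  shows "V x \<le> 1 \<Longrightarrow> N x \<le> V x powr a" "1 \<le> V x \<Longrightarrow> N x \<le> V x powr b"
proof -
  have "(V x \<le> 1 \<longrightarrow> N x \<le> V x powr a) \<and> (1 \<le> V x \<longrightarrow> N x \<le> V x powr b)"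
  proof (cases "x = 0")
    case False
    define s where "s = ln (V x)"
    define y where "y = d (- s) *v x"
    have y: "N y = 1" "x = d s *v y" using N_unit[OF False] by (auto simp: y_def s_def)
    have Vp: "V x powr c = exp (c * s)" for c using False by (simp add: powr_def s_def)
    have "N x \<le> exp (b * s)" if "s \<ge> 0"
      using N_dilation_bounds(2)[OF that, of y] y by simp
    moreover have "N x \<le> exp (a * s)" if "s \<le> 0"
      using N_dilation_bounds(1)[of "- s" x] that y by (simp add: y_def[symmetric] exp_minus field_simps)
    ultimately show ?thesis using False Vp by (simp add: s_def)
  qed (simp add: wnorm_def)
  then show "V x \<le> 1 \<Longrightarrow> N x \<le> V x powr a" "1 \<le> V x \<Longrightarrow> N x \<le> V x powr b" by auto
qed

text \<open>Adding both powers covers the two regimes with one strictly increasing function, from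
  which the class K gains are later built.\<close>

lemma N_le_V_sum: "N x \<le> V x powr a + V x powr b"
  using N_le_V[of x] by (smt (verit) powr_ge_zero)

lemma V_le_N_sum: "V x \<le> N x powr (1 / a) + N x powr (1 / b)"
proof (cases "x = 0")
  case False
  define s where "s = ln (V x)"
  define y where "y = d (- s) *v x"
  have y: "N y = 1" "x = d s *v y" using N_unit[OF False] by (auto simp: y_def s_def)
  have V: "V x = exp s" using False by (simp add: s_def)
  have "exp s \<le> N x powr (1 / a)" if "s \<ge> 0"
  proof -
    have "exp (a * s) \<le> N x" using N_dilation_bounds(1)[OF that, of y] y by simp
    then have "exp (a * s) powr (1 / a) \<le> N x powr (1 / a)" using a_pos by (intro powr_mono2) auto
    then show ?thesis using a_pos by (simp add: powr_def)
  qed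
  moreover have "exp s \<le> N x powr (1 / b)" if "s \<le> 0"
  proof -
    have "exp (b * s) \<le> N x"
      using N_dilation_bounds(2)[of "- s" x] that y by (simp add: y_def[symmetric] exp_minus field_simps)
    then have "exp (b * s) powr (1 / b) \<le> N x powr (1 / b)" using b_pos by (intro powr_mono2) auto
    then show ?thesis using b_pos by (simp add: powr_def)
  qed
  ultimately show ?thesis unfolding V by (smt (verit) powr_ge_zero)
qed simp

end

section \<open>Absolutely continuous functions and scalar comparison\<close>

lemma abs_cont_on_imp_continuous_on:
  fixes x :: "real \<Rightarrow> 'a::real_normed_vector"
  assumes "abs_cont_on {a..b} x"
  shows "continuous_on {a..b} x"
  unfolding continuous_on_iff
proof (intro ballI allI impI)
  fix t e :: real assume t: "t \<in> {a..b}" and "e > 0"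
  then obtain d where "d > 0" and d: "\<And>\<D>. \<D> division_of \<Union>\<D> \<Longrightarrow> \<Union>\<D> \<subseteq> {a..b} \<Longrightarrow>
      (\<Sum>k\<in>\<D>. Sup k - Inf k) < d \<Longrightarrow> (\<Sum>k\<in>\<D>. norm (x (Sup k) - x (Inf k))) < e"
    using assms[unfolded abs_cont_on_def, rule_format, OF \<open>e > 0\<close>] by blast
  have *: "norm (x v - x u) < e" if "u \<in> {a..b}" "v \<in> {a..b}" "u \<le> v" "v - u < d" for u v
    using d[of "{{u..v}}"] that division_of_self[of u v] by auto
  have "dist (x t') (x t) < e" if "t' \<in> {a..b}" "dist t' t < d" for t'
    using *[of t t'] *[of t' t] t that by (cases "t \<le> t'") (auto simp: dist_norm norm_minus_commute)
  then show "\<exists>d>0. \<forall>t'\<in>{a..b}. dist t' t < d \<longrightarrow> dist (x t') (x t) < e"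
    using \<open>d > 0\<close> by blast
qed

text \<open>Cousin's lemma: around points with a derivative the increments are controlled by the
  derivative, and the tagged intervals at the exceptional points have small total length.\<close>

lemma abs_cont_on_increment_le:
  fixes x :: "real \<Rightarrow> 'a::euclidean_space"
  assumes ac: "abs_cont_on S x" and sub: "{a..b} \<subseteq> S" and "a \<le> b" and neg: "negligible E"
    and deriv: "\<And>t. t \<in> {a..b} - E \<Longrightarrow> \<exists>v. (x has_vector_derivative v) (at t) \<and> u \<bullet> v \<le> m"
  shows "u \<bullet> (x b - x a) \<le> m * (b - a)"
proof (rule field_le_epsilon)
  fix e :: real assume "e > 0"
  \<comment> \<open>The error \<open>e\<close> is shared in thirds: \<open>c * (b - a)\<close> for
    the intervals tagged at points with a derivative, \<open>norm u * e1\<close> for the variation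
    of \<open>x\<close> over the intervals tagged in \<open>E\<close>, and
    \<open>\<bar>m + c\<bar> * d'\<close> for the total length of the latter.\<close>
  define c where "c = e / (3 * (b - a + 1))"
  have c: "c > 0" "c * (b - a) \<le> e / 3"
    using \<open>e > 0\<close> \<open>a \<le> b\<close> by (auto simp: c_def field_simps)
  have nu: "norm u + 1 > 0" by (simp add: add_nonneg_pos)
  define e2 where "e2 = c / (norm u + 1)"
  have e2: "e2 > 0" "norm u * e2 \<le> c"
    using c(1) by (auto simp: e2_def divide_le_eq mult.commute[of c] add_nonneg_pos intro!: mult_right_mono)
  define e1 where "e1 = e / (3 * (norm u + 1))"
  have e1: "e1 > 0" "norm u * e1 \<le> e / 3"
    using \<open>e > 0\<close> nu by (auto simp: e1_def intro!: divide_pos_pos) (simp add: field_simps)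
  obtain d where "d > 0" and d: "\<And>\<D>. \<D> division_of \<Union>\<D> \<Longrightarrow> \<Union>\<D> \<subseteq> S \<Longrightarrow>
      (\<Sum>k\<in>\<D>. Sup k - Inf k) < d \<Longrightarrow> (\<Sum>k\<in>\<D>. norm (x (Sup k) - x (Inf k))) < e1"
    using ac[unfolded abs_cont_on_def, rule_format, OF e1(1)] by blast
  define d' where "d' = min d (e / (3 * (\<bar>m + c\<bar> + 1)))"
  have d': "d' > 0" "d' \<le> d" "\<bar>m + c\<bar> * d' \<le> e / 3"
  proof -
    show "d' > 0" "d' \<le> d" using \<open>d > 0\<close> \<open>e > 0\<close> by (auto simp: d'_def intro!: divide_pos_pos add_nonneg_pos)
    have "\<bar>m + c\<bar> * d' \<le> \<bar>m + c\<bar> * (e / (3 * (\<bar>m + c\<bar> + 1)))"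
      by (intro mult_left_mono) (auto simp: d'_def)
    also have "\<dots> = e / 3 * (\<bar>m + c\<bar> / (\<bar>m + c\<bar> + 1))" by simp
    also have "\<dots> \<le> e / 3 * 1" using \<open>e > 0\<close> by (intro mult_left_mono) auto
    also have "\<dots> = e / 3" by simp
    finally show "\<bar>m + c\<bar> * d' \<le> e / 3" .
  qed
  have E: "E \<in> null_sets lebesgue" using neg by (simp add: negligible_iff_null_sets)
  then obtain T where T: "open T" "E \<subseteq> T" "T - E \<in> lmeasurable" "emeasure lebesgue (T - E) < ennreal d'"
    using sets_lebesgue_outer_open[of E d'] d'(1) by auto
  have Tm: "T \<in> lmeasurable" "measure lebesgue T < d'"
  proof -
    have eq: "T = (T - E) \<union> E" using T(2) by blast
    have em: "emeasure lebesgue T = emeasure lebesgue (T - E)"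
      using emeasure_Un_null_set[of "T - E" lebesgue E] T(3) E eq by auto
    then show Tl: "T \<in> lmeasurable"
      using T by (auto simp: fmeasurable_def intro: borel_open)
    have "ennreal (measure lebesgue T) < ennreal d'"
      using em T(4) Tl by (simp add: emeasure_eq_measure2)
    then show "measure lebesgue T < d'" by (simp add: ennreal_less_iff)
  qed
  \<comment> \<open>Straddle estimate: the tag lies between \<open>p\<close> and \<open>q\<close>,
    so the two linearisation errors add up to at most \<open>e2\<close> times the length of the
    interval.\<close>
  have "\<exists>r>0. \<forall>p q. p \<le> t \<and> t \<le> q \<and> {p..q} \<subseteq> ball t r \<longrightarrow> u \<bullet> (x q - x p) \<le> (m + c) * (q - p)"
    if "t \<in> {a..b} - E" for t
  proof -
    obtain v where v: "(x has_vector_derivative v) (at t)" "u \<bullet> v \<le> m" using deriv \<open>t \<in> {a..b} - E\<close> by blast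
    then obtain r where r: "r > 0" "\<And>s. norm (s - t) < r \<Longrightarrow> norm (x s - x t - (s - t) *\<^sub>R v) \<le> e2 * norm (s - t)"
      using e2(1) unfolding has_vector_derivative_def has_derivative_at_alt by blast
    have "u \<bullet> (x q - x p) \<le> (m + c) * (q - p)" if "p \<le> t" "t \<le> q" "{p..q} \<subseteq> ball t r" for p q
    proof -
      have pq: "p \<in> ball t r" "q \<in> ball t r"
        using subsetD[OF that(3), of p] subsetD[OF that(3), of q] that(1,2) by auto
      have "norm (x q - x t - (q - t) *\<^sub>R v) \<le> e2 * (q - t)" "norm (x p - x t - (p - t) *\<^sub>R v) \<le> e2 * (t - p)"
        using r(2)[of q] r(2)[of p] pq that by (auto simp: dist_norm abs_minus_commute)
      then have "norm ((x q - x t - (q - t) *\<^sub>R v) - (x p - x t - (p - t) *\<^sub>R v)) \<le> e2 * (q - t) + e2 * (t - p)"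
        by (meson add_mono norm_triangle_ineq4 order_trans)
      moreover have "(x q - x t - (q - t) *\<^sub>R v) - (x p - x t - (p - t) *\<^sub>R v) = x q - x p - (q - p) *\<^sub>R v"
        by (simp add: algebra_simps)
      ultimately have n: "norm (x q - x p - (q - p) *\<^sub>R v) \<le> e2 * (q - p)"
        by (simp add: algebra_simps)
      have "u \<bullet> (x q - x p) = (q - p) * (u \<bullet> v) + u \<bullet> (x q - x p - (q - p) *\<^sub>R v)"
        by (simp add: inner_diff_right)
      also have "\<dots> \<le> (q - p) * m + norm u * (e2 * (q - p))"
        using that v(2) order_trans[OF norm_cauchy_schwarz mult_left_mono[OF n norm_ge_zero]]
        by (intro add_mono mult_left_mono) auto
      also have "\<dots> = (q - p) * m + (norm u * e2) * (q - p)" by simp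
      also have "\<dots> \<le> (q - p) * m + c * (q - p)"
        using e2(2) that by (intro add_left_mono mult_right_mono) auto
      finally show ?thesis by (simp add: algebra_simps)
    qed
    then show ?thesis using r(1) by blast
  qed
  then obtain r where r: "\<And>t. t \<in> {a..b} - E \<Longrightarrow> r t > 0"
    "\<And>t p q. t \<in> {a..b} - E \<Longrightarrow> p \<le> t \<Longrightarrow> t \<le> q \<Longrightarrow> {p..q} \<subseteq> ball t (r t) \<Longrightarrow> u \<bullet> (x q - x p) \<le> (m + c) * (q - p)"
    by metis
  \<comment> \<open>Intervals tagged in \<open>E\<close> are forced into the open set
    \<open>T\<close> of measure below \<open>d'\<close>, which bounds their total length. The unit
    ball is a default for points outside \<open>{a..b}\<close>.\<close>
  define \<gamma> where "\<gamma> t = (if t \<in> E then T else if t \<in> {a..b} then ball t (r t) else ball t 1)" for t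
  have "gauge \<gamma>"
    using T(1,2) r(1) by (auto simp: gauge_def \<gamma>_def)
  then obtain p where p: "p tagged_division_of {a..b}" "\<gamma> fine p"
    using fine_division_exists_real by blast
  have fin: "finite p" using p(1) by blast
  have K: "\<exists>v w. k = {v..w} \<and> v \<le> t \<and> t \<le> w \<and> t \<in> {a..b} \<and> {v..w} \<subseteq> {a..b} \<and> {v..w} \<subseteq> \<gamma> t"
    if "(t, k) \<in> p" for t k
    using tagged_division_ofD(2,3,4)[OF p(1) that] fineD[OF p(2) that] by force
  \<comment> \<open>The excess of an increment over the permitted slope is additive over intervals,
    so its sum over the tagged division telescopes.\<close>
  define \<Delta> where "\<Delta> k = u \<bullet> (x (Sup k) - x (Inf k)) - (m + c) * (Sup k - Inf k)" for k
  have tot: "(\<Sum>(t, k)\<in>p. \<Delta> k) = u \<bullet> (x b - x a) - (m + c) * (b - a)"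
    using additive_tagged_division_1[OF \<open>a \<le> b\<close> p(1), of "\<lambda>t. u \<bullet> x t - (m + c) * t"]
    by (simp add: \<Delta>_def algebra_simps)
  define pE where "pE = {(t, k) \<in> p. t \<in> E}"
  have pE: "pE \<subseteq> p" by (auto simp: pE_def)
  have good: "(\<Sum>(t, k)\<in>p - pE. \<Delta> k) \<le> 0"
  proof (rule sum_nonpos, clarify)
    fix t k assume tk: "(t, k) \<in> p" "(t, k) \<notin> pE"
    obtain v w where vw: "k = {v..w}" "v \<le> t" "t \<le> w" "t \<in> {a..b}" "{v..w} \<subseteq> \<gamma> t"
      using K[OF tk(1)] by blast
    have "t \<notin> E" using tk by (auto simp: pE_def)
    then show "\<Delta> k \<le> 0"
      using r(2)[of t v w] vw by (simp add: \<Delta>_def \<gamma>_def)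
  qed
  have partE: "pE tagged_partial_division_of {a..b}"
    using tagged_partial_division_subset[OF _ pE] p(1) tagged_division_of_def by blast
  note divE = tagged_partial_division_of_Union_self[OF partE]
  define \<D> where "\<D> = snd ` pE"
  have D: "\<D> division_of \<Union>\<D>" using division_of_tagged_division[OF divE] by (simp add: \<D>_def)
  have DK: "\<exists>v w. k = {v..w} \<and> v \<le> w \<and> {v..w} \<subseteq> {a..b} \<and> {v..w} \<subseteq> T" if "k \<in> \<D>" for k
  proof -
    obtain t where "(t, k) \<in> pE" using \<open>k \<in> \<D>\<close> by (auto simp: \<D>_def)
    then have "(t, k) \<in> p" "t \<in> E" by (auto simp: pE_def)
    then show ?thesis using K[of t k] unfolding \<gamma>_def by (smt (verit))
  qed
  have len: "(\<Sum>k\<in>\<D>. Sup k - Inf k) < d'"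
  proof -
    have "(\<Sum>k\<in>\<D>. Sup k - Inf k) = (\<Sum>k\<in>\<D>. measure lebesgue k)"
      by (rule sum.cong) (use DK in force)+
    also have "\<dots> = measure lebesgue (\<Union>\<D>)" by (rule content_division[OF D])
    also have "\<dots> \<le> measure lebesgue T"
      using DK lmeasurable_division[OF D] Tm(1) by (intro measure_mono_fmeasurable) fastforce+
    finally show ?thesis using Tm(2) by simp
  qed
  have var: "(\<Sum>k\<in>\<D>. norm (x (Sup k) - x (Inf k))) < e1"
    using D len d'(2) DK sub by (intro d) fastforce+
  \<comment> \<open>Passing from tagged intervals to the bare division requires value 0 on
    degenerate intervals. The guard supplies it for the empty set, where \<open>Sup\<close> and
    \<open>Inf\<close> carry no information.\<close>
  have "(\<Sum>(t, k)\<in>pE. \<Delta> k) = (\<Sum>(t, k)\<in>pE. if k = {} then 0 else \<Delta> k)"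
    using K pE by (intro sum.cong) fastforce+
  also have "\<dots> = (\<Sum>k\<in>\<D>. if k = {} then 0 else \<Delta> k)"
    unfolding \<D>_def by (rule sum.over_tagged_division_lemma[OF divE]) (auto simp: \<Delta>_def)
  also have "\<dots> = (\<Sum>k\<in>\<D>. \<Delta> k)"
    using DK by (intro sum.cong) fastforce+
  also have "\<dots> \<le> (\<Sum>k\<in>\<D>. norm u * norm (x (Sup k) - x (Inf k)) + \<bar>m + c\<bar> * (Sup k - Inf k))"
  proof (rule sum_mono)
    fix k assume "k \<in> \<D>"
    then have "Sup k - Inf k \<ge> 0" using DK[of k] by auto
    then have "- ((m + c) * (Sup k - Inf k)) \<le> \<bar>m + c\<bar> * (Sup k - Inf k)"
      by (metis abs_ge_minus_self abs_mult abs_of_nonneg)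
    then show "\<Delta> k \<le> norm u * norm (x (Sup k) - x (Inf k)) + \<bar>m + c\<bar> * (Sup k - Inf k)"
      unfolding \<Delta>_def using norm_cauchy_schwarz[of u "x (Sup k) - x (Inf k)"] by linarith
  qed
  also have "\<dots> = norm u * (\<Sum>k\<in>\<D>. norm (x (Sup k) - x (Inf k))) + \<bar>m + c\<bar> * (\<Sum>k\<in>\<D>. Sup k - Inf k)"
    by (simp add: sum.distrib sum_distrib_left)
  also have "\<dots> \<le> norm u * e1 + \<bar>m + c\<bar> * d'"
    using var len by (intro add_mono mult_left_mono) auto
  also have "\<dots> \<le> e / 3 + e / 3" using e1 d' by (intro add_mono) auto
  finally have "(\<Sum>(t, k)\<in>pE. \<Delta> k) \<le> e / 3 + e / 3" .
  moreover have "(\<Sum>(t, k)\<in>p. \<Delta> k) = (\<Sum>(t, k)\<in>p - pE. \<Delta> k) + (\<Sum>(t, k)\<in>pE. \<Delta> k)"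
    by (rule sum.subset_diff[OF pE fin])
  ultimately have "u \<bullet> (x b - x a) \<le> (m + c) * (b - a) + (e / 3 + e / 3)"
    using tot good by linarith
  also have "\<dots> \<le> m * (b - a) + e"
    using c(2) by (simp add: algebra_simps)
  finally show "u \<bullet> (x b - x a) \<le> m * (b - a) + e" .
qed

text \<open>At the last time with \<open>W \<le> c\<close> continuity forces \<open>W = c\<close>,
  and there the local condition extends the bound beyond that last time.\<close>

lemma stays_below:
  fixes W :: "real \<Rightarrow> real"
  assumes cont: "continuous_on {s..t} W" and "s \<le> t" "W s \<le> c"
    and step: "\<And>r. r \<in> {s..<t} \<Longrightarrow> W r = c \<Longrightarrow> \<exists>\<delta>>0. \<forall>r'\<in>{r..r + \<delta>} \<inter> {..t}. W r' \<le> c"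
  shows "W t \<le> c"
proof (rule ccontr)
  assume "\<not> W t \<le> c"
  define R where "R = {r \<in> {s..t}. W r \<le> c}"
  have "closed R" unfolding R_def
    by (intro continuous_closed_preimage_constant continuous_on_closed_Collect_le cont continuous_intros)
  moreover have "bounded R" by (rule bounded_subset[of "{s..t}"]) (auto simp: R_def)
  moreover have "s \<in> R" using assms by (simp add: R_def)
  ultimately obtain r where r: "r \<in> R" "\<And>r'. r' \<in> R \<Longrightarrow> r' \<le> r"
    using compact_attains_sup[of R] compact_eq_bounded_closed by blast
  have rst: "r \<in> {s..<t}" using r(1) \<open>\<not> W t \<le> c\<close> by (cases "r = t") (auto simp: R_def)
  have "W r = c"
  proof -
    have "continuous_on {r..t} W" using continuous_on_subset[OF cont] rst by auto
    then obtain r' where "r \<le> r'" "r' \<le> t" "W r' = c"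
      using IVT'[of W r c t] r(1) rst \<open>\<not> W t \<le> c\<close> by (auto simp: R_def)
    with r(2)[of r'] rst show ?thesis by (auto simp: R_def)
  qed
  then obtain \<delta> where "\<delta> > 0" "\<forall>r'\<in>{r..r + \<delta>} \<inter> {..t}. W r' \<le> c" using step rst by blast
  then have "min (r + \<delta>) t \<in> R" using rst by (auto simp: R_def)
  with r(2) \<open>\<delta> > 0\<close> rst show False by fastforce
qed

text \<open>The decay condition is the right-hand difference quotient form of \<open>W' \<le> - k W\<^sup>1\<^sup>+\<^sup>\<mu>\<close>,
  imposed as long as \<open>L < W < H\<close>.\<close>

locale decay =
  fixes W :: "real \<Rightarrow> real" and k \<mu> L T :: real and H :: ereal
  assumes cont: "continuous_on {0..T} W" and k_pos: "k > 0" and L_nonneg: "L \<ge> 0"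
    and initial: "ereal (W 0) < H"
    and L_less_H: "ereal L < H"
    and step: "\<And>r. r \<in> {0..<T} \<Longrightarrow> L < W r \<Longrightarrow> ereal (W r) < H \<Longrightarrow>
      \<exists>\<delta>>0. \<forall>r'\<in>{r..r + \<delta>} \<inter> {..T}. W r' \<le> W r * exp (- (k * W r powr \<mu> * (r' - r)))"
begin

lemma le_max:
  assumes "0 \<le> s" "s \<le> t" "t \<le> T" "ereal (W s) < H"
  shows "W t \<le> max L (W s)"
proof (rule ccontr)
  assume "\<not> W t \<le> max L (W s)"
  moreover have "ereal (max L (W s)) < H" using assms(4) L_less_H by (simp add: max_def)
  ultimately have "ereal (max L (W s)) < min (ereal (W t)) H"
    by (simp only: not_le less_ereal.simps min_less_iff_conj)
  \<comment> \<open>The level \<open>c\<close> lies strictly inside the window from \<open>L\<close>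
    to \<open>H\<close>, so the decay condition is available whenever \<open>W\<close> equals it; at
    \<open>max L (W s)\<close> itself this could fail.\<close>
  then obtain c where c: "max L (W s) < c" "c < W t" "ereal c < H"
    using ereal_dense2 by (metis less_ereal.simps(1) min_less_iff_conj)
  have "W t \<le> c"
  proof (rule stays_below[of s t W])
    show "continuous_on {s..t} W" using continuous_on_subset[OF cont] assms by auto
    fix r assume r: "r \<in> {s..<t}" "W r = c"
    then obtain \<delta> where \<delta>: "\<delta> > 0" "\<forall>r'\<in>{r..r + \<delta>} \<inter> {..T}. W r' \<le> W r * exp (- (k * W r powr \<mu> * (r' - r)))"
      using step[of r] c assms by auto
    have "W r' \<le> c" if "r' \<in> {r..r + \<delta>} \<inter> {..t}" for r'
    proof -
      have "W r' \<le> W r * exp (- (k * W r powr \<mu> * (r' - r)))" using \<delta>(2) that assms by auto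
      also have "\<dots> \<le> W r * 1"
        using that r c L_nonneg k_pos by (intro mult_left_mono) auto
      finally show ?thesis using r by simp
    qed
    with \<delta>(1) show "\<exists>\<delta>>0. \<forall>r'\<in>{r..r + \<delta>} \<inter> {..t}. W r' \<le> c" by blast
  qed (use assms c in auto)
  with c show False by simp
qed

text \<open>Once at or below \<open>L\<close>, \<open>W\<close> never rises above it again. Being
  above \<open>L\<close> at time \<open>t\<close> therefore means that the decay was active at all
  earlier times.\<close>

lemma above_before:
  assumes "0 \<le> s" "s \<le> t" "t \<le> T" "L < W t"
  shows "L < W s" "ereal (W s) < H"
proof -
  show H: "ereal (W s) < H"
    using le_max[of 0 s] assms initial L_less_H
    by (metis (no_types, lifting) ereal_less_eq(3) le_less_trans max_def order.refl order_trans)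
  show "L < W s" using le_max[OF assms(1-3) H] assms(4) by (simp add: max_def split: if_splits)
qed

lemma monotone_from_step:
  assumes "0 \<le> T" and cont\<phi>: "continuous_on {0..T} \<phi>"
    and step\<phi>: "\<And>r. r \<in> {0..<T} \<Longrightarrow> \<exists>\<delta>>0. \<forall>r'\<in>{r..r + \<delta>} \<inter> {..T}. \<phi> r' \<le> \<phi> r"
  shows "\<phi> T \<le> (\<phi> 0 :: real)"
proof (rule stays_below[OF cont\<phi> \<open>0 \<le> T\<close> order.refl])
  fix r assume "r \<in> {0..<T}" "\<phi> r = \<phi> 0"
  then show "\<exists>\<delta>>0. \<forall>r'\<in>{r..r + \<delta>} \<inter> {..T}. \<phi> r' \<le> \<phi> 0"
    using step\<phi>[of r] by simp
qed

lemma fixed_time_bound: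
  assumes "\<mu> > 0" "0 \<le> T" "L < W T"
  shows "k * \<mu> * T \<le> W T powr (- \<mu>)"
proof -
  have W: "L < W r" "ereal (W r) < H" "0 < W r" if "r \<in> {0..T}" for r
    using above_before[of r T] that assms L_nonneg by auto
  have "k * \<mu> * T - W T powr (- \<mu>) \<le> k * \<mu> * 0 - W 0 powr (- \<mu>)"
  proof (rule monotone_from_step[OF assms(2)])
    show "continuous_on {0..T} (\<lambda>r. k * \<mu> * r - W r powr (- \<mu>))"
      using W(3) by (intro continuous_intros cont) fastforce
    fix r assume r: "r \<in> {0..<T}"
    then obtain \<delta> where \<delta>: "\<delta> > 0" "\<forall>r'\<in>{r..r + \<delta>} \<inter> {..T}. W r' \<le> W r * exp (- (k * W r powr \<mu> * (r' - r)))"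
      using step[of r] W[of r] by auto
    have "k * \<mu> * r' - W r' powr (- \<mu>) \<le> k * \<mu> * r - W r powr (- \<mu>)" if r': "r' \<in> {r..r + \<delta>} \<inter> {..T}" for r'
    proof -
      define \<theta> where "\<theta> = \<mu> * (k * W r powr \<mu> * (r' - r))"
      have pos: "0 < W r" "0 < W r'" using W(3) r r' by auto
      \<comment> \<open>The tangent bound of the exponential points the right way here, so no part
        of the rate is lost.\<close>
      have "W r powr (- \<mu>) * (1 + \<theta>) \<le> W r powr (- \<mu>) * exp \<theta>"
        by (intro mult_left_mono exp_ge_add_one_self) auto
      also have "\<dots> = (W r * exp (- (k * W r powr \<mu> * (r' - r)))) powr (- \<mu>)"
        using pos by (simp add: powr_mult \<theta>_def exp_powr_real mult_ac)
      also have "\<dots> \<le> W r' powr (- \<mu>)"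
        using pos \<delta>(2) r' assms(1) by (intro powr_mono2') auto
      finally have "W r powr (- \<mu>) + (W r powr (- \<mu>) * W r powr \<mu>) * (\<mu> * k * (r' - r)) \<le> W r' powr (- \<mu>)"
        by (simp add: \<theta>_def algebra_simps)
      also have "W r powr (- \<mu>) * W r powr \<mu> = 1" using pos by (simp flip: powr_add)
      finally show ?thesis by (simp add: algebra_simps)
    qed
    with \<delta>(1) show "\<exists>\<delta>>0. \<forall>r'\<in>{r..r + \<delta>} \<inter> {..T}.
        k * \<mu> * r' - W r' powr (- \<mu>) \<le> k * \<mu> * r - W r powr (- \<mu>)" by blast
  qed
  then show ?thesis by (smt (verit) mult_zero_right powr_ge_zero)
qed

text \<open>For negative \<mu> the exponential must be bounded from above, where its tangent is of
  no help. The chord-like bound costs half the slope and the restriction to \<theta> \<le>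
  1.\<close>

lemma exp_minus_le: "0 \<le> \<theta> \<Longrightarrow> \<theta> \<le> 1 \<Longrightarrow> exp (- \<theta>) \<le> 1 - \<theta> / 2" for \<theta> :: real
proof -
  assume \<theta>: "0 \<le> \<theta>" "\<theta> \<le> 1"
  have "\<theta> * \<theta> \<le> \<theta>" using \<theta> by (simp add: mult_left_le)
  then have "1 \<le> (1 - \<theta> / 2) * (1 + \<theta>)" by (simp add: algebra_simps)
  also have "\<dots> \<le> (1 - \<theta> / 2) * exp \<theta>" using \<theta> by (intro mult_left_mono exp_ge_add_one_self) auto
  finally show ?thesis by (simp add: exp_minus field_simps)
qed

text \<open>Now \<open>W powr (- \<mu>)\<close> has a positive exponent and decreases at rate at
  least \<open>k * (- \<mu>) / 2\<close>; since it cannot become negative, its initial value limits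
  the time spent above \<open>L\<close>.\<close>

lemma finite_time_bound:
  assumes "\<mu> < 0" "0 \<le> T" "L < W T"
  shows "k * (- \<mu>) / 2 * T \<le> W 0 powr (- \<mu>)"
proof -
  define p where "p = - \<mu>"
  have p: "p > 0" "\<mu> = - p" using assms by (auto simp: p_def)
  have W: "L < W r" "ereal (W r) < H" "0 < W r" if "r \<in> {0..T}" for r
    using above_before[of r T] that assms L_nonneg by auto
  have "k * p / 2 * T + W T powr p \<le> k * p / 2 * 0 + W 0 powr p"
  proof (rule monotone_from_step[OF assms(2)])
    show "continuous_on {0..T} (\<lambda>r. k * p / 2 * r + W r powr p)"
      using W(3) by (intro continuous_intros cont) fastforce+
    fix r assume r: "r \<in> {0..<T}"
    then have Wr: "W r > 0" using W by auto
    obtain \<delta> where \<delta>: "\<delta> > 0" "\<forall>r'\<in>{r..r + \<delta>} \<inter> {..T}. W r' \<le> W r * exp (- (k * W r powr \<mu> * (r' - r)))"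
      using step[of r] W[of r] r by auto
    \<comment> \<open>The second entry of the minimum is the step length at which \<theta> below
      reaches 1.\<close>
    define \<delta>' where "\<delta>' = min \<delta> (W r powr p / (p * k))"
    have \<delta>': "\<delta>' > 0" using \<delta>(1) p k_pos Wr by (simp add: \<delta>'_def)
    have "k * p / 2 * r' + W r' powr p \<le> k * p / 2 * r + W r powr p" if r': "r' \<in> {r..r + \<delta>'} \<inter> {..T}" for r'
    proof -
      define \<theta> where "\<theta> = p * (k * W r powr \<mu> * (r' - r))"
      have inv: "W r powr p * W r powr \<mu> = 1" using Wr p by (simp flip: powr_add)
      have pos: "0 \<le> W r'" "r' \<in> {r..r + \<delta>} \<inter> {..T}" using W(3)[of r'] r r' by (auto simp: \<delta>'_def)
      have "r' - r \<le> W r powr p / (p * k)" using r' by (auto simp: \<delta>'_def)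
      then have "(p * k) * (r' - r) \<le> W r powr p" using p k_pos by (simp add: field_simps)
      then have "((p * k) * (r' - r)) * W r powr \<mu> \<le> 1"
        using inv by (metis mult_right_mono powr_ge_zero)
      then have \<theta>1: "\<theta> \<le> 1" by (simp add: \<theta>_def mult_ac)
      have \<theta>0: "0 \<le> \<theta>" using p(1) k_pos r' by (simp add: \<theta>_def)
      have "W r' powr p \<le> (W r * exp (- (k * W r powr \<mu> * (r' - r)))) powr p"
        using \<delta>(2) pos p by (intro powr_mono2) auto
      also have "\<dots> = W r powr p * exp (- \<theta>)"
        using Wr by (simp add: powr_mult \<theta>_def exp_powr_real mult_ac)
      also have "\<dots> \<le> W r powr p * (1 - \<theta> / 2)"
        using exp_minus_le[OF \<theta>0 \<theta>1] by (intro mult_left_mono) auto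
      also have "\<dots> = W r powr p - (W r powr p * W r powr \<mu>) * (k * p / 2 * (r' - r))"
        by (simp add: \<theta>_def algebra_simps)
      finally show ?thesis unfolding inv by (simp add: field_simps)
    qed
    with \<delta>' show "\<exists>\<delta>>0. \<forall>r'\<in>{r..r + \<delta>} \<inter> {..T}.
        k * p / 2 * r' + W r' powr p \<le> k * p / 2 * r + W r powr p" by blast
  qed
  then show ?thesis unfolding p_def by (smt (verit) mult_zero_right powr_ge_zero)
qed

end

section \<open>Decay along Filippov solutions\<close>

lemma bounded_bilinear_vector_matrix_mult:
  "bounded_bilinear ((v*) :: real^'m \<Rightarrow> real^'n^'m \<Rightarrow> real^'n)"
  unfolding bilinear_conv_bounded_bilinear[symmetric] bilinear_def
  by (auto intro!: linearI simp: vector_matrix_mult_def vec_eq_iff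
      sum.distrib sum_distrib_left algebra_simps)

lemmas continuous_on_matrix_mult [continuous_intros] =
    bounded_bilinear.continuous_on[OF bounded_bilinear_matrix_mult]
  and continuous_on_vector_matrix_mult [continuous_intros] =
    bounded_bilinear.continuous_on[OF bounded_bilinear_vector_matrix_mult]

text \<open>The Filippov set is an intersection, hence contained in its member for the radius
  \<delta> and the empty null set.\<close>

lemma filippov_map_subset:
  assumes "\<delta> > 0" "closed C" "convex C" "\<And>y. y \<in> ball x \<delta> \<Longrightarrow> f y \<in> C"
  shows "filippov_map f x \<subseteq> C"
proof -
  have "filippov_map f x \<subseteq> closure (convex hull (f ` (ball x \<delta> - {})))"
    unfolding filippov_map_def using assms(1) by (intro INF_lower2[of \<delta>] INF_lower2[of "{}"]) auto
  also have "\<dots> \<subseteq> C"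
    using assms by (intro closure_minimal hull_minimal) auto
  finally show ?thesis .
qed

lemma filippov_solution_continuous:
  assumes "filippov_solution f \<tau> x" "ereal b < \<tau>"
  shows "continuous_on {0..b} x"
proof (cases "b \<ge> 0")
  case True
  then show ?thesis
    using assms by (intro abs_cont_on_imp_continuous_on) (auto simp: filippov_solution_def)
qed simp

lemma filippov_solution_increment_le:
  fixes f :: "'a::euclidean_space \<Rightarrow> 'a"
  assumes sol: "filippov_solution f \<tau> x" and "0 \<le> s" "s \<le> t" "ereal t < \<tau>"
    and le: "\<And>r v. r \<in> {s..t} \<Longrightarrow> v \<in> filippov_map f (x r) \<Longrightarrow> u \<bullet> v \<le> m"
  shows "u \<bullet> (x t - x s) \<le> m * (t - s)"
proof -
  have "AE r in lebesgue. 0 < r \<and> ereal r < \<tau> \<longrightarrow>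
      (\<exists>v\<in>filippov_map f (x r). (x has_vector_derivative v) (at r))"
    using sol by (simp add: filippov_solution_def)
  then obtain E where E: "negligible E" "{r. \<not> (0 < r \<and> ereal r < \<tau> \<longrightarrow>
      (\<exists>v\<in>filippov_map f (x r). (x has_vector_derivative v) (at r)))} \<subseteq> E"
    unfolding eventually_ae_filter_negligible by blast
  show ?thesis
  proof (rule abs_cont_on_increment_le)
    show "abs_cont_on {0..t} x" using sol assms by (simp add: filippov_solution_def)
    show "{s..t} \<subseteq> {0..t}" "s \<le> t" using assms by auto
    \<comment> \<open>With the endpoints counted as exceptional, the remaining times satisfy
      \<open>0 < r\<close>, as the differential inclusion demands, even for
      \<open>s = 0\<close>.\<close>
    show "negligible (insert s (insert t E))" using E(1) by simp
    fix r assume r: "r \<in> {s..t} - insert s (insert t E)"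
    then have "0 < r" "r < t" using assms by auto
    moreover from \<open>r < t\<close> have "ereal r < \<tau>" using assms(4) by (meson ereal_less_eq(3) less_imp_le order.strict_trans1)
    ultimately obtain v where "v \<in> filippov_map f (x r)" "(x has_vector_derivative v) (at r)"
      using E(2) r by auto
    then show "\<exists>v. (x has_vector_derivative v) (at r) \<and> u \<bullet> v \<le> m" using le r by auto
  qed
qed

section \<open>The one-sided decay estimate at a single time of a solution\<close>

context homogeneous_norm
begin

definition unit :: "real^'n \<Rightarrow> real^'n" where
  "unit y = d (- ln (V y)) *v y"

text \<open>Half the gradient in \<open>x\<close> of \<open>(N (d (- s) *v x))\<^sup>2\<close>, with
  \<open>s\<close> frozen at \<open>ln (V y)\<close>. Implicit differentiation of the equation
  \<open>N (d (- s) *v x) = 1\<close> yields V' = V (\<open>grad\<close> . x') /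
  \<open>rate\<close>, so \<open>grad y \<bullet> f y \<le> - c * V y powr \<mu> * rate y\<close>
  encodes V' \<le> - c V powr (1 + \<mu>).\<close>

definition grad :: "real^'n \<Rightarrow> real^'n" where
  "grad y = unit y v* (P ** d (- ln (V y)))"

lemma grad_inner: "grad y \<bullet> v = unit y \<bullet> (P *v (d (- ln (V y)) *v v))"
  by (simp add: grad_def dot_lmul_matrix matrix_vector_mul_assoc)

lemma N_unit': "y \<noteq> 0 \<Longrightarrow> N (unit y) = 1"
  by (simp add: unit_def N_unit)

lemma dilation_unit: "y \<noteq> 0 \<Longrightarrow> d (ln (V y)) *v unit y = y"
  by (simp add: unit_def)

lemma continuous_on_unit: "continuous_on (- {0}) unit"
  unfolding unit_def by (intro continuous_intros) auto

lemma continuous_on_grad: "continuous_on (- {0}) grad"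
  unfolding grad_def by (intro continuous_intros continuous_on_unit) auto

text \<open>Half the growth rate of the squared weighted norm along the dilation orbit where it
  crosses the unit sphere: the denominator in the implicit differentiation.\<close>

definition rate :: "real^'n \<Rightarrow> real" where
  "rate y = unit y \<bullet> (P *v (G *v unit y))"

lemma a_le_rate: "y \<noteq> 0 \<Longrightarrow> a \<le> rate y"
  using lower[of "unit y"] N_unit'[of y] N_square[of "unit y"] by (simp add: rate_def)

lemma continuous_on_rate: "continuous_on (- {0}) rate"
  unfolding rate_def by (intro continuous_intros continuous_on_unit)

text \<open>Time and state move together: the first component lowers the level
  \<open>ln (V x)\<close> at speed \<open>h\<close>, the second moves the state. A joint derivative
  lets a single remainder term cover both.\<close>

lemma N_square_dilation_has_derivative2:
  assumes "x \<noteq> 0"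
  shows "((\<lambda>p. (N (d (h * fst p) *v (d (- ln (V x)) *v snd p)))\<^sup>2) has_derivative
    (\<lambda>p. 2 * (h * fst p * rate x + grad x \<bullet> snd p))) (at (0, x))"
proof -
  define s where "s = - ln (V x)"
  define y where "y = unit x"
  have y: "y = d s *v x" by (simp add: y_def s_def unit_def)
  have 1: "((\<lambda>p. d (h * fst p)) has_derivative (\<lambda>p. (h * fst p) *\<^sub>R G)) (at (0, x))"
  proof -
    have "((\<lambda>p::real \<times> (real^'n). h * fst p) has_derivative (\<lambda>p. h * fst p)) (at (0, x))"
      by (auto intro!: derivative_eq_intros)
    from diff_chain_at[OF this, of d "\<lambda>t. t *\<^sub>R G"] dilation_has_vector_derivative[of G 0 UNIV]
    show ?thesis by (simp add: o_def has_vector_derivative_def)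
  qed
  have 2: "((\<lambda>p::real \<times> (real^'n). d s *v snd p) has_derivative (\<lambda>p. d s *v snd p)) (at (0, x))"
    by (intro bounded_linear.has_derivative[OF matrix_vector_mul_bounded_linear] derivative_intros)
  have 3: "((\<lambda>p. d (h * fst p) *v (d s *v snd p)) has_derivative
      (\<lambda>p. d s *v snd p + (h * fst p) *\<^sub>R (G *v y))) (at (0, x))"
    using bounded_bilinear.FDERIV[OF bounded_bilinear_matrix_vector_mult 1 2]
    by (simp add: y scaleR_matrix_vector_assoc)
  have 4: "((\<lambda>p. P *v (d (h * fst p) *v (d s *v snd p))) has_derivative
      (\<lambda>p. P *v (d s *v snd p + (h * fst p) *\<^sub>R (G *v y)))) (at (0, x))"
    by (intro bounded_linear.has_derivative[OF matrix_vector_mul_bounded_linear] 3)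
  have eq: "y \<bullet> (P *v w) + w \<bullet> (P *v y) = 2 * (y \<bullet> (P *v w))" for w
    using symmetric_inner[OF posdefD(1)[OF posdef], of w y] by (simp add: inner_commute)
  have "((\<lambda>p. (N (d (h * fst p) *v (d s *v snd p)))\<^sup>2) has_derivative
     (\<lambda>p. 2 * (y \<bullet> (P *v (d s *v snd p + (h * fst p) *\<^sub>R (G *v y)))))) (at (0, x))"
    using bounded_bilinear.FDERIV[OF bounded_bilinear_inner 3 4]
    by (simp add: N_square y[symmetric] eq)
  then show ?thesis
    by (simp add: rate_def grad_inner s_def y_def algebra_simps matrix_vector_mult_scaleR)
qed

text \<open>On a small ball all values of \<open>f\<close> lie in one half-space of the fixed
  functional \<open>grad x0\<close>, hence so do all Filippov velocities and the increments of
  \<open>x\<close>. Aiming only at the rate \<open>c / 2\<close> leaves room for the two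
  approximation errors.\<close>

lemma local_decay:
  assumes sol: "filippov_solution f \<tau> x" and t0: "0 \<le> t0" "ereal t0 < \<tau>"
    and D: "open D" "0 \<notin> D" "x t0 \<in> D" and "c > 0"
    and bound: "\<And>y. y \<in> D \<Longrightarrow> grad y \<bullet> f y \<le> - c * V y powr \<mu> * rate y"
    and bnd: "r > 0" "\<And>y. y \<in> ball (x t0) r \<Longrightarrow> norm (f y) \<le> M"
  shows "\<exists>\<delta>>0. \<forall>t\<in>{t0..t0 + \<delta>}. ereal t < \<tau> \<longrightarrow>
    V (x t) \<le> V (x t0) * exp (- (c / 2 * V (x t0) powr \<mu> * (t - t0)))"
proof -
  define x0 where "x0 = x t0"
  define k where "k = c * V x0 powr \<mu>"
  have x0: "x0 \<noteq> 0" "x0 \<in> D" using D by (auto simp: x0_def)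
  have Vx0: "V x0 > 0" using x0 by simp
  then have k: "k > 0" using \<open>c > 0\<close> by (simp add: k_def)
  define \<Gamma> where "\<Gamma> = rate x0"
  have \<Gamma>: "\<Gamma> > 0" using a_le_rate[OF x0(1)] a_pos by (simp add: \<Gamma>_def)
  have M: "M \<ge> 0"
    using bnd(2)[of x0] bnd(1) order_trans[OF norm_ge_zero, of "f x0" M] by (simp add: x0_def)
  have lim: "(grad \<longlongrightarrow> grad x0) (nhds x0)" "((\<lambda>y. c * V y powr \<mu> * rate y) \<longlongrightarrow> k * \<Gamma>) (nhds x0)"
  proof -
    have "continuous_on (- {0}) (\<lambda>y. c * V y powr \<mu> * rate y)"
      by (intro continuous_intros continuous_on_rate) auto
    then have "isCont grad x0" "isCont (\<lambda>y. c * V y powr \<mu> * rate y) x0"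
      using continuous_on_grad x0(1) by (auto simp: continuous_on_eq_continuous_at open_Compl)
    then show "(grad \<longlongrightarrow> grad x0) (nhds x0)" "((\<lambda>y. c * V y powr \<mu> * rate y) \<longlongrightarrow> k * \<Gamma>) (nhds x0)"
      using tendsto_at_iff_tendsto_nhds[of grad x0]
        tendsto_at_iff_tendsto_nhds[of "\<lambda>y. c * V y powr \<mu> * rate y" x0]
      by (auto simp: isCont_def k_def \<Gamma>_def)
  qed
  \<comment> \<open>Of the full \<open>k * \<Gamma>\<close>, one eighth is given up for the
    variation of the right-hand side and one eighth for exchanging \<open>grad y\<close> with
    \<open>grad x0\<close>; three quarters remain. \<open>M + 1\<close> avoids a division by
    0.\<close>
  have "eventually (\<lambda>y. y \<in> ball x0 r \<inter> D) (nhds x0)"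
    using bnd(1) D x0(2) by (intro eventually_nhds_in_open) auto
  moreover have "eventually (\<lambda>y. dist (grad y) (grad x0) < k * \<Gamma> / (8 * (M + 1))) (nhds x0)"
    using k \<Gamma> M by (intro tendstoD lim(1)) simp
  moreover have "eventually (\<lambda>y. 7 / 8 * (k * \<Gamma>) < c * V y powr \<mu> * rate y) (nhds x0)"
    using k \<Gamma> by (intro order_tendstoD(1)[OF lim(2)]) simp
  ultimately have "eventually (\<lambda>y. y \<in> ball x0 r \<inter> D \<and> dist (grad y) (grad x0) < k * \<Gamma> / (8 * (M + 1)) \<and>
      7 / 8 * (k * \<Gamma>) < c * V y powr \<mu> * rate y) (nhds x0)"
    by eventually_elim auto
  then obtain \<delta>1 where \<delta>1: "\<delta>1 > 0" and near: "\<And>y. y \<in> ball x0 \<delta>1 \<Longrightarrow> y \<in> ball x0 r \<and> y \<in> D \<and>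
      dist (grad y) (grad x0) < k * \<Gamma> / (8 * (M + 1)) \<and> 7 / 8 * (k * \<Gamma>) < c * V y powr \<mu> * rate y"
    unfolding eventually_nhds_metric by (auto simp: dist_commute)
  have fy: "grad x0 \<bullet> f y \<le> - (3 / 4 * (k * \<Gamma>))" "norm (f y) \<le> M" if "y \<in> ball x0 \<delta>1" for y
  proof -
    note n = near[OF that]
    show fM: "norm (f y) \<le> M" using n bnd(2)[of y] by (simp add: x0_def)
    have "(grad x0 - grad y) \<bullet> f y \<le> norm (grad x0 - grad y) * norm (f y)" by (rule norm_cauchy_schwarz)
    also have "\<dots> \<le> k * \<Gamma> / (8 * (M + 1)) * (M + 1)"
      using n fM M k \<Gamma> by (intro mult_mono) (auto simp: dist_norm norm_minus_commute)
    also have "\<dots> = k * \<Gamma> / 8" using M by (simp add: field_simps)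
    finally have 1: "(grad x0 - grad y) \<bullet> f y \<le> k * \<Gamma> / 8" .
    have "grad y \<bullet> f y \<le> - (7 / 8 * (k * \<Gamma>))"
      using bound[of y] n by linarith
    with 1 show "grad x0 \<bullet> f y \<le> - (3 / 4 * (k * \<Gamma>))"
      by (simp add: inner_diff_left)
  qed
  have F: "grad x0 \<bullet> v \<le> - (3 / 4 * (k * \<Gamma>)) \<and> norm v \<le> M"
    if "y \<in> ball x0 (\<delta>1 / 2)" "v \<in> filippov_map f y" for y v
  proof -
    have "filippov_map f y \<subseteq> {v. grad x0 \<bullet> v \<le> - (3 / 4 * (k * \<Gamma>))} \<inter> cball 0 M"
    \<comment> \<open>Halving the radius keeps a whole ball around each \<open>y\<close> inside the
      region controlled by \<open>fy\<close>.\<close>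
    proof (rule filippov_map_subset[where \<delta> = "\<delta>1 / 2"])
      fix z assume "z \<in> ball y (\<delta>1 / 2)"
      then have "z \<in> ball x0 \<delta>1"
        using that(1) dist_triangle[of x0 z y] by simp
      from fy[OF this] show "f z \<in> {v. grad x0 \<bullet> v \<le> - (3 / 4 * (k * \<Gamma>))} \<inter> cball 0 M" by simp
    qed (use \<delta>1 in \<open>auto intro!: closed_Int convex_Int closed_halfspace_le convex_halfspace_le\<close>)
    with that(2) show ?thesis by auto
  qed
  obtain \<delta>2 where \<delta>2: "\<delta>2 > 0" "\<And>t. t \<in> {t0..t0 + \<delta>2} \<Longrightarrow> ereal t < \<tau> \<Longrightarrow> x t \<in> ball x0 (\<delta>1 / 2)"
  proof -
    obtain T where T: "t0 < T" "ereal T < \<tau>"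
      using ereal_dense2[OF t0(2)] by auto
    have "continuous_on {0..T} x" by (rule filippov_solution_continuous[OF sol T(2)])
    then obtain e where e: "e > 0" "\<forall>t\<in>{0..T}. dist t t0 < e \<longrightarrow> dist (x t) (x t0) < \<delta>1 / 2"
      using t0 T \<delta>1 unfolding continuous_on_iff by (metis atLeastAtMost_iff half_gt_zero less_imp_le)
    show ?thesis
    proof (rule that[of "min (e / 2) (T - t0)"])
      show "min (e / 2) (T - t0) > 0" using e T by simp
      fix t assume "t \<in> {t0..t0 + min (e / 2) (T - t0)}"
      then have "t \<in> {0..T}" "dist t t0 < e" using e(1) t0 by (auto simp: dist_norm)
      then show "x t \<in> ball x0 (\<delta>1 / 2)" using e(2) by (auto simp: x0_def dist_commute)
    qed
  qed
  have incr: "grad x0 \<bullet> (x t - x0) \<le> - (3 / 4 * (k * \<Gamma>)) * (t - t0)" "norm (x t - x0) \<le> M * (t - t0)"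
    if t: "t \<in> {t0..t0 + \<delta>2}" "ereal t < \<tau>" for t
  proof -
    have in_ball: "x r \<in> ball x0 (\<delta>1 / 2)" if "r \<in> {t0..t}" for r
      using that t by (intro \<delta>2(2)) (auto intro: le_less_trans[of "ereal r" "ereal t"])
    show "grad x0 \<bullet> (x t - x0) \<le> - (3 / 4 * (k * \<Gamma>)) * (t - t0)"
      unfolding x0_def using t t0 F[OF in_ball] 
      by (intro filippov_solution_increment_le[OF sol]) (auto simp: x0_def)
    \<comment> \<open>The increment is tested against its own direction, which turns the scalar
      estimate into a Lipschitz bound.\<close>
    have "(x t - x0) \<bullet> (x t - x0) \<le> norm (x t - x0) * M * (t - t0)"
      unfolding x0_def
    proof (rule filippov_solution_increment_le[OF sol])
      fix r v assume "r \<in> {t0..t}" "v \<in> filippov_map f (x r)"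
      then have "norm v \<le> M" using F in_ball by blast
      then show "(x t - x t0) \<bullet> v \<le> norm (x t - x t0) * M"
        by (intro order_trans[OF norm_cauchy_schwarz] mult_left_mono) auto
    qed (use t t0 in auto)
    then have "norm (x t - x0) * norm (x t - x0) \<le> norm (x t - x0) * (M * (t - t0))"
      by (simp add: dot_square_norm power2_eq_square mult.assoc)
    then show "norm (x t - x0) \<le> M * (t - t0)"
      using M t mult_le_cancel_left_pos[of "norm (x t - x0)"] by (cases "x t = x0") auto
  qed
  \<comment> \<open>At \<open>(t - t0, x t)\<close> this value is at most 1 exactly if
    \<open>V (x t) \<le> V x0 * exp (- (k / 2 * (t - t0)))\<close>.\<close>
  define \<Psi> where "\<Psi> p = (N (d (k / 2 * fst p) *v (d (- ln (V x0)) *v snd p)))\<^sup>2" for p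
  define e where "e = k * \<Gamma> / (4 * (M + 1))"
  have "e > 0" using k \<Gamma> M by (simp add: e_def)
  have "(\<Psi> has_derivative (\<lambda>p. 2 * (k / 2 * fst p * \<Gamma> + grad x0 \<bullet> snd p))) (at (0, x0))"
    unfolding \<Psi>_def[abs_def] \<Gamma>_def by (rule N_square_dilation_has_derivative2[OF x0(1)])
  then obtain \<delta>3 where \<delta>3: "\<delta>3 > 0" "\<And>p. norm (p - (0, x0)) < \<delta>3 \<Longrightarrow>
      norm (\<Psi> p - \<Psi> (0, x0) - 2 * (k / 2 * fst (p - (0, x0)) * \<Gamma> + grad x0 \<bullet> snd (p - (0, x0)))) \<le> e * norm (p - (0, x0))"
    using \<open>e > 0\<close> unfolding has_derivative_at_alt by blast
  have \<Psi>0: "\<Psi> (0, x0) = 1" using N_unit[OF x0(1)] by (simp add: \<Psi>_def)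
  define \<delta> where "\<delta> = min \<delta>2 (\<delta>3 / (2 * (M + 1)))"
  have "\<delta> > 0" using \<delta>2 \<delta>3 M by (simp add: \<delta>_def)
  moreover have "V (x t) \<le> V x0 * exp (- (c / 2 * V x0 powr \<mu> * (t - t0)))"
    if t: "t \<in> {t0..t0 + \<delta>}" "ereal t < \<tau>" for t
  proof -
    define \<theta> where "\<theta> = t - t0"
    have t2: "t \<in> {t0..t0 + \<delta>2}" using t by (auto simp: \<delta>_def)
    have \<theta>: "0 \<le> \<theta>" using t by (simp add: \<theta>_def)
    have np: "norm ((\<theta>, x t) - (0, x0)) \<le> (M + 1) * \<theta>"
    proof -
      have "norm ((\<theta>, x t) - (0, x0)) \<le> \<bar>\<theta>\<bar> + norm (x t - x0)"
        using norm_Pair_le[of \<theta> "x t - x0"] by simp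
      also have "\<dots> \<le> \<theta> + M * \<theta>" using \<theta> incr(2)[OF t2 t(2)] by (simp add: \<theta>_def)
      finally show ?thesis by (simp add: algebra_simps)
    qed
    also have "(M + 1) * \<theta> \<le> (M + 1) * (\<delta>3 / (2 * (M + 1)))"
      using t M by (intro mult_left_mono) (auto simp: \<theta>_def \<delta>_def)
    also have "\<dots> = \<delta>3 / 2" using M by (simp add: field_simps)
    also have "\<dots> < \<delta>3" using \<delta>3 by simp
    finally have "\<bar>\<Psi> (\<theta>, x t) - 1 - 2 * (k / 2 * \<theta> * \<Gamma> + grad x0 \<bullet> (x t - x0))\<bar> \<le> e * norm ((\<theta>, x t) - (0, x0))"
      using \<delta>3(2)[of "(\<theta>, x t)"] by (simp add: \<Psi>0)
    also have "\<dots> \<le> e * ((M + 1) * \<theta>)" using np \<open>e > 0\<close> by (intro mult_left_mono) auto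
    also have "\<dots> = k * \<Gamma> * \<theta> / 4" using M by (simp add: e_def field_simps)
    finally have "\<bar>\<Psi> (\<theta>, x t) - 1 - 2 * (k / 2 * \<theta> * \<Gamma> + grad x0 \<bullet> (x t - x0))\<bar> \<le> k * \<Gamma> * \<theta> / 4" .
    moreover have "2 * (k / 2 * \<theta> * \<Gamma> + z) = k * \<Gamma> * \<theta> + 2 * z" for z by simp
    ultimately have "\<Psi> (\<theta>, x t) \<le> 1 + k * \<Gamma> * \<theta> + 2 * (grad x0 \<bullet> (x t - x0)) + k * \<Gamma> * \<theta> / 4"
      unfolding abs_le_iff by simp
    \<comment> \<open>Balance in units of \<open>k * \<Gamma> * \<theta>\<close>: the lowered level
      contributes 1, the motion of the state - 3 / 2 and the linearisation remainder 1 / 4, in total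
      - 1 / 4.\<close>
    also have "\<dots> \<le> 1 + k * \<Gamma> * \<theta> + 2 * (- (3 / 4 * (k * \<Gamma>)) * \<theta>) + k * \<Gamma> * \<theta> / 4"
      using incr(1)[OF t2 t(2)] unfolding \<theta>_def[symmetric] by linarith
    also have "\<dots> = 1 - k * \<Gamma> * \<theta> / 4" by (simp add: algebra_simps)
    also have "\<dots> \<le> 1" using k \<Gamma> \<theta> by simp
    finally have "(N (d (- (ln (V x0) - k / 2 * \<theta>)) *v x t))\<^sup>2 \<le> 1\<^sup>2"
      by (simp add: \<Psi>_def matrix_vector_mul_assoc flip: dilation_add)
    then have "N (d (- (ln (V x0) - k / 2 * \<theta>)) *v x t) \<le> 1"
      by (rule power2_le_imp_le) simp
    then have "V (x t) \<le> exp (ln (V x0) - k / 2 * \<theta>)" by (simp only: V_le_exp_iff)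
    also have "\<dots> = V x0 * exp (- (k / 2 * \<theta>))" using x0 by (simp only: diff_conv_add_uminus exp_add) simp
    finally show ?thesis by (simp add: k_def \<theta>_def)
  qed
  ultimately show ?thesis unfolding x0_def by blast
qed

end

section \<open>Stability of dissipative vector fields\<close>

lemma classK_mono: "\<alpha> \<in> classK \<Longrightarrow> 0 \<le> r \<Longrightarrow> r \<le> s \<Longrightarrow> \<alpha> r \<le> \<alpha> s"
  unfolding classK_def strict_mono_on_def by (cases "r = s") (auto intro: less_imp_le)

lemma classK_nonneg: "\<alpha> \<in> classK \<Longrightarrow> 0 \<le> r \<Longrightarrow> 0 \<le> \<alpha> r"
  using classK_mono[of \<alpha> 0 r] by (simp add: classK_def)

lemma classK_compose:
  assumes "\<alpha> \<in> classK" "\<beta> \<in> classK"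
  shows "(\<lambda>r. \<alpha> (\<beta> r)) \<in> classK"
proof -
  have "continuous_on {0..} (\<lambda>r. \<alpha> (\<beta> r))"
    by (rule continuous_on_compose2[of "{0..}" \<alpha>])
      (use assms classK_nonneg[OF assms(2)] in \<open>auto simp: classK_def\<close>)
  moreover have "strict_mono_on {0..} (\<lambda>r. \<alpha> (\<beta> r))"
    using assms classK_nonneg[OF assms(2)] by (auto simp: classK_def strict_mono_on_def)
  ultimately show ?thesis using assms by (simp add: classK_def)
qed

lemma classK_powr_sum:
  assumes "0 < p" "0 < q"
  shows "(\<lambda>r. r powr p + r powr q) \<in> classK"
proof -
  have "continuous_on {0..} (\<lambda>r. r powr p + r powr q)"
    using assms by (intro continuous_intros continuous_on_powr') auto
  moreover have "strict_mono_on {0..} (\<lambda>r. r powr p + r powr q)"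
    using assms by (auto simp: strict_mono_on_def intro!: add_strict_mono powr_less_mono2)
  ultimately show ?thesis by (simp add: classK_def)
qed

context homogeneous_norm
begin

definition N_gain :: "real \<Rightarrow> real" where "N_gain v = v powr a + v powr b"
definition V_gain :: "real \<Rightarrow> real" where "V_gain r = r powr (1 / a) + r powr (1 / b)"

lemma N_gain: "N_gain \<in> classK" "N x \<le> N_gain (V x)"
  using classK_powr_sum[OF a_pos b_pos] N_le_V_sum[of x] by (auto simp: N_gain_def[abs_def])

lemma V_gain: "V_gain \<in> classK" "V x \<le> V_gain (N x)"
  using classK_powr_sum[of "1 / a" "1 / b"] a_pos b_pos V_le_N_sum[of x] by (auto simp: V_gain_def[abs_def])

lemma gain_classK: "(\<lambda>r. N_gain (V_gain r)) \<in> classK"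
  by (rule classK_compose[OF N_gain(1) V_gain(1)])

text \<open>The window \<open>L < V < H\<close> treats all claims uniformly: \<open>L = 0\<close>
  with \<open>H = \<infinity>\<close> is the global case, finite \<open>H\<close> the local one,
  positive \<open>L\<close> the practical one. Since \<open>L \<ge> 0\<close>, the origin is always
  excluded, and \<open>grad\<close> and \<open>rate\<close> are continuous on the window.\<close>

definition dissipative :: "(real^'n \<Rightarrow> real^'n) \<Rightarrow> real \<Rightarrow> real \<Rightarrow> real \<Rightarrow> ereal \<Rightarrow> bool" where
  "dissipative f \<mu> c L H \<longleftrightarrow> 0 < c \<and> 0 \<le> L \<and> ereal L < H \<and>
    (\<forall>y. L < V y \<and> ereal (V y) < H \<longrightarrow> grad y \<bullet> f y \<le> - c * V y powr \<mu> * rate y \<and>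
      (\<exists>r>0. \<exists>M. \<forall>z\<in>ball y r. norm (f z) \<le> M))"

lemma open_V_between: "open {y. L < V y \<and> ereal (V y) < H}"
proof -
  have op: "open {y. V y < h}" "open {y. L < V y}" for h
    by (intro open_Collect_less continuous_intros)+
  show ?thesis
    by (cases H) (auto intro!: open_Collect_conj op)
qed

lemma dissipative_decay:
  assumes dis: "dissipative f \<mu> c L H" and sol: "filippov_solution f \<tau> x"
    and T: "0 \<le> T" "ereal T < \<tau>" and "ereal (V (x 0)) < H"
  shows "decay (\<lambda>t. V (x t)) (c / 2) \<mu> L T H"
proof
  note d = dis[unfolded dissipative_def]
  show "continuous_on {0..T} (\<lambda>t. V (x t))"
    by (intro continuous_intros filippov_solution_continuous[OF sol T(2)])
  show "c / 2 > 0" "L \<ge> 0" "ereal L < H" "ereal (V (x 0)) < H" using d assms by auto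
  fix r assume r: "r \<in> {0..<T}" "L < V (x r)" "ereal (V (x r)) < H"
  obtain e M where eM: "e > 0" "\<And>z. z \<in> ball (x r) e \<Longrightarrow> norm (f z) \<le> M" using d r by blast
  have rt: "ereal r < \<tau>" using r(1) T(2) by (auto intro: less_trans[of "ereal r" "ereal T"])
  define D where "D = {y. L < V y \<and> ereal (V y) < H}"
  have "\<exists>\<delta>>0. \<forall>t\<in>{r..r + \<delta>}. ereal t < \<tau> \<longrightarrow>
    V (x t) \<le> V (x r) * exp (- (c / 2 * V (x r) powr \<mu> * (t - r)))"
  proof (rule local_decay[OF sol _ rt, where D = D])
    show "open D" unfolding D_def by (rule open_V_between)
    show "0 \<notin> D" "x r \<in> D" "0 \<le> r" "c > 0" using d r by (auto simp: D_def)
    show "e > 0" "\<And>z. z \<in> ball (x r) e \<Longrightarrow> norm (f z) \<le> M" by (fact eM)+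
    show "grad y \<bullet> f y \<le> - c * V y powr \<mu> * rate y" if "y \<in> D" for y
      using d that by (auto simp: D_def)
  qed
  moreover have "ereal t < \<tau>" if "t \<le> T" for t
    using that T(2) by (auto intro: le_less_trans[of "ereal t" "ereal T"])
  ultimately show "\<exists>\<delta>>0. \<forall>t\<in>{r..r + \<delta>} \<inter> {..T}.
      V (x t) \<le> V (x r) * exp (- (c / 2 * V (x r) powr \<mu> * (t - r)))"
    by (metis IntE atMost_iff)
qed

lemma dissipative_Lyapunov_bound:
  assumes dis: "dissipative f \<mu> c L H" and sol: "filippov_solution f \<tau> x"
    and t: "0 \<le> t" "ereal t < \<tau>" and H: "ereal (V (x 0)) < H"
  shows "V (x t) \<le> max L (V (x 0))"
  using decay.le_max[OF dissipative_decay[OF assms], of 0 t] t H by simp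

lemma dissipative_Lyapunov_stable:
  assumes dis: "dissipative f \<mu> c 0 H"
  shows "Lyapunov_stable_on N f {x. ereal (V x) < H}"
  unfolding Lyapunov_stable_on_def
proof (intro bexI[OF _ gain_classK] ballI allI impI)
  fix x0 \<tau> x t
  assume "x0 \<in> {x. ereal (V x) < H}" and sol: "filippov_solution f \<tau> x \<and> x 0 = x0"
    and t: "0 \<le> t" "ereal t < \<tau>"
  then have "V (x t) \<le> V x0"
    using dissipative_Lyapunov_bound[OF dis, of \<tau> x t] V_nonneg[of x0] by (auto simp: max_def split: if_splits)
  also have "\<dots> \<le> V_gain (N x0)" by (rule V_gain(2))
  finally have "N_gain (V (x t)) \<le> N_gain (V_gain (N x0))"
    by (intro classK_mono[OF N_gain(1)] V_nonneg)
  with N_gain(2)[of "x t"] show "N (x t) \<le> N_gain (V_gain (N x0))" by simp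
qed

lemma dissipative_finite_time_stable:
  assumes dis: "dissipative f \<mu> c 0 H" and "\<mu> < 0"
  shows "finite_time_stable_on N f {x. ereal (V x) < H}"
proof -
  have c: "c > 0" using dis by (simp add: dissipative_def)
  \<comment> \<open>The bound \<open>decay.finite_time_bound\<close> with \<open>k = c / 2\<close>,
    solved for time; the added 1 makes the contradiction strict.\<close>
  define T where "T x = V x powr (- \<mu>) / (c / 2 * (- \<mu>) / 2) + 1" for x
  have cm: "c / 2 * (- \<mu>) / 2 > 0" using c \<open>\<mu> < 0\<close> by (simp add: mult_pos_neg)
  then have "V x powr (- \<mu>) / (c / 2 * (- \<mu>) / 2) \<ge> 0" for x by (intro divide_nonneg_pos) auto
  then have T_ge: "T x \<ge> 1" for x by (simp add: T_def)
  have "\<exists>\<delta>>0. bounded (T ` ball x \<delta>)" for x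
  proof -
    have "continuous_on (cball x 1) T"
      unfolding T_def using \<open>\<mu> < 0\<close> c V_nonneg by (intro continuous_intros continuous_on_powr') auto
    then have "bounded (T ` cball x 1)"
      by (intro compact_imp_bounded compact_continuous_image compact_cball)
    then have "bounded (T ` ball x 1)"
      by (rule bounded_subset) auto
    then show ?thesis by (intro exI[of _ 1]) simp
  qed
  moreover have "N (x t) = 0" if "ereal (V (x 0)) < H" and sol: "filippov_solution f \<tau> x"
    and t: "T (x 0) \<le> t" "ereal t < \<tau>" for \<tau> x t
  proof (rule ccontr)
    assume "N (x t) \<noteq> 0"
    then have pos: "0 < V (x t)" by simp
    have t0: "0 \<le> t" using t T_ge[of "x 0"] by simp
    have "c / 2 * (- \<mu>) / 2 * t \<le> V (x 0) powr (- \<mu>)"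
      using decay.finite_time_bound[OF dissipative_decay[OF dis sol t0 t(2) that(1)] \<open>\<mu> < 0\<close> t0 pos] .
    then have "t \<le> V (x 0) powr (- \<mu>) / (c / 2 * (- \<mu>) / 2)"
      using cm by (simp only: pos_le_divide_eq mult.commute)
    with t(1) show False by (simp add: T_def)
  qed
  moreover have "T x \<ge> 0" for x using T_ge[of x] by simp
  ultimately show ?thesis
    unfolding finite_time_stable_on_def
    by (intro conjI dissipative_Lyapunov_stable[OF dis] exI[of _ T]) auto
qed

text \<open>If \<open>V\<close> were still above \<open>v\<close>, then
  \<open>V powr (- \<mu>)\<close> would be at most \<open>v powr (- \<mu>)\<close>, while it has
  grown linearly in time from a nonnegative value. Hence the waiting time depends on
  \<open>v\<close> only.\<close>

lemma dissipative_fixed_time_bound: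
  assumes dis: "dissipative f \<mu> c L \<infinity>" and "\<mu> > 0" "v > 0" "L \<le> v"
    and sol: "filippov_solution f \<tau> x" and t: "v powr (- \<mu>) / (c / 2 * \<mu>) + 1 \<le> t" "ereal t < \<tau>"
  shows "V (x t) \<le> v"
proof (rule ccontr)
  assume "\<not> V (x t) \<le> v"
  then have Vt: "v < V (x t)" "L < V (x t)" using assms by auto
  have c: "c / 2 * \<mu> > 0" using dis \<open>\<mu> > 0\<close> by (simp add: dissipative_def)
  have "0 \<le> v powr (- \<mu>) / (c / 2 * \<mu>)" using c by (intro divide_nonneg_pos) auto
  then have t0: "0 \<le> t" using t(1) by linarith
  have "c / 2 * \<mu> * t \<le> V (x t) powr (- \<mu>)"
    using decay.fixed_time_bound[OF dissipative_decay[OF dis sol t0 t(2)] \<open>\<mu> > 0\<close> t0 Vt(2)] by simp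
  also have "\<dots> \<le> v powr (- \<mu>)" using Vt assms by (intro powr_mono2') auto
  finally have "t \<le> v powr (- \<mu>) / (c / 2 * \<mu>)"
    using c by (simp only: pos_le_divide_eq mult.commute)
  with t show False by simp
qed

lemma dissipative_nearly_fixed_time_stable:
  assumes dis: "dissipative f \<mu> c 0 \<infinity>" and "\<mu> > 0"
  shows "nearly_fixed_time_stable N f"
  unfolding nearly_fixed_time_stable_def
proof (intro conjI allI impI)
  show "Lyapunov_stable_on N f UNIV"
    using dissipative_Lyapunov_stable[OF dis] by simp
  fix r :: real assume "r > 0"
  have c: "c / 2 * \<mu> > 0" using dis \<open>\<mu> > 0\<close> by (simp add: dissipative_def)
  \<comment> \<open>With \<open>v \<le> 1\<close> the power with exponent \<open>b\<close> is the
    smaller one, so both powers are at most \<open>r / 3\<close> and \<open>N_gain v\<close> stays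
    below \<open>r\<close>.\<close>
  define v where "v = min 1 ((r / 3) powr (1 / a))"
  have v: "v > 0" "v \<le> 1" "v powr a \<le> r / 3"
  proof -
    show "v > 0" "v \<le> 1" using \<open>r > 0\<close> by (auto simp: v_def)
    have "v powr a \<le> ((r / 3) powr (1 / a)) powr a"
      using \<open>v > 0\<close> a_pos by (intro powr_mono2) (auto simp: v_def)
    then show "v powr a \<le> r / 3" using a_pos \<open>r > 0\<close> by (simp add: powr_powr)
  qed
  have "v powr b \<le> v powr a"
    using v a_le_b by (intro powr_mono') auto
  then have Nv: "N_gain v < r" using v \<open>r > 0\<close> by (simp add: N_gain_def)
  have "0 \<le> v powr (- \<mu>) / (c / 2 * \<mu>)" using c by (intro divide_nonneg_pos) auto
  moreover have "N (x t) < r" if "filippov_solution f \<tau> x" "v powr (- \<mu>) / (c / 2 * \<mu>) + 1 \<le> t" "ereal t < \<tau>" for \<tau> x t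
  proof -
    have "V (x t) \<le> v" using dissipative_fixed_time_bound[OF dis \<open>\<mu> > 0\<close> v(1) _ that] v by simp
    then have "N_gain (V (x t)) \<le> N_gain v" by (intro classK_mono[OF N_gain(1)] V_nonneg)
    with N_gain(2)[of "x t"] Nv show ?thesis by simp
  qed
  ultimately show "\<exists>Tr>0. \<forall>\<tau> x. filippov_solution f \<tau> x \<longrightarrow> (\<forall>t\<ge>Tr. ereal t < \<tau> \<longrightarrow> N (x t) < r)"
    by (intro exI[of _ "v powr (- \<mu>) / (c / 2 * \<mu>) + 1"]) auto
qed

lemma dissipative_practically_fixed_time_stable:
  assumes dis: "dissipative f \<mu> c L \<infinity>" and "\<mu> > 0" "L > 0"
  shows "practically_fixed_time_stable N f"
  unfolding practically_fixed_time_stable_def practically_Lyapunov_stable_with_def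
proof (intro exI conjI bexI[OF _ gain_classK] allI impI)
  show "N_gain L \<ge> 0" using classK_nonneg[OF N_gain(1)] \<open>L > 0\<close> by simp
  have c: "c / 2 * \<mu> > 0" using dis \<open>\<mu> > 0\<close> by (simp add: dissipative_def)
  have "0 \<le> L powr (- \<mu>) / (c / 2 * \<mu>)" using c by (intro divide_nonneg_pos) auto
  then show "L powr (- \<mu>) / (c / 2 * \<mu>) + 1 > 0" by linarith
  fix \<tau> x t assume sol: "filippov_solution f \<tau> x" and "L powr (- \<mu>) / (c / 2 * \<mu>) + 1 \<le> t" "ereal t < \<tau>"
  then have "V (x t) \<le> L"
    using dissipative_fixed_time_bound[OF dis \<open>\<mu> > 0\<close> \<open>L > 0\<close>] by simp
  then have "N_gain (V (x t)) \<le> N_gain L" by (intro classK_mono[OF N_gain(1)] V_nonneg)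
  with N_gain(2)[of "x t"] show "N (x t) \<le> N_gain L" by simp
next
  fix x0 \<tau> x t assume sol: "filippov_solution f \<tau> x \<and> x 0 = x0" and t: "0 \<le> t" "ereal t < \<tau>"
  have "V (x t) \<le> max L (V x0)"
    using dissipative_Lyapunov_bound[OF dis, of \<tau> x t] sol t by auto
  then have "N_gain (V (x t)) \<le> N_gain (max L (V x0))"
    by (intro classK_mono[OF N_gain(1)] V_nonneg)
  \<comment> \<open>A maximum of nonnegative terms is at most their sum; this separates the fixed
    radius from the part that depends on the initial state.\<close>
  also have "\<dots> \<le> N_gain L + N_gain (V x0)"
    using classK_nonneg[OF N_gain(1), of L] classK_nonneg[OF N_gain(1), of "V x0"] \<open>L > 0\<close> V_nonneg[of x0]
    by (simp add: max_def)
  also have "N_gain (V x0) \<le> N_gain (V_gain (N x0))"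
    by (intro classK_mono[OF N_gain(1)] V_nonneg V_gain(2))
  finally show "N (x t) \<le> N_gain L + N_gain (V_gain (N x0))"
    using N_gain(2)[of "x t"] by simp
qed

end

section \<open>The quantized closed loop\<close>

text \<open>\<open>A0\<close> is homogeneous of degree \<mu> and inputs carry weight 1. On the unit
  sphere the nominal feedback is the linear map \<open>K\<close>, so \<open>lyapunov\<close> is the
  exact decay identity there, and dilations spread it to all states.\<close>

locale closed_loop = homogeneous_norm P G a b
  for P G :: "real^'n^'n" and a b :: real +
  fixes A0 :: "real^'n^'n" and B :: "real^'m^'n" and K0 K :: "real^'n^'m" and \<mu> \<rho> :: real
  assumes hom_A0: "A0 ** G = G ** A0 + \<mu> *\<^sub>R A0"
    and hom_B: "G ** B = B"
    and \<rho>_pos: "0 < \<rho>"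
    and lyapunov: "\<And>y. y \<bullet> (P *v (A0 *v y + B *v (K *v y))) = - \<rho> * (y \<bullet> (P *v (G *v y)))"
begin

definition \<Phi> :: "real^'n \<Rightarrow> real^'m" where
  "\<Phi> z = V z powr (1 + \<mu>) *\<^sub>R (K *v unit z)"

text \<open>Splitting \<open>K0 *v q x\<close> into \<open>K0 *v x\<close> and the measurement error
  moves the nominal part into the homogeneous matrix \<open>A0\<close>.\<close>

definition vfield :: "(real^'n \<Rightarrow> real^'n) \<Rightarrow> real^'n \<Rightarrow> real^'n" where
  "vfield q x = A0 *v x + B *v (K0 *v (q x - x)) + B *v \<Phi> (q x)"

lemma unit_0 [simp]: "unit 0 = 0"
  by (simp add: unit_def)

lemma feedback_eq: "feedback K0 K P G \<mu> z = K0 *v z + \<Phi> z"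
  by (simp add: feedback_def \<Phi>_def unit_def)

lemma unit_dilation: "unit (d s *v z) = unit z"
proof (cases "z = 0")
  case False
  then show ?thesis
    by (simp add: unit_def V_dilation ln_mult matrix_vector_mul_assoc flip: dilation_add)
qed simp

lemma \<Phi>_dilation: "\<Phi> (d s *v z) = exp ((1 + \<mu>) * s) *\<^sub>R \<Phi> z"
  by (simp add: \<Phi>_def unit_dilation V_dilation powr_mult V_nonneg exp_powr_real mult.commute)

text \<open>Rescaling by \<open>d (- ln (V x))\<close> multiplies the \<open>A0\<close> term by
  \<open>V x powr \<mu>\<close> and every \<open>B\<close> term by \<open>1 / V x\<close>. The
  factor \<open>V x powr (1 + \<mu>)\<close> released by \<open>\<Phi> (q x)\<close> restores the
  common power, while the \<open>K0\<close> error keeps its bare \<open>1 / V x\<close>.\<close>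

lemma grad_vfield:
  assumes "x \<noteq> 0"
  shows "grad x \<bullet> vfield q x =
    V x powr \<mu> * (- \<rho> * rate x + unit x \<bullet> (P *v (B *v (\<Phi> (d (- ln (V x)) *v q x) - K *v unit x))))
    + (unit x \<bullet> (P *v (B *v (K0 *v (q x - x))))) / V x"
proof -
  define s where "s = ln (V x)"
  define y where "y = unit x"
  define z where "z = d (- s) *v q x"
  have V: "V x = exp s" using assms by (simp add: s_def)
  have x: "x = d s *v y" using dilation_unit[OF assms] by (simp add: y_def s_def)
  have q: "q x = d s *v z" by (simp add: z_def)
  have 1: "d (- s) *v (A0 *v x) = exp (\<mu> * s) *\<^sub>R (A0 *v y)"
  proof -
    have "A0 *v x = exp (\<mu> * s) *\<^sub>R (d s *v (A0 *v y))"
      unfolding x by (simp add: matrix_vector_mul_assoc dilation_intertwine[OF hom_A0] scaleR_matrix_vector_assoc)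
    then show ?thesis by (simp add: matrix_vector_mult_scaleR)
  qed
  have 2: "d (- s) *v (B *v w) = exp (- s) *\<^sub>R (B *v w)" for w
    by (simp add: matrix_vector_mul_assoc dilation_mult_eq_exp[OF hom_B] scaleR_matrix_vector_assoc)
  have 3: "\<Phi> (q x) = exp ((1 + \<mu>) * s) *\<^sub>R \<Phi> z"
    unfolding q by (rule \<Phi>_dilation)
  have "d (- s) *v vfield q x = exp (\<mu> * s) *\<^sub>R (A0 *v y) + exp (- s) *\<^sub>R (B *v (K0 *v (q x - x)))
      + (exp ((1 + \<mu>) * s) * exp (- s)) *\<^sub>R (B *v \<Phi> z)"
    unfolding vfield_def by (simp only: matrix_vector_right_distrib 1 2 3 matrix_vector_mult_scaleR scaleR_scaleR)
  also have "exp ((1 + \<mu>) * s) * exp (- s) = exp (\<mu> * s)"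
    by (simp add: algebra_simps flip: exp_add)
  also have "exp (\<mu> * s) *\<^sub>R (A0 *v y) + exp (- s) *\<^sub>R (B *v (K0 *v (q x - x))) + exp (\<mu> * s) *\<^sub>R (B *v \<Phi> z)
      = exp (\<mu> * s) *\<^sub>R ((A0 *v y + B *v (K *v y)) + B *v (\<Phi> z - K *v y)) + exp (- s) *\<^sub>R (B *v (K0 *v (q x - x)))"
    by (simp add: algebra_simps)
  finally have "grad x \<bullet> vfield q x = exp (\<mu> * s) * (y \<bullet> (P *v (A0 *v y + B *v (K *v y))) + y \<bullet> (P *v (B *v (\<Phi> z - K *v y))))
      + exp (- s) * (y \<bullet> (P *v (B *v (K0 *v (q x - x)))))"
    unfolding grad_inner s_def[symmetric] y_def[symmetric]
    by (simp only: matrix_vector_right_distrib[of P] matrix_vector_mult_scaleR inner_add_right inner_scaleR_right)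
  then show ?thesis
    unfolding lyapunov z_def s_def[symmetric] y_def[symmetric]
    by (simp add: V exp_powr_real rate_def y_def exp_minus divide_inverse mult.commute)
qed

section \<open>Effect of the measurement error near the unit sphere\<close>

lemma continuous_on_\<Phi>: "continuous_on (- {0}) \<Phi>"
  unfolding \<Phi>_def by (intro continuous_intros continuous_on_unit) auto

lemma \<Phi>_unit: "N y = 1 \<Longrightarrow> \<Phi> y = K *v y"
  using V_eqI[of 0 y] by (simp add: \<Phi>_def unit_def)

text \<open>The shell \<open>1 / 2 \<le> N z \<le> 2\<close> is compact and avoids the origin, so
  \<Phi> is uniformly continuous on it; on the unit sphere \<Phi> equals \<open>K\<close>. No
  quantizer enters the choice of \<open>e\<close>.\<close>

lemma \<Phi>_near_unit:
  assumes "\<delta> > 0"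
  obtains e where "0 < e" "e \<le> 1" "\<And>y z. N y = 1 \<Longrightarrow> V (z - y) \<le> e \<Longrightarrow> norm (\<Phi> z - K *v y) \<le> \<delta>"
proof -
  obtain C where C: "C > 0" "\<And>x. norm x \<le> C * N x" using norm_le_N by blast
  define S where "S = {z. 1 / 2 \<le> N z} \<inter> {z. N z \<le> 2}"
  have "closed S"
    unfolding S_def by (intro closed_Int closed_Collect_le continuous_intros)
  moreover have "bounded S"
  proof (rule boundedI[of S "C * 2"])
    fix z assume "z \<in> S"
    then show "norm z \<le> C * 2"
      using C(2)[of z] C(1) by (intro order_trans[OF C(2)] mult_left_mono) (auto simp: S_def)
  qed
  ultimately have "compact S" by (simp add: compact_eq_bounded_closed)
  moreover have "continuous_on S \<Phi>"
    by (rule continuous_on_subset[OF continuous_on_\<Phi>]) (auto simp: S_def wnorm_def)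
  ultimately have "uniformly_continuous_on S \<Phi>" by (intro compact_uniformly_continuous)
  then obtain d1 where d1: "d1 > 0" "\<And>y z. y \<in> S \<Longrightarrow> z \<in> S \<Longrightarrow> dist z y < d1 \<Longrightarrow> dist (\<Phi> z) (\<Phi> y) < \<delta>"
    using assms unfolding uniformly_continuous_on_def by metis
  \<comment> \<open>The bound 1 / 2 keeps \<open>z\<close> in the shell, the other keeps it within
    \<open>d1\<close> of \<open>y\<close>. The root \<open>1 / a\<close> taken for \<open>e\<close>
    inverts the estimate of \<open>N\<close> by \<open>V powr a\<close>.\<close>
  define m where "m = min (1 / 2) (d1 / (2 * C))"
  have m: "m > 0" "m \<le> 1 / 2" "C * m \<le> d1 / 2"
    using d1(1) C(1) by (auto simp: m_def min_def field_simps)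
  define e where "e = m powr (1 / a)"
  have e: "0 < e" "e \<le> 1" "e powr a = m"
    using m a_pos by (auto simp: e_def powr_powr powr_le1)
  show ?thesis
  proof (rule that[OF e(1,2)])
    fix y z assume y: "N y = 1" and zy: "V (z - y) \<le> e"
    have "N (z - y) \<le> V (z - y) powr a" using zy e by (intro N_le_V(1)) simp
    also have "\<dots> \<le> e powr a" using zy a_pos V_nonneg by (intro powr_mono2) auto
    finally have Nm: "N (z - y) \<le> m" by (simp add: e)
    have "N z \<le> N y + N (z - y)" using N_triangle[of y "z - y"] by simp
    moreover have "N y \<le> N z + N (z - y)" using N_triangle[of z "y - z"] N_minus[of "z - y"] by simp
    ultimately have "z \<in> S" "y \<in> S" using y Nm m by (auto simp: S_def)
    moreover have "dist z y < d1"
    proof -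
      have "dist z y \<le> C * N (z - y)" using C(2) by (simp add: dist_norm)
      also have "\<dots> \<le> C * m" using C(1) Nm by (intro mult_left_mono) auto
      finally show ?thesis using m d1(1) by simp
    qed
    ultimately have "dist (\<Phi> z) (\<Phi> y) < \<delta>" using d1(2) by blast
    then show "norm (\<Phi> z - K *v y) \<le> \<delta>" using \<Phi>_unit[OF y] by (simp add: dist_norm)
  qed
qed

text \<open>By homogeneity of \<open>V\<close>, a relative error at \<open>x\<close> becomes an
  absolute error of the same size at the unit sphere.\<close>

lemma V_rescaled_error:
  assumes "x \<noteq> 0" "V (q x - x) \<le> e * V x"
  shows "V (d (- ln (V x)) *v q x - unit x) \<le> e"
proof -
  have "d (- ln (V x)) *v q x - unit x = d (- ln (V x)) *v (q x - x)"
    by (simp add: unit_def algebra_simps)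
  then have "V (d (- ln (V x)) *v q x - unit x) = V (q x - x) / V x"
    using assms(1) by (simp add: V_dilation exp_minus divide_inverse_commute)
  also have "\<dots> \<le> e" using assms by (simp add: divide_le_eq)
  finally show ?thesis .
qed

lemma bound_by_N:
  fixes M :: "real^'n^'k"
  obtains C where "C > 0" "\<And>x. norm (M *v x) \<le> C * N x"
proof -
  obtain C where C: "C > 0" "\<And>x. norm x \<le> C * N x" using norm_le_N by blast
  obtain k where k: "k > 0" "\<And>x. norm (M *v x) \<le> norm x * k"
    using bounded_linear.pos_bounded[OF matrix_vector_mul_bounded_linear[of M]] by blast
  have "norm (M *v x) \<le> (C * k) * N x" for x
    using order_trans[OF k(2) mult_right_mono[OF C(2), of k x]] k(1) by (simp add: mult_ac)
  then show ?thesis using that[of "C * k"] C(1) k(1) by simp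
qed

text \<open>The field itself may jump, but off the origin it is dominated by the continuous function
  \<beta>. The \<open>K0\<close> error is bounded through \<open>V (q w - w) \<le> V w\<close>, with
  no recourse to \<kappa>.\<close>

lemma vfield_locally_bounded:
  assumes near: "\<And>y z. N y = 1 \<Longrightarrow> V (z - y) \<le> e \<Longrightarrow> norm (\<Phi> z - K *v y) \<le> \<delta>"
    and e: "e \<le> 1" "\<And>x. V (q x - x) \<le> e * V x" and "x \<noteq> 0"
  shows "\<exists>r>0. \<exists>M. \<forall>z\<in>ball x r. norm (vfield q z) \<le> M"
proof -
  obtain k1 where k1: "k1 > 0" "\<And>x. norm ((B ** K0) *v x) \<le> k1 * N x"
    using bound_by_N[of "B ** K0"] by blast
  obtain k2 where k2: "k2 > 0" "\<And>w. norm (B *v w) \<le> norm w * k2"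
    using bounded_linear.pos_bounded[OF matrix_vector_mul_bounded_linear[of B]] by blast
  define \<beta> where "\<beta> w = norm (A0 *v w) + k1 * (V w powr a + V w powr b)
      + V w powr (1 + \<mu>) * (\<delta> + norm (K *v unit w)) * k2" for w
  have le: "norm (vfield q w) \<le> \<beta> w" if "w \<noteq> 0" for w
  proof -
    define z where "z = d (- ln (V w)) *v q w"
    have "V (q w - w) \<le> V w"
      using e(1) order_trans[OF e(2)[of w] mult_right_mono[OF e(1) V_nonneg]] by simp
    then have "N_gain (V (q w - w)) \<le> N_gain (V w)"
      by (intro classK_mono[OF N_gain(1)] V_nonneg)
    then have "N (q w - w) \<le> V w powr a + V w powr b"
      using N_gain(2)[of "q w - w"] by (simp add: N_gain_def)
    then have 1: "norm (B *v (K0 *v (q w - w))) \<le> k1 * (V w powr a + V w powr b)"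
      using order_trans[OF k1(2)[of "q w - w"] mult_left_mono[of _ _ k1]] k1(1)
      by (simp add: matrix_vector_mul_assoc)
    have "norm (\<Phi> z - K *v unit w) \<le> \<delta>"
      unfolding z_def by (rule near[OF N_unit'[OF that] V_rescaled_error[of w q e, OF that e(2)]])
    then have 2: "norm (\<Phi> z) \<le> \<delta> + norm (K *v unit w)"
      using norm_triangle_sub[of "\<Phi> z" "K *v unit w"] by linarith
    have "q w = d (ln (V w)) *v z" by (simp add: z_def)
    then have "\<Phi> (q w) = V w powr (1 + \<mu>) *\<^sub>R \<Phi> z"
      using that by (simp add: \<Phi>_dilation powr_def)
    then have "norm (\<Phi> (q w)) \<le> V w powr (1 + \<mu>) * (\<delta> + norm (K *v unit w))"
      using 2 by (simp add: mult_left_mono)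
    then have 3: "norm (B *v \<Phi> (q w)) \<le> V w powr (1 + \<mu>) * (\<delta> + norm (K *v unit w)) * k2"
      using order_trans[OF k2(2) mult_right_mono] k2(1) by simp
    show ?thesis
      unfolding vfield_def \<beta>_def using 1 3 by (intro norm_triangle_mono) auto
  qed
  have "continuous_on (- {0}) \<beta>"
    unfolding \<beta>_def by (intro continuous_intros continuous_on_unit) auto
  then have "isCont \<beta> x" using \<open>x \<noteq> 0\<close> by (simp add: continuous_on_eq_continuous_at open_Compl)
  then have "(\<beta> \<longlongrightarrow> \<beta> x) (nhds x)"
    by (simp add: isCont_def tendsto_at_iff_tendsto_nhds)
  then have "eventually (\<lambda>w. \<beta> w < \<beta> x + 1) (nhds x)" by (rule order_tendstoD) simp
  moreover have "eventually (\<lambda>w. w \<in> - {0}) (nhds x)"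
    using \<open>x \<noteq> 0\<close> by (intro eventually_nhds_in_open) auto
  ultimately have "eventually (\<lambda>w. norm (vfield q w) \<le> \<beta> x + 1) (nhds x)"
    by eventually_elim (use le in force)
  then obtain r where "r > 0" "\<forall>w. dist w x < r \<longrightarrow> norm (vfield q w) \<le> \<beta> x + 1"
    unfolding eventually_nhds_metric by blast
  then show ?thesis
    by (intro exI[of _ r] conjI exI[of _ "\<beta> x + 1"]) (auto simp: dist_commute)
qed

text \<open>Each of the two error terms costs at most
  \<open>\<rho> * a / 4 * V x powr \<mu>\<close>, that is a quarter of the nominal decay because
  \<open>a \<le> rate x\<close>; half of the decay survives. Both \<open>e\<close> and \<eta> are
  chosen before the quantizer.\<close>

lemma vfield_dissipative:
  obtains e \<eta> where "0 < e" "0 < \<eta>"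
    "\<And>q L H. (\<And>x. V (q x - x) \<le> e * V x) \<Longrightarrow> 0 \<le> L \<Longrightarrow> ereal L < H \<Longrightarrow>
      (\<And>x. L < V x \<Longrightarrow> ereal (V x) < H \<Longrightarrow> norm (K0 *v (q x - x)) \<le> \<eta> * V x powr (1 + \<mu>)) \<Longrightarrow>
      dissipative (vfield q) \<mu> (\<rho> / 2) L H"
proof -
  obtain C where C: "C > 0" "\<And>x. norm x \<le> C * N x" using norm_le_N by blast
  obtain k where k: "k > 0" "\<And>w. norm ((P ** B) *v w) \<le> norm w * k"
    using bounded_linear.pos_bounded[OF matrix_vector_mul_bounded_linear[of "P ** B"]] by blast
  define C1 where "C1 = C * k"
  have C1: "C1 > 0" using C k by (simp add: C1_def)
  have le: "y \<bullet> (P *v (B *v w)) \<le> C1 * norm w" if "N y = 1" for y w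
  proof -
    have "y \<bullet> (P *v (B *v w)) \<le> norm y * norm ((P ** B) *v w)"
      by (simp add: matrix_vector_mul_assoc norm_cauchy_schwarz)
    also have "\<dots> \<le> C * (norm w * k)"
      using C(2)[of y] that k(2) C(1) by (intro mult_mono) auto
    finally show ?thesis by (simp add: C1_def mult_ac)
  qed
  \<comment> \<open>\<open>C1\<close> bounds the functional that maps \<open>w\<close> to
    \<open>y \<bullet> (P *v (B *v w))\<close> for \<open>y\<close> on the unit sphere; this \<eta>
    makes either error exactly affordable.\<close>
  define \<eta> where "\<eta> = \<rho> * a / (4 * C1)"
  have \<eta>: "\<eta> > 0" "C1 * \<eta> = \<rho> * a / 4" using \<rho>_pos a_pos C1 by (auto simp: \<eta>_def)
  obtain e where e: "0 < e" "e \<le> 1"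
    "\<And>y z. N y = 1 \<Longrightarrow> V (z - y) \<le> e \<Longrightarrow> norm (\<Phi> z - K *v y) \<le> \<eta>"
    using \<Phi>_near_unit[OF \<eta>(1)] by blast
  show ?thesis
  proof (rule that[OF e(1) \<eta>(1)])
    fix q :: "real^'n \<Rightarrow> real^'n" and L H
    assume q: "\<And>x. V (q x - x) \<le> e * V x" and L: "0 \<le> L" "ereal L < H"
      and K0: "\<And>x. L < V x \<Longrightarrow> ereal (V x) < H \<Longrightarrow> norm (K0 *v (q x - x)) \<le> \<eta> * V x powr (1 + \<mu>)"
    have "grad x \<bullet> vfield q x \<le> - (\<rho> / 2) * V x powr \<mu> * rate x" if x: "L < V x" "ereal (V x) < H" for x
    proof -
      have "0 < V x" using x L by linarith
      then have x0: "x \<noteq> 0" by simp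
      define z where "z = d (- ln (V x)) *v q x"
      have "unit x \<bullet> (P *v (B *v (\<Phi> z - K *v unit x))) \<le> C1 * norm (\<Phi> z - K *v unit x)"
        by (rule le[OF N_unit'[OF x0]])
      also have "\<dots> \<le> C1 * \<eta>"
        using e(3)[OF N_unit'[OF x0] V_rescaled_error[of x q e, OF x0 q]] C1 by (simp add: z_def)
      finally have 1: "unit x \<bullet> (P *v (B *v (\<Phi> z - K *v unit x))) \<le> \<rho> * a / 4" by (simp add: \<eta>)
      have "unit x \<bullet> (P *v (B *v (K0 *v (q x - x)))) \<le> C1 * norm (K0 *v (q x - x))"
        by (rule le[OF N_unit'[OF x0]])
      also have "\<dots> \<le> C1 * (\<eta> * V x powr (1 + \<mu>))"
        using K0[OF x] C1 by simp
      also have "\<dots> = (C1 * \<eta>) * V x powr \<mu> * V x"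
        using V_nonneg[of x] by (simp add: powr_add mult_ac)
      finally have 2: "unit x \<bullet> (P *v (B *v (K0 *v (q x - x)))) / V x \<le> \<rho> * a / 4 * V x powr \<mu>"
        using \<open>0 < V x\<close> unfolding \<eta> by (simp only: pos_divide_le_eq)
      have "\<rho> * a \<le> \<rho> * rate x" using a_le_rate[OF x0] \<rho>_pos by simp
      then have "- \<rho> * rate x + \<rho> * a / 4 + \<rho> * a / 4 \<le> - (\<rho> / 2) * rate x" by linarith
      then have "V x powr \<mu> * (- \<rho> * rate x + \<rho> * a / 4 + \<rho> * a / 4) \<le> V x powr \<mu> * (- (\<rho> / 2) * rate x)"
        by (intro mult_left_mono) auto
      moreover have "V x powr \<mu> * (- \<rho> * rate x + unit x \<bullet> (P *v (B *v (\<Phi> z - K *v unit x))))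
          \<le> V x powr \<mu> * (- \<rho> * rate x + \<rho> * a / 4)"
        using 1 by (intro mult_left_mono) auto
      moreover have "V x powr \<mu> * (- \<rho> * rate x + \<rho> * a / 4) + \<rho> * a / 4 * V x powr \<mu>
          = V x powr \<mu> * (- \<rho> * rate x + \<rho> * a / 4 + \<rho> * a / 4)"
        by (simp add: algebra_simps)
      ultimately have "grad x \<bullet> vfield q x \<le> V x powr \<mu> * (- (\<rho> / 2) * rate x)"
        using 2 unfolding grad_vfield[OF x0] z_def[symmetric] by linarith
      then show ?thesis by (simp add: mult_ac)
    qed
    moreover have "\<exists>r>0. \<exists>M. \<forall>z\<in>ball x r. norm (vfield q z) \<le> M" if "L < V x" for x
    proof (rule vfield_locally_bounded[OF e(3,2) q])
      show "x \<noteq> 0" using that L by auto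
    qed
    ultimately show "dissipative (vfield q) \<mu> (\<rho> / 2) L H"
      using \<rho>_pos L by (simp add: dissipative_def)
  qed
qed

text \<open>Near the origin \<open>N x\<close> is at most \<open>V x powr a\<close>; since
  \<open>a > 1 + \<mu>\<close>, the surplus power \<open>p\<close> of \<open>V\<close> outweighs any
  constant.\<close>

lemma small_K0_error_near_0:
  assumes q: "\<And>x. N (q x - x) \<le> \<kappa> * N x" and "0 \<le> \<kappa>" "0 < \<eta>" "1 + \<mu> < a"
  obtains H where "0 < H" "\<And>x. V x < H \<Longrightarrow> norm (K0 *v (q x - x)) \<le> \<eta> * V x powr (1 + \<mu>)"
proof -
  obtain k where k: "k > 0" "\<And>x. norm (K0 *v x) \<le> k * N x"
    using bound_by_N[of K0] by blast
  define p where "p = a - (1 + \<mu>)"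
  have p: "p > 0" "a = p + (1 + \<mu>)" using assms by (auto simp: p_def)
  \<comment> \<open>\<open>H \<le> 1\<close> admits the exponent \<open>a\<close>; the other bound
    solves \<open>(k * \<kappa> + 1) * V powr p = \<eta>\<close>, with 1 added so that
    \<open>\<kappa> = 0\<close> causes no division by 0.\<close>
  define H where "H = min 1 ((\<eta> / (k * \<kappa> + 1)) powr (1 / p))"
  have kk: "k * \<kappa> \<ge> 0" using k assms by simp
  show ?thesis
  proof (rule that[of H])
    show "0 < H" using assms kk by (simp add: H_def)
    fix x assume VH: "V x < H"
    have "V x powr p \<le> ((\<eta> / (k * \<kappa> + 1)) powr (1 / p)) powr p"
      using VH p V_nonneg by (intro powr_mono2) (auto simp: H_def)
    also have "\<dots> = \<eta> / (k * \<kappa> + 1)" using p assms kk by (simp add: powr_powr)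
    finally have Vp: "(k * \<kappa> + 1) * V x powr p \<le> \<eta>" using kk by (simp add: pos_le_divide_eq mult.commute)
    have "norm (K0 *v (q x - x)) \<le> k * (\<kappa> * N x)"
      using k(1) q by (intro order_trans[OF k(2)] mult_left_mono) auto
    also have "\<dots> \<le> (k * \<kappa>) * V x powr a"
      using kk N_le_V(1)[of x] VH by (simp add: H_def mult_left_mono flip: mult.assoc)
    also have "\<dots> \<le> (k * \<kappa> + 1) * V x powr a" by (intro mult_right_mono) auto
    also have "\<dots> = ((k * \<kappa> + 1) * V x powr p) * V x powr (1 + \<mu>)"
      unfolding p(2) powr_add by simp
    also have "\<dots> \<le> \<eta> * V x powr (1 + \<mu>)" using Vp by (intro mult_right_mono) auto
    finally show "norm (K0 *v (q x - x)) \<le> \<eta> * V x powr (1 + \<mu>)" .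
  qed
qed

text \<open>Counterpart for large states: there \<open>N x\<close> is at most
  \<open>V x powr b\<close>, and \<open>1 + \<mu>\<close> exceeds \<open>b\<close> by the helpful
  power \<open>p\<close>.\<close>

lemma small_K0_error_near_infinity:
  assumes q: "\<And>x. N (q x - x) \<le> \<kappa> * N x" and "0 \<le> \<kappa>" "0 < \<eta>" "b < 1 + \<mu>"
  obtains L where "0 < L" "\<And>x. L < V x \<Longrightarrow> norm (K0 *v (q x - x)) \<le> \<eta> * V x powr (1 + \<mu>)"
proof -
  obtain k where k: "k > 0" "\<And>x. norm (K0 *v x) \<le> k * N x"
    using bound_by_N[of K0] by blast
  define p where "p = (1 + \<mu>) - b"
  have p: "p > 0" "1 + \<mu> = p + b" using assms by (auto simp: p_def)
  define L where "L = max 1 (((k * \<kappa> + 1) / \<eta>) powr (1 / p))"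
  have kk: "k * \<kappa> \<ge> 0" using k assms by simp
  show ?thesis
  proof (rule that[of L])
    show "0 < L" by (simp add: L_def)
    fix x assume VL: "L < V x"
    have "(k * \<kappa> + 1) / \<eta> = (((k * \<kappa> + 1) / \<eta>) powr (1 / p)) powr p"
      using p assms kk by (simp add: powr_powr)
    also have "\<dots> \<le> V x powr p"
      using VL p by (intro powr_mono2) (auto simp: L_def)
    finally have Vp: "k * \<kappa> + 1 \<le> \<eta> * V x powr p" using assms by (simp add: pos_divide_le_eq mult.commute)
    have "norm (K0 *v (q x - x)) \<le> k * (\<kappa> * N x)"
      using k(1) q by (intro order_trans[OF k(2)] mult_left_mono) auto
    also have "\<dots> \<le> (k * \<kappa>) * V x powr b"
      using kk N_le_V(2)[of x] VL by (simp add: L_def mult_left_mono flip: mult.assoc)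
    also have "\<dots> \<le> (\<eta> * V x powr p) * V x powr b" using Vp by (intro mult_right_mono) auto
    also have "\<dots> = \<eta> * V x powr (1 + \<mu>)" unfolding p(2) powr_add by simp
    finally show "norm (K0 *v (q x - x)) \<le> \<eta> * V x powr (1 + \<mu>)" .
  qed
qed

end

section \<open>The linear matrix equations\<close>

text \<open>The definition of \<open>K0\<close> amounts to \<open>K0 ** G0 = Y0 + K0\<close>.
  Inserted into the equation for \<open>A\<close>, and with \<open>G0 ** B = 0\<close>, it yields
  \<open>A0 ** G0 = G0 ** A0 + A0\<close>, of which the claim is the multiple by \<mu>.\<close>

lemma homogeneous_closed_loop:
  fixes A G0 A0 Gd :: "real^'n^'n" and B :: "real^'m^'n" and Y0 K0 :: "real^'n^'m"
  assumes eq: "A ** G0 + B ** Y0 = G0 ** A + A" and G0B: "G0 ** B = 0"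
    and inv: "invertible (G0 - mat 1)" and K0: "K0 = Y0 ** matrix_inv (G0 - mat 1)"
    and A0: "A0 = A + B ** K0" and Gd: "Gd = mat 1 + \<mu> *\<^sub>R G0"
  shows "A0 ** Gd = Gd ** A0 + \<mu> *\<^sub>R A0" and "Gd ** B = B"
proof -
  note bl = bounded_bilinear_matrix_mult
  note simps = bounded_bilinear.add_left[OF bl] bounded_bilinear.add_right[OF bl]
    bounded_bilinear.scaleR_left[OF bl] bounded_bilinear.scaleR_right[OF bl]
    bounded_bilinear.diff_right[OF bl]
  have "K0 ** (G0 - mat 1) = Y0"
    by (simp add: K0 matrix_inv_mult[OF inv] flip: matrix_mul_assoc)
  then have K0G0: "K0 ** G0 = Y0 + K0" by (simp add: simps algebra_simps)
  have "A0 ** G0 = A ** G0 + B ** (K0 ** G0)" by (simp add: A0 simps matrix_mul_assoc)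
  also have "\<dots> = (A ** G0 + B ** Y0) + B ** K0" by (simp add: K0G0 simps)
  also have "\<dots> = G0 ** A + A0" by (simp add: eq A0)
  also have "G0 ** A = G0 ** A0" using G0B by (simp add: A0 simps matrix_mul_assoc bounded_bilinear.zero_left[OF bl])
  finally have "A0 ** G0 = G0 ** A0 + A0" .
  then show "A0 ** Gd = Gd ** A0 + \<mu> *\<^sub>R A0" by (simp add: Gd simps scaleR_add_right)
  show "Gd ** B = B" by (simp add: Gd simps G0B)
qed

lemma transpose_inner: "x \<bullet> (transpose M *v y) = y \<bullet> (M *v x)" for M :: "real^'n^'m"
  by (metis dot_lmul_matrix inner_commute transpose_matrix_vector)

text \<open>The substitution \<open>w = matrix_inv X *v y\<close> turns the form of the symmetric
  matrix at \<open>w\<close> into twice the desired form at \<open>y\<close>.\<close>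

lemma matrix_inv_posdef_form:
  fixes X Gd :: "real^'n^'n"
  assumes X: "posdef X" and XG: "posdef (X ** transpose Gd + Gd ** X)" and "y \<noteq> 0"
  shows "0 < y \<bullet> (matrix_inv X *v (Gd *v y))"
proof -
  note inv = matrix_inv_mult[OF posdef_invertible[OF X]]
  define w where "w = matrix_inv X *v y"
  have Xw: "X *v w = y" by (simp add: w_def matrix_vector_mul_assoc inv)
  then have "w \<noteq> 0" using \<open>y \<noteq> 0\<close> by auto
  have "w \<bullet> ((X ** transpose Gd + Gd ** X) *v w) = w \<bullet> (X *v (transpose Gd *v w)) + w \<bullet> (Gd *v y)"
    by (simp add: matrix_vector_mult_add_rdistrib inner_add_right Xw del: transpose_matrix_vector flip: matrix_vector_mul_assoc)
  also have "w \<bullet> (X *v (transpose Gd *v w)) = w \<bullet> (Gd *v y)"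
    unfolding symmetric_inner[OF posdefD(1)[OF X]] Xw by (rule transpose_inner)
  also have "w \<bullet> (Gd *v y) = y \<bullet> (matrix_inv X *v (Gd *v y))"
    unfolding w_def by (rule symmetric_inner[OF posdefD(1)[OF posdef_matrix_inv[OF X]], symmetric])
  finally show ?thesis using posdefD(2)[OF XG \<open>w \<noteq> 0\<close>] by simp
qed

text \<open>The matrix equation is tested at \<open>w = matrix_inv X *v y\<close>. Every term
  contributes the same number as its transpose, so the equation is twice the claim.\<close>

lemma Lyapunov_identity:
  fixes X A0 Gd :: "real^'n^'n" and B :: "real^'m^'n" and Y :: "real^'n^'m"
  assumes X: "posdef X"
    and eq: "X ** transpose A0 + A0 ** X + transpose Y ** transpose B + B ** Y
           + \<rho> *\<^sub>R (X ** transpose Gd + Gd ** X) = 0"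
  shows "y \<bullet> (matrix_inv X *v (A0 *v y + B *v ((Y ** matrix_inv X) *v y)))
       = - \<rho> * (y \<bullet> (matrix_inv X *v (Gd *v y)))"
proof -
  note inv = matrix_inv_mult[OF posdef_invertible[OF X]]
  define w where "w = matrix_inv X *v y"
  have Xw: "X *v w = y" by (simp add: w_def matrix_vector_mul_assoc inv)
  have wy: "y \<bullet> (matrix_inv X *v v) = w \<bullet> v" for v
    unfolding w_def by (rule symmetric_inner[OF posdefD(1)[OF posdef_matrix_inv[OF X]]])
  have XT: "w \<bullet> (X *v (transpose M *v w)) = w \<bullet> (M *v y)" for M
    unfolding symmetric_inner[OF posdefD(1)[OF X]] Xw by (rule transpose_inner)
  have YT: "w \<bullet> (transpose Y *v (transpose B *v w)) = w \<bullet> (B *v (Y *v w))"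
    by (metis transpose_inner inner_commute)
  have "0 = w \<bullet> (X *v (transpose A0 *v w)) + w \<bullet> (A0 *v y) + w \<bullet> (transpose Y *v (transpose B *v w))
      + w \<bullet> (B *v (Y *v w)) + \<rho> * (w \<bullet> (X *v (transpose Gd *v w)) + w \<bullet> (Gd *v y))"
    using arg_cong[OF eq, of "\<lambda>M. w \<bullet> (M *v w)"]
    by (simp add: matrix_vector_mult_add_rdistrib inner_add_right Xw
        del: transpose_matrix_vector flip: matrix_vector_mul_assoc scaleR_matrix_vector_assoc)
  also have "\<dots> = 2 * (w \<bullet> (A0 *v y) + w \<bullet> (B *v (Y *v w)) + \<rho> * (w \<bullet> (Gd *v y)))"
    unfolding XT YT by (simp add: algebra_simps)
  finally have "w \<bullet> (A0 *v y) + w \<bullet> (B *v (Y *v w)) = - \<rho> * (w \<bullet> (Gd *v y))" by simp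
  moreover have "(Y ** matrix_inv X) *v y = Y *v w" by (simp add: w_def matrix_vector_mul_assoc)
  ultimately show ?thesis by (simp add: wy inner_add_right)
qed

theorem theorem2:
  fixes A G0 A0 Gd X P :: "real^'n^'n"
    and B :: "real^'m^'n"
    and Y0 K0 Y K :: "real^'n^'m"
    and \<mu> \<rho> \<eta>max \<eta>min :: real
  assumes "controllable A B"
    and "A ** G0 + B ** Y0 = G0 ** A + A"
    and "G0 ** B = 0"
    and "invertible (G0 - mat 1)"
    and "\<forall>\<mu>'\<in>{-1..1 / real CARD('n)}. anti_Hurwitz (mat 1 + \<mu>' *\<^sub>R G0)"
    and "K0 = Y0 ** matrix_inv (G0 - mat 1)"
    and "A0 = A + B ** K0"
    and "nilpotent_mat A0"
    and "\<mu> \<in> {-1..1 / real CARD('n)}"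
    and "Gd = mat 1 + \<mu> *\<^sub>R G0"
    and "\<rho> > 0"
    and "X ** transpose A0 + A0 ** X + transpose Y ** transpose B + B ** Y
           + \<rho> *\<^sub>R (X ** transpose Gd + Gd ** X) = 0"
    and "posdef (X ** transpose Gd + Gd ** X)"
    and "posdef X"
    and "K = Y ** matrix_inv X"
    and "P = matrix_inv X"
    and "\<eta>max = 1/2 * lambda_max (msqrt P ** Gd ** matrix_inv (msqrt P)
                                 + matrix_inv (msqrt P) ** transpose Gd ** msqrt P)"
    and "\<eta>min = 1/2 * lambda_min (msqrt P ** Gd ** matrix_inv (msqrt P)
                                 + matrix_inv (msqrt P) ** transpose Gd ** msqrt P)"
  shows "\<exists>\<epsilon>0>0. \<forall>\<epsilon>\<in>{0<..<\<epsilon>0}. \<forall>q :: real^'n \<Rightarrow> real^'n.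
    quantizer q \<and> (\<forall>x. hnorm P Gd (q x - x) \<le> \<epsilon> * hnorm P Gd x) \<longrightarrow>
    (let f = (\<lambda>x. A *v x + B *v feedback K0 K P Gd \<mu> (q x)) in
      (K0 = 0 \<longrightarrow>
         (\<mu> < 0 \<longrightarrow> globally_finite_time_stable (wnorm P) f) \<and>
         (\<mu> > 0 \<longrightarrow> nearly_fixed_time_stable (wnorm P) f)) \<and>
      (K0 \<noteq> 0 \<and> (\<exists>\<kappa>\<ge>0. \<forall>x. wnorm P (q x - x) \<le> \<kappa> * wnorm P x) \<longrightarrow>
         (\<mu> < min (\<eta>min - 1) 0 \<longrightarrow> locally_finite_time_stable (wnorm P) f) \<and>
         (\<mu> > max (\<eta>max - 1) 0 \<longrightarrow> practically_fixed_time_stable (wnorm P) f)))"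
proof -
  note eq = assms(2) and G0B = assms(3) and inv = assms(4) and K0 = assms(6) and A0 = assms(7)
    and Gd = assms(10) and \<rho> = assms(11) and lyap = assms(12) and XG = assms(13) and X = assms(14)
    and K = assms(15) and P = assms(16) and \<eta>max = assms(17) and \<eta>min = assms(18)
  have pdP: "posdef P" unfolding P by (rule posdef_matrix_inv[OF X])
  have max: "\<eta>max = 1/2 * lambda_max (weighted_sym P Gd)" and min: "\<eta>min = 1/2 * lambda_min (weighted_sym P Gd)"
    by (simp_all add: \<eta>max \<eta>min weighted_sym_def)
  have "0 < \<eta>min"
    using lambda_min_weighted_sym_pos[OF pdP, of Gd] matrix_inv_posdef_form[OF X XG] by (simp add: min P)
  interpret closed_loop P Gd \<eta>min \<eta>max A0 B K0 K \<mu> \<rho>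
  proof
    show "posdef P" "0 < \<eta>min" "0 < \<rho>" by fact+
    show "\<eta>min * (y \<bullet> (P *v y)) \<le> y \<bullet> (P *v (Gd *v y))" "y \<bullet> (P *v (Gd *v y)) \<le> \<eta>max * (y \<bullet> (P *v y))" for y
      unfolding max min by (rule weighted_Rayleigh[OF pdP])+
    show "A0 ** Gd = Gd ** A0 + \<mu> *\<^sub>R A0" "Gd ** B = B"
      by (rule homogeneous_closed_loop[OF eq G0B inv K0 A0 Gd])+
    show "y \<bullet> (P *v (A0 *v y + B *v (K *v y))) = - \<rho> * (y \<bullet> (P *v (Gd *v y)))" for y
      unfolding P K by (rule Lyapunov_identity[OF X lyap])
  qed
  have f: "(\<lambda>x. A *v x + B *v feedback K0 K P Gd \<mu> (q x)) = vfield q" for q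
  proof
    fix x
    have "A *v x = A0 *v x - B *v (K0 *v x)"
      by (simp add: A0 matrix_vector_mult_add_rdistrib matrix_vector_mul_assoc)
    then show "A *v x + B *v feedback K0 K P Gd \<mu> (q x) = vfield q x"
      by (simp add: feedback_eq vfield_def algebra_simps)
  qed
  \<comment> \<open>\<open>e\<close> serves as \<epsilon>0: it is fixed before \<open>q\<close> and
    \<kappa>, which afterwards influence only the levels \<open>H\<close> and
    \<open>L\<close>.\<close>
  obtain e \<eta> where e: "0 < e" and \<eta>: "0 < \<eta>"
    and dis: "\<And>q L H. (\<And>x. V (q x - x) \<le> e * V x) \<Longrightarrow> 0 \<le> L \<Longrightarrow> ereal L < H \<Longrightarrow>
      (\<And>x. L < V x \<Longrightarrow> ereal (V x) < H \<Longrightarrow> norm (K0 *v (q x - x)) \<le> \<eta> * V x powr (1 + \<mu>)) \<Longrightarrow>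
      dissipative (vfield q) \<mu> (\<rho> / 2) L H"
    by (rule vfield_dissipative) blast
  show ?thesis
  proof (intro exI[of _ e] conjI e ballI allI impI, unfold f Let_def, intro conjI impI)
    fix \<epsilon> q
    assume \<epsilon>: "\<epsilon> \<in> {0<..<e}" and q: "quantizer q \<and> (\<forall>x. V (q x - x) \<le> \<epsilon> * V x)"
    have qe: "V (q x - x) \<le> e * V x" for x
      using q \<epsilon> order_trans[OF _ mult_right_mono[OF _ V_nonneg], of "V (q x - x)" \<epsilon> x e] by auto
    {
      assume "K0 = 0"
      then have d: "dissipative (vfield q) \<mu> (\<rho> / 2) 0 \<infinity>"
        using \<eta> by (intro dis qe) auto
      show "globally_finite_time_stable N (vfield q)" if "\<mu> < 0"
        using dissipative_finite_time_stable[OF d that] by (simp add: globally_finite_time_stable_def)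
      show "nearly_fixed_time_stable N (vfield q)" if "\<mu> > 0"
        by (rule dissipative_nearly_fixed_time_stable[OF d that])
    }
    {
      assume "K0 \<noteq> 0 \<and> (\<exists>\<kappa>\<ge>0. \<forall>x. N (q x - x) \<le> \<kappa> * N x)"
      then obtain \<kappa> where \<kappa>: "0 \<le> \<kappa>" "\<And>x. N (q x - x) \<le> \<kappa> * N x" by blast
      show "locally_finite_time_stable N (vfield q)" if "\<mu> < min (\<eta>min - 1) 0"
      proof -
        have \<mu>: "1 + \<mu> < \<eta>min" "\<mu> < 0" using that by auto
        obtain H where H: "0 < H" "\<And>x. V x < H \<Longrightarrow> norm (K0 *v (q x - x)) \<le> \<eta> * V x powr (1 + \<mu>)"
          using small_K0_error_near_0[OF \<kappa>(2,1) \<eta> \<mu>(1)] by blast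
        have "dissipative (vfield q) \<mu> (\<rho> / 2) 0 (ereal H)"
          using H by (intro dis qe) auto
        from dissipative_finite_time_stable[OF this \<mu>(2)]
        have "finite_time_stable_on N (vfield q) {x. V x < H}" by simp
        moreover have "open {x. V x < H}" by (intro open_Collect_less continuous_intros)
        ultimately show ?thesis unfolding locally_finite_time_stable_def using H(1) by auto
      qed
      show "practically_fixed_time_stable N (vfield q)" if "\<mu> > max (\<eta>max - 1) 0"
      proof -
        have \<mu>: "\<eta>max < 1 + \<mu>" "\<mu> > 0" using that by auto
        obtain L where L: "0 < L" "\<And>x. L < V x \<Longrightarrow> norm (K0 *v (q x - x)) \<le> \<eta> * V x powr (1 + \<mu>)"
          using small_K0_error_near_infinity[OF \<kappa>(2,1) \<eta> \<mu>(1)] by blast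
        have "dissipative (vfield q) \<mu> (\<rho> / 2) L \<infinity>"
          using L by (intro dis qe) auto
        then show ?thesis by (rule dissipative_practically_fixed_time_stable) (use \<mu> L in auto)
      qed
    }
  qed
qed

end
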